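(* Let $a_n\to\infty$, let $t=t_n$ be determined by $m(t)=a_n$, and write $s=s(t)$, $\mu_3=\mu_3(t)$. Let $Y_1$ be a random variable with density $p_{a_n}$, i.e. with law $P_{a_n}$. (i) If $\lim_{n\to\infty}\frac{a_n}{s\sqrt n}=0$, then $$p_{a_n}(Y_1)=\pi^{a_n}(Y_1)(1+R_n),$$ where $R_n$ is a function of $Y_1$ such that $P_{a_n}\big(|R_n|>\delta/\sqrt n\big)\to0$ as $n\to\infty$ for every $\delta>0$. (ii) If $0<\liminf_{n\to\infty}\frac{a_n}{s\sqrt n}\le\limsup_{n\to\infty}\frac{a_n}{s\sqrt n}<\infty$, then $$p_{a_n}(Y_1)=g_{a_n}(Y_1)(1+R_n'),$$ where $R_n'$ is a function of $Y_1$ such that $P_{a_n}(|R_n'|>\delta)\to0$ as $n\to\infty$ for every $\delta>0$. Here $$g_{a_n}(x):=C\,p(x)\,\mathfrak{n}(\alpha\beta+a_n,\beta,x),\qquad \alpha:=t+\frac{\mu_3}{2(n-1)s^2},\qquad \beta:=(n-1)s^2,$$ where $\mathfrak{n}(\mu,\sigma^2,x)$ is the normal density with expectation $\mu$ and variance $\sigma^2$ evaluated at $x$ and $C=C_n$ is the normalizing constant making $g_{a_n}$ a probability density.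
   Context: Standing setting. $X_1,X_2,\dots$ are i.i.d. non-negative unbounded random variables with density $p$ on $\mathbb{R}_+$ of the form $p(x)=\exp(-(g(x)-q(x)))$, $x\ge 0$ ($p=0$ on $(-\infty,0)$), where $g$ is positive, convex, four times differentiable, $g(x)/x\to\infty$ as $x\to\infty$, and $q$ is bounded. Put $h=g'$ and let $\psi=h^{\leftarrow}$ be the inverse of $h$ (for large arguments). $RV(\alpha)$ denotes the functions on $\mathbb{R}_+$ regularly varying at infinity with index $\alpha$. It is assumed that $h\in\mathcal{R}$, i.e. one of the following holds. (Regularly varying case) $h(x)=x^{\beta_0}l(x)$ for some $\beta_0>0$, with $l(x)=c\exp\int_1^x\frac{\epsilon(u)}{u}du$, $c>0$, $\epsilon$ twice differentiable, $\epsilon(x)=o(1)$, $x|\epsilon'(x)|=O(1)$, $x^2|\epsilon''(x)|=O(1)$ as $x\to\infty$; moreover $|h''|\in RV(\theta)$ for some real $\theta\le\beta_0-2$, and $|q|\in RV(\eta)$ for some $\eta<\theta-\frac{3\beta_0}{2}-\frac32$. (Rapidly varying case) $h$ is rapidly varying at infinity, $\psi\in RV(0)$ with $\psi(t)=c\exp\int_1^t\frac{\epsilon(u)}{u}du$, $c>0$, $\epsilon$ twice differentiable, $\epsilon(t)=o(1)$, $t\epsilon'(t)/\epsilon(t)\to0$, $t^2\epsilon''(t)/\epsilon(t)\to0$ as $t\to\infty$; moreover $|q(\psi(t))|\in RV(\eta)$ as a function of $t$, for some $\eta<-\frac12$. $\Phi(t)=E[e^{tX_1}]$ (finite for all $t\ge0$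 and in a neighborhood of $0$), $m(t)=\frac{d}{dt}\log\Phi(t)$, $s^2(t)=m'(t)$ with $s(t)>0$, $\mu_3(t)=\frac{d^3}{dt^3}\log\Phi(t)$. The tilted density is $\pi_t(x)=e^{tx}p(x)/\Phi(t)$; for $a$ in the range of $m$, $\pi^a:=\pi_t$ where $t$ is the unique solution of $m(t)=a$. $S_1^n=X_1+\dots+X_n$; $p_{a_n}(\cdot)=p(X_1=\cdot\mid S_1^n=na_n)$ is the conditional density of $X_1$ given $S_1^n=na_n$ and $P_{a_n}$ is the probability measure with density $p_{a_n}$. *)

theory Defs
  imports "HOL-Probability.Probability" "HOL-Library.Landau_Symbols"
begin

text \<open>
  \<open>D 0 = f\<close>, and \<open>D 1, ..., D k\<close> are the successive derivatives of \<open>f\<close> on \<open>S\<close>, so \<open>f\<close> is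
  \<open>k\<close> times differentiable there; at the boundary point of a half-line the derivatives are one-sided.
\<close>
definition derivs_on :: "nat \<Rightarrow> real set \<Rightarrow> (real \<Rightarrow> real) \<Rightarrow> (nat \<Rightarrow> real \<Rightarrow> real) \<Rightarrow> bool" where
  "derivs_on k S f D \<longleftrightarrow>
     D 0 = f \<and> (\<forall>i<k. \<forall>x\<in>S. (D i has_real_derivative D (Suc i) x) (at x within S))"

text \<open>
  Only a neighbourhood of infinity matters in the next three definitions, since inverse functions
  such as \<open>\<psi>\<close> below are determined for large arguments only.
\<close>
definition regularly_varying :: "real \<Rightarrow> (real \<Rightarrow> real) \<Rightarrow> bool" where
  "regularly_varying \<alpha> f \<longleftrightarrow>
     (\<exists>A. set_borel_measurable borel {A..} f) \<and>
     (\<forall>\<^sub>F x in at_top. f x > 0) \<and>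
     (\<forall>c>0. ((\<lambda>x. f (c * x) / f x) \<longlongrightarrow> c powr \<alpha>) at_top)"

definition rapidly_varying :: "(real \<Rightarrow> real) \<Rightarrow> bool" where
  "rapidly_varying f \<longleftrightarrow>
     (\<exists>A. set_borel_measurable borel {A..} f) \<and>
     (\<forall>\<^sub>F x in at_top. f x > 0) \<and>
     (\<forall>c>1. filterlim (\<lambda>x. f (c * x) / f x) at_top at_top) \<and>
     (\<forall>c. 0 < c \<and> c < 1 \<longrightarrow> ((\<lambda>x. f (c * x) / f x) \<longlongrightarrow> 0) at_top)"

definition inverse_at_top :: "(real \<Rightarrow> real) \<Rightarrow> (real \<Rightarrow> real) \<Rightarrow> bool" where
  "inverse_at_top h \<psi> \<longleftrightarrow>
     (\<forall>\<^sub>F x in at_top. \<psi> (h x) = x) \<and> (\<forall>\<^sub>F u in at_top. \<psi> u \<ge> 0 \<and> h (\<psi> u) = u)"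

definition karamata :: "real \<Rightarrow> (real \<Rightarrow> real) \<Rightarrow> real \<Rightarrow> real" where
  "karamata c \<epsilon> x = c * exp (integral {1..x} (\<lambda>u. \<epsilon> u / u))"

text \<open>
  In the next two definitions \<open>E 1\<close> and \<open>E 2\<close> are the first two derivatives of \<open>\<epsilon> = E 0\<close>, and
  \<open>h2\<close> stands for the second derivative of \<open>h\<close>.
\<close>
definition regular_case :: "(real \<Rightarrow> real) \<Rightarrow> (real \<Rightarrow> real) \<Rightarrow> (real \<Rightarrow> real) \<Rightarrow> bool" where
  "regular_case h h2 q \<longleftrightarrow>
     (\<exists>\<beta>0 c \<epsilon> E \<theta> \<eta>.
        \<beta>0 > 0 \<and> c > 0 \<and>
        (\<forall>\<^sub>F x in at_top. h x = x powr \<beta>0 * karamata c \<epsilon> x) \<and>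
        derivs_on 2 {1..} \<epsilon> E \<and>
        (\<epsilon> \<longlongrightarrow> 0) at_top \<and>
        (\<lambda>x. x * \<bar>E 1 x\<bar>) \<in> O[at_top](\<lambda>_. 1) \<and>
        (\<lambda>x. x\<^sup>2 * \<bar>E 2 x\<bar>) \<in> O[at_top](\<lambda>_. 1) \<and>
        \<theta> \<le> \<beta>0 - 2 \<and> regularly_varying \<theta> (\<lambda>x. \<bar>h2 x\<bar>) \<and>
        \<eta> < \<theta> - 3 * \<beta>0 / 2 - 3 / 2 \<and> regularly_varying \<eta> (\<lambda>x. \<bar>q x\<bar>))"

text \<open>
  The non-vanishing of \<open>\<epsilon>\<close> is what gives the quotients by \<open>\<epsilon>\<close> their meaning; it is spelled out
  because division by zero is total.
\<close>
definition rapid_case :: "(real \<Rightarrow> real) \<Rightarrow> (real \<Rightarrow> real) \<Rightarrow> bool" where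
  "rapid_case h q \<longleftrightarrow>
     rapidly_varying h \<and>
     (\<exists>\<psi> c \<epsilon> E \<eta>.
        inverse_at_top h \<psi> \<and> regularly_varying 0 \<psi> \<and>
        c > 0 \<and>
        (\<forall>\<^sub>F u in at_top. \<psi> u = karamata c \<epsilon> u) \<and>
        derivs_on 2 {1..} \<epsilon> E \<and>
        (\<epsilon> \<longlongrightarrow> 0) at_top \<and>
        (\<forall>\<^sub>F u in at_top. \<epsilon> u \<noteq> 0) \<and>
        ((\<lambda>u. u * E 1 u / \<epsilon> u) \<longlongrightarrow> 0) at_top \<and>
        ((\<lambda>u. u\<^sup>2 * E 2 u / \<epsilon> u) \<longlongrightarrow> 0) at_top \<and>
        \<eta> < - 1 / 2 \<and> regularly_varying \<eta> (\<lambda>u. \<bar>q (\<psi> u)\<bar>))"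

definition mgf :: "'a measure \<Rightarrow> ('a \<Rightarrow> real) \<Rightarrow> real \<Rightarrow> real" where
  "mgf M Y t = integral\<^sup>L M (\<lambda>\<omega>. exp (t * Y \<omega>))"

definition tilt_mean :: "'a measure \<Rightarrow> ('a \<Rightarrow> real) \<Rightarrow> real \<Rightarrow> real" where
  "tilt_mean M Y = deriv (\<lambda>t. ln (mgf M Y t))"

definition tilt_sd :: "'a measure \<Rightarrow> ('a \<Rightarrow> real) \<Rightarrow> real \<Rightarrow> real" where
  "tilt_sd M Y t = sqrt (deriv (tilt_mean M Y) t)"

definition tilt_mu3 :: "'a measure \<Rightarrow> ('a \<Rightarrow> real) \<Rightarrow> real \<Rightarrow> real" where
  "tilt_mu3 M Y = (deriv ^^ 3) (\<lambda>t. ln (mgf M Y t))"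

definition tilted_density :: "'a measure \<Rightarrow> ('a \<Rightarrow> real) \<Rightarrow> (real \<Rightarrow> real) \<Rightarrow> real \<Rightarrow> real \<Rightarrow> real" where
  "tilted_density M Y p t x = exp (t * x) * p x / mgf M Y t"

text \<open>
  \<open>sum_density p n\<close> is the \<open>n\<close>-fold convolution power of the density \<open>p\<close>, for \<open>n \<ge> 1\<close>
  (the value at \<open>0\<close> is junk).
\<close>
fun sum_density :: "(real \<Rightarrow> real) \<Rightarrow> nat \<Rightarrow> real \<Rightarrow> ennreal" where
  "sum_density p 0 = (\<lambda>x. 0)"
| "sum_density p (Suc 0) = (\<lambda>x. ennreal (p x))"
| "sum_density p (Suc (Suc n)) =
     (\<lambda>x. \<integral>\<^sup>+y. ennreal (p (x - y)) * sum_density p (Suc n) y \<partial>lborel)"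

lemma (in prob_space) distributed_sum_density:
  fixes X :: "nat \<Rightarrow> 'a \<Rightarrow> real"
  assumes "finite I" "I \<noteq> {}" "indep_vars (\<lambda>_. borel) X I"
    and "\<And>i. i \<in> I \<Longrightarrow> distributed M lborel (X i) (\<lambda>x. ennreal (p x))"
  shows "distributed M lborel (\<lambda>\<omega>. \<Sum>i\<in>I. X i \<omega>) (sum_density p (card I))"
  using assms
proof (induction I rule: finite_ne_induct)
  case (singleton i)
  then show ?case by simp
next
  case (insert i I)
  have 1: "distributed M lborel (\<lambda>\<omega>. \<Sum>i\<in>I. X i \<omega>) (sum_density p (card I))"
    using insert.prems by (intro insert.IH) (auto intro: indep_vars_subset)
  have 2: "indep_var borel (X i) borel (\<lambda>\<omega>. \<Sum>i\<in>I. X i \<omega>)"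
    using insert.hyps insert.prems by (intro indep_vars_sum) auto
  have 3: "distributed M lborel (\<lambda>\<omega>. X i \<omega> + (\<Sum>i\<in>I. X i \<omega>))
      (\<lambda>x. \<integral>\<^sup>+y. ennreal (p (x - y)) * sum_density p (card I) y \<partial>lborel)"
    using insert.prems 1 by (intro distributed_convolution[OF 2]) auto
  obtain k where k: "card I = Suc k"
    using insert.hyps by (cases "card I") auto
  show ?case
    using 3 insert.hyps by (simp add: k)
qed

text \<open>
  Density of \<open>X\<^sub>1\<close> at \<open>x\<close> given \<open>S\<^sub>1\<^sup>n = w\<close>: the joint density of \<open>X\<^sub>1\<close> and \<open>S\<^sub>1\<^sup>n\<close>, which is
  the density of \<open>X\<^sub>1\<close> at \<open>x\<close> times that of \<open>S\<^sub>2\<^sup>n\<close> at \<open>w - x\<close>, over the density of \<open>S\<^sub>1\<^sup>n\<close> at \<open>w\<close>.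
  The convolution powers fix the pointwise version.
\<close>
definition cond_density :: "(real \<Rightarrow> real) \<Rightarrow> nat \<Rightarrow> real \<Rightarrow> real \<Rightarrow> real" where
  "cond_density p n w x =
     p x * enn2real (sum_density p (n - 1) (w - x)) / enn2real (sum_density p n w)"

definition cond_law :: "(real \<Rightarrow> real) \<Rightarrow> nat \<Rightarrow> real \<Rightarrow> real measure" where
  "cond_law p n w = density lborel (\<lambda>x. ennreal (cond_density p n w x))"

definition normal_tilt :: "(real \<Rightarrow> real) \<Rightarrow> real \<Rightarrow> real \<Rightarrow> real \<Rightarrow> real" where
  "normal_tilt p \<mu> \<sigma> x =
     p x * normal_density \<mu> \<sigma> x / (LINT y|lborel. p y * normal_density \<mu> \<sigma> y)"

text \<open>
  The library's \<open>normal_density\<close> takes the standard deviation, whence \<open>sqrt \<beta>\<close>.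
\<close>
definition approx_density ::
  "'a measure \<Rightarrow> ('a \<Rightarrow> real) \<Rightarrow> (real \<Rightarrow> real) \<Rightarrow> nat \<Rightarrow> real \<Rightarrow> real \<Rightarrow> real \<Rightarrow> real" where
  "approx_density M Y p n a t =
     (let s = tilt_sd M Y t;
          \<alpha> = t + tilt_mu3 M Y t / (2 * (real n - 1) * s\<^sup>2);
          \<beta> = (real n - 1) * s\<^sup>2
      in normal_tilt p (\<alpha> * \<beta> + a) (sqrt \<beta>))"

end

theory Submission
  imports Defs "HOL-Real_Asymp.Real_Asymp"
begin

text \<open>
  Tilting cancels in a conditional density. Write \<open>a = a\<^sub>n\<close>, \<open>t = t\<^sub>n\<close>, \<open>s = s(t)\<close>, and let
  \<open>f z = s * \<pi>\<^sub>t (a + s * z)\<close> be the tilted density in standardized form, so that \<open>f\<close> has mean \<open>0\<close> and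
  variance \<open>1\<close>. If \<open>S\<^sub>k\<close> denotes the \<open>k\<close>-fold convolution power of \<open>f\<close>, then
  \<open>p\<^sub>a(y) = \<pi>\<^sup>a(y) * S\<^sub>n\<^sub>-\<^sub>1(- z) / S\<^sub>n(0)\<close> with \<open>z = (y - a) / s\<close> (lemma \<open>cond_density_tilt\<close>). Everything
  therefore rests on a local limit theorem for \<open>S\<^sub>k\<close> in which the density \<open>f\<close> itself moves with \<open>n\<close>.

  The third moment of \<open>f\<close> tends to \<open>0\<close>. Granted this, the first Edgeworth correction is already
  \<open>o(1 / sqrt n)\<close>, and \<open>S\<^sub>k x = (2 * pi * k) powr (- 1/2) * (exp (- x\<^sup>2 / (2 * k)) + o(1 / sqrt k))\<close> uniformly in \<open>x\<close>.
  For bounded \<open>z\<close> the ratio \<open>S\<^sub>n\<^sub>-\<^sub>1(- z) / S\<^sub>n(0)\<close> is hence \<open>1 + o(1 / sqrt n)\<close>; for all \<open>z\<close> it is at most \<open>2\<close> when \<open>n\<close> is large,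
  so that the conditional law is dominated by twice the tilted law and Chebyshev's inequality confines \<open>Y\<^sub>1\<close> to
  \<open>\<bar>z\<bar> \<le> K\<close> up to probability \<open>2 / K\<^sup>2\<close>. This is part (i).

  The local limit theorem (\<open>local_limit_estimate\<close>) is proved by Fourier inversion and is quantitative: its
  constants depend only on an exponential envelope \<open>f z \<le> A * exp (- c * \<bar>z\<bar>)\<close> and on a lower bound
  \<open>f \<ge> \<kappa>\<close> on \<open>[-1, 1]\<close>. The envelope controls the Taylor expansion of the characteristic function \<open>\<phi>\<close> at \<open>0\<close>, the
  lower bound keeps \<open>\<bar>\<phi>\<bar>\<close> away from \<open>1\<close> elsewhere, and boundedness of \<open>f\<close> makes \<open>\<bar>\<phi>\<bar>\<^sup>2\<close> integrable. Since
  \<open>f\<close> may be discontinuous, inversion is established pointwise from the third convolution power on.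

  That the standardized tilted densities satisfy these bounds uniformly, with vanishing third moment, is
  Laplace's method. Let \<open>x\<close> solve \<open>h x = t\<close> and put \<open>\<sigma> = h'(x) powr (- 1/2)\<close>. At scale \<open>\<sigma>\<close> around \<open>x\<close> the exponent
  \<open>g(x + \<sigma> z) - g x - t \<sigma> z\<close> tends to \<open>z\<^sup>2 / 2\<close> as soon as \<open>h'(x + \<sigma> z) / h'(x) \<rightarrow> 1\<close>, and convexity of \<open>g\<close> turns the
  values at \<open>z = 1\<close> and \<open>z = - 1\<close> into a linear lower bound, hence an integrable envelope. The ratio condition,
  with \<open>x * h' x \<rightarrow> \<infinity>\<close>, is \<open>slowly_changing_curvature\<close>; it follows from Karamata's representation of \<open>h\<close>
  in the regularly varying case and of the inverse of \<open>h\<close> in the rapidly varying case. The perturbation \<open>q\<close>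
  disappears in the limit because a bounded function of negative index of regular variation tends to \<open>0\<close>.

  For part (ii), completing the square shows that \<open>g\<^sub>a\<close> is proportional to
  \<open>\<pi>\<^sup>a(y) * exp (b * z - z\<^sup>2 / (2 * (n - 1)))\<close> with \<open>b = \<mu>\<^sub>3 / (2 * (n - 1) * s)\<close>. Here \<open>b \<rightarrow> 0\<close>, since \<open>\<mu>\<^sub>3 / s\<^sup>3 \<rightarrow> 0\<close> and
  \<open>s\<^sup>2 / n \<rightarrow> 0\<close>: the latter combines \<open>s\<^sup>2 / a \<rightarrow> 0\<close>, again from Laplace's method, with the bound on
  \<open>a / (s * sqrt n)\<close>. So the extra factor tends to \<open>1\<close> for bounded \<open>z\<close>, its normalization tends to \<open>1\<close> by dominated
  convergence, and (ii) follows from the estimate behind (i).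
\<close>

section \<open>Square integrability of the characteristic function of a bounded density\<close>

lemma borel_measurable_complex_cnj [measurable (raw)]:
  "f \<in> borel_measurable M \<Longrightarrow> (\<lambda>x. cnj (f x)) \<in> borel_measurable M"
  by (rule measurable_compose[OF _ borel_measurable_continuous_onI]) (auto intro: continuous_intros)

locale bounded_density =
  fixes f :: "real \<Rightarrow> real" and B :: real
  assumes f_measurable [measurable]: "f \<in> borel_measurable borel"
    and f_nonneg: "\<And>x. 0 \<le> f x" and f_le: "\<And>x. f x \<le> B"
    and f_integrable: "integrable lborel f" and f_integral: "(LBINT x. f x) = 1"
begin

abbreviation "\<mu> \<equiv> density lborel (\<lambda>x. ennreal (f x))"
abbreviation "\<phi> \<equiv> char \<mu>"

lemma real_distribution_mu: "real_distribution \<mu>"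
proof -
  have "emeasure \<mu> (space \<mu>) = (\<integral>\<^sup>+x. ennreal (f x) \<partial>lborel)"
    by (simp add: emeasure_density)
  also have "\<dots> = ennreal (LBINT x. f x)"
    using f_integrable f_nonneg by (intro nn_integral_eq_integral) auto
  finally have "emeasure \<mu> (space \<mu>) = 1" by (simp add: f_integral)
  then show ?thesis
    by (simp add: real_distribution_def real_distribution_axioms_def prob_spaceI)
qed

sublocale real_distribution \<mu> by (rule real_distribution_mu)

lemma B_nonneg: "0 \<le> B" using f_nonneg[of 0] f_le[of 0] by linarith

lemma char_eq: "\<phi> u = (CLBINT x. complex_of_real (f x) * iexp (u * x))"
  unfolding char_def by (subst integral_density) (auto simp: f_nonneg scaleR_conv_of_real)

text \<open>
  By Fubini's theorem, integrating \<open>\<bar>\<phi>\<bar>\<^sup>2\<close> against a Gaussian law amounts to averaging the characteristic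
  function of that law over the difference of two independent variables with density \<open>f\<close>. The average is a mean of
  convolutions of \<open>f\<close> with a Gaussian bump, and these are at most \<open>B\<close> times the mass of the bump.
\<close>
lemma gaussian_smoothed_char_square:
  assumes "l > 0"
  shows "(\<integral>v. (cmod (\<phi> (l * v)))\<^sup>2 \<partial>std_normal_distribution) \<le> B * sqrt (2 * pi) / l"
proof -
  interpret G: real_distribution std_normal_distribution
    by (rule real_dist_normal_dist)
  interpret MG: pair_prob_space \<mu> std_normal_distribution ..
  have [measurable]: "\<phi> \<in> borel_measurable borel" by (rule char_measurable)
  have bnd: "cmod (\<phi> u) \<le> 1" for u by (rule cmod_char_le_1)
  have cnj: "cnj (\<phi> u) = (CLINT y|\<mu>. iexp (- (u * y)))" for u
    unfolding char_def by (subst Bochner_Integration.integral_cnj[symmetric]) (simp add: exp_cnj)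
  have inner: "(CLINT v|std_normal_distribution. iexp (l * v * x) * cnj (\<phi> (l * v))) =
      (CLINT y|\<mu>. complex_of_real (exp (- ((l * (x - y))^2) / 2)))" for x
  proof -
    have "(CLINT v|std_normal_distribution. iexp (l * v * x) * cnj (\<phi> (l * v))) =
        (CLINT v|std_normal_distribution. (CLINT y|\<mu>. iexp (l * (x - y) * v)))"
      unfolding cnj by (subst integral_mult_right_zero[symmetric]) 
         (simp add: exp_add[symmetric] algebra_simps)
    also have "\<dots> = (CLINT y|\<mu>. (CLINT v|std_normal_distribution. iexp (l * (x - y) * v)))"
      by (intro MG.Fubini_integral MG.P.integrable_const_bound[where B=1]) (auto simp del: of_real_mult of_real_diff)
    also have "\<dots> = (CLINT y|\<mu>. char std_normal_distribution (l * (x - y)))"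
      by (simp add: char_def)
    finally show ?thesis by (simp add: char_std_normal_distribution)
  qed
  have "complex_of_real (\<integral>v. (cmod (\<phi> (l * v)))\<^sup>2 \<partial>std_normal_distribution)
      = (CLINT v|std_normal_distribution. \<phi> (l * v) * cnj (\<phi> (l * v)))"
    by (simp add: complex_norm_square[symmetric] del: of_real_power)
  also have "\<dots> = (CLINT v|std_normal_distribution. (CLINT x|\<mu>. iexp (l * v * x) * cnj (\<phi> (l * v))))"
    by (simp add: char_def)
  also have "\<dots> = (CLINT x|\<mu>. (CLINT v|std_normal_distribution. iexp (l * v * x) * cnj (\<phi> (l * v))))"
    using bnd by (intro MG.Fubini_integral MG.P.integrable_const_bound[where B=1])
       (auto simp: norm_mult simp del: of_real_mult)
  also have "\<dots> = (CLINT x|\<mu>. (CLINT y|\<mu>. complex_of_real (exp (- ((l * (x - y))^2) / 2))))"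
    unfolding inner ..
  also have "\<dots> = complex_of_real (\<integral>x. (\<integral>y. exp (- ((l * (x - y))^2) / 2) \<partial>\<mu>) \<partial>\<mu>)"
    by simp
  finally have eq: "(\<integral>v. (cmod (\<phi> (l * v)))\<^sup>2 \<partial>std_normal_distribution)
      = (\<integral>x. (\<integral>y. exp (- ((l * (x - y))^2) / 2) \<partial>\<mu>) \<partial>\<mu>)"
    using of_real_eq_iff by blast
  have le: "(\<integral>y. exp (- ((l * (x - y))^2) / 2) \<partial>\<mu>) \<le> B * sqrt (2 * pi) / l" for x
  proof -
    have nd: "exp (- ((l * (x - y))^2) / 2) = sqrt (2 * pi) / l * normal_density x (1/l) y" for y
      using assms by (simp add: normal_density_def real_sqrt_mult real_sqrt_divide power_mult_distrib power2_commute power_divide)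
    have le': "f y * exp (- ((l * (x - y))^2) / 2) \<le> B * (sqrt (2 * pi) / l * normal_density x (1/l) y)" for y
      unfolding nd[symmetric] by (intro mult_right_mono f_le) auto
    have "(\<integral>y. exp (- ((l * (x - y))^2) / 2) \<partial>\<mu>) = (LBINT y. f y * exp (- ((l * (x - y))^2) / 2))"
      by (subst integral_density) (auto simp: f_nonneg)
    also have "\<dots> \<le> (LBINT y. B * (sqrt (2 * pi) / l * normal_density x (1/l) y))"
    proof (rule integral_mono)
      show i: "integrable lborel (\<lambda>y. B * (sqrt (2 * pi) / l * normal_density x (1/l) y))"
        using assms by (intro integrable_mult_right) auto
      show "integrable lborel (\<lambda>y. f y * exp (- ((l * (x - y))^2) / 2))"
      proof (rule Bochner_Integration.integrable_bound[OF i], simp, rule AE_I2)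
        fix y
        have "0 \<le> f y * exp (- ((l * (x - y))^2) / 2)" by (simp add: f_nonneg)
        then show "norm (f y * exp (- ((l * (x - y))^2) / 2)) \<le> norm (B * (sqrt (2 * pi) / l * normal_density x (1/l) y))"
          unfolding real_norm_def using le'[of y] by linarith
      qed
    qed (rule le')
    also have "\<dots> = B * sqrt (2 * pi) / l" using assms by simp
    finally show ?thesis .
  qed
  have "(\<integral>x. (\<integral>y. exp (- ((l * (x - y))^2) / 2) \<partial>\<mu>) \<partial>\<mu>) \<le> (\<integral>x. B * sqrt (2 * pi) / l \<partial>\<mu>)"
  proof (rule integral_mono)
    show "integrable \<mu> (\<lambda>x. \<integral>y. exp (- ((l * (x - y))^2) / 2) \<partial>\<mu>)"
      using le by (intro integrable_const_bound[where B="B * sqrt (2 * pi) / l"]) auto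
  qed (use le in auto)
  also have "\<dots> = B * sqrt (2 * pi) / l" by (simp add: prob_space[simplified])
  finally show ?thesis unfolding eq .
qed

text \<open>
  The factor \<open>exp (- u\<^sup>2 / (2 * l\<^sup>2))\<close> makes the preceding estimate independent of the width \<open>l\<close>;
  Fatou's lemma removes it as \<open>l \<rightarrow> \<infinity>\<close>.
\<close>
lemma nn_integral_char_square: "(\<integral>\<^sup>+u. ennreal ((cmod (\<phi> u))\<^sup>2) \<partial>lborel) \<le> ennreal (2 * pi * B)"
proof -
  have [measurable]: "\<phi> \<in> borel_measurable borel" by (rule char_measurable)
  interpret G: real_distribution std_normal_distribution
    by (rule real_dist_normal_dist)
  let ?e = "\<lambda>(n::nat) u. (cmod (\<phi> u))\<^sup>2 * exp (- (u / real (Suc n))\<^sup>2 / 2)"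
  have bound: "(\<integral>\<^sup>+u. ennreal (?e n u) \<partial>lborel) \<le> ennreal (2 * pi * B)" for n
  proof -
    let ?l = "real (Suc n)"
    have "(\<integral>\<^sup>+u. ennreal (?e n u) \<partial>lborel) = ennreal ?l * (\<integral>\<^sup>+v. ennreal (?e n (?l * v)) \<partial>lborel)"
      by (subst nn_integral_real_affine[where c="?l" and t=0]) auto
    also have "(\<lambda>v. ennreal (?e n (?l * v))) =
        (\<lambda>v. ennreal (sqrt (2 * pi)) * (ennreal (std_normal_density v) * ennreal ((cmod (\<phi> (?l * v)))\<^sup>2)))"
      by (auto simp: ennreal_mult[symmetric] std_normal_density_def field_simps simp del: of_nat_Suc)
    also have "ennreal ?l * (\<integral>\<^sup>+v. ennreal (sqrt (2 * pi)) * (ennreal (std_normal_density v) * ennreal ((cmod (\<phi> (?l * v)))\<^sup>2)) \<partial>lborel)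
       = ennreal ?l * (ennreal (sqrt (2 * pi)) * (\<integral>\<^sup>+v. ennreal ((cmod (\<phi> (?l * v)))\<^sup>2) \<partial>std_normal_distribution))"
      by (simp add: nn_integral_cmult nn_integral_density)
    also have "(\<integral>\<^sup>+v. ennreal ((cmod (\<phi> (?l * v)))\<^sup>2) \<partial>std_normal_distribution)
       = ennreal (\<integral>v. (cmod (\<phi> (?l * v)))\<^sup>2 \<partial>std_normal_distribution)"
      by (intro nn_integral_eq_integral G.integrable_const_bound[where B=1])
         (auto intro!: power_le_one cmod_char_le_1)
    also have "ennreal ?l * (ennreal (sqrt (2 * pi)) * \<dots>) \<le> ennreal ?l * (ennreal (sqrt (2 * pi)) * ennreal (B * sqrt (2 * pi) / ?l))"
      by (intro mult_left_mono ennreal_leI gaussian_smoothed_char_square) auto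
    also have "\<dots> = ennreal (?l * (sqrt (2 * pi) * (B * sqrt (2 * pi) / ?l)))"
      using B_nonneg by (simp add: ennreal_mult[symmetric] del: of_nat_Suc)
    also have "?l * (sqrt (2 * pi) * (B * sqrt (2 * pi) / ?l)) = 2 * pi * B"
      by (simp add: field_simps del: of_nat_Suc)
    finally show ?thesis .
  qed
  have "(\<integral>\<^sup>+u. ennreal ((cmod (\<phi> u))\<^sup>2) \<partial>lborel) = (\<integral>\<^sup>+u. liminf (\<lambda>n. ennreal (?e n u)) \<partial>lborel)"
  proof (intro nn_integral_cong)
    fix u
    have "(\<lambda>n. u / real (Suc n)) \<longlonglongrightarrow> 0"
      by (intro LIMSEQ_Suc[OF tendsto_divide_0[OF tendsto_const]] filterlim_at_top_imp_at_infinity filterlim_real_sequentially)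
    then have "(\<lambda>n. ?e n u) \<longlonglongrightarrow> (cmod (\<phi> u))\<^sup>2 * exp (- 0\<^sup>2 / 2)"
      by (intro tendsto_intros) auto
    then have "(\<lambda>n. ennreal (?e n u)) \<longlonglongrightarrow> ennreal ((cmod (\<phi> u))\<^sup>2)" by (intro tendsto_ennrealI) simp
    then show "ennreal ((cmod (\<phi> u))\<^sup>2) = liminf (\<lambda>n. ennreal (?e n u))"
      by (intro lim_imp_Liminf[symmetric]) auto
  qed
  also have "\<dots> \<le> liminf (\<lambda>n. \<integral>\<^sup>+u. ennreal (?e n u) \<partial>lborel)"
    by (intro nn_integral_liminf) auto
  also have "\<dots> \<le> ennreal (2 * pi * B)"
    by (intro Liminf_le[OF _ always_eventually]) (use bound in auto)
  finally show ?thesis .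
qed

lemma char_square_integrable: "integrable lborel (\<lambda>u. (cmod (\<phi> u))\<^sup>2)"
  and char_square_integral: "(LBINT u. (cmod (\<phi> u))\<^sup>2) \<le> 2 * pi * B"
proof -
  have [measurable]: "\<phi> \<in> borel_measurable borel" by (rule char_measurable)
  show i: "integrable lborel (\<lambda>u. (cmod (\<phi> u))\<^sup>2)"
    using nn_integral_char_square by (intro integrableI_nonneg) (auto simp: less_top[symmetric] top_unique)
  show "(LBINT u. (cmod (\<phi> u))\<^sup>2) \<le> 2 * pi * B"
    using nn_integral_char_square B_nonneg by (subst (asm) nn_integral_eq_integral[OF i]) auto
qed

end

section \<open>Recovering a density from an integrable characteristic function\<close>

definition inverse_fourier :: "(real \<Rightarrow> complex) \<Rightarrow> real \<Rightarrow> complex" where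
  "inverse_fourier \<psi> x = (CLBINT u. iexp (- (u * x)) * \<psi> u) / (2 * pi)"

lemma inverse_fourier_continuous:
  assumes "integrable lborel \<psi>"
  shows "continuous_on UNIV (inverse_fourier \<psi>)"
  unfolding continuous_on_eq_continuous_at[OF open_UNIV] continuous_at_sequentially
proof safe
  fix x :: real and X assume X: "X \<longlonglongrightarrow> x"
  have [measurable]: "\<psi> \<in> borel_measurable lborel" using assms by auto
  have "(\<lambda>n. CLBINT u. iexp (- (u * X n)) * \<psi> u) \<longlonglongrightarrow> (CLBINT u. iexp (- (u * x)) * \<psi> u)"
    by (rule integral_dominated_convergence[where w="\<lambda>u. cmod (\<psi> u)"])
       (auto intro!: tendsto_intros X simp: norm_mult assms simp del: of_real_mult of_real_minus)
  then show "(inverse_fourier \<psi> \<circ> X) \<longlonglongrightarrow> inverse_fourier \<psi> x"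
    unfolding comp_def inverse_fourier_def by (intro tendsto_intros) auto
qed

lemma inverse_fourier_bounded:
  assumes "integrable lborel \<psi>"
  shows "cmod (inverse_fourier \<psi> x) \<le> (LBINT u. cmod (\<psi> u)) / (2 * pi)"
proof -
  have "cmod (CLBINT u. iexp (- (u * x)) * \<psi> u) \<le> (LBINT u. cmod (iexp (- (u * x)) * \<psi> u))"
    by (rule integral_norm_bound)
  also have "\<dots> = (LBINT u. cmod (\<psi> u))" by (simp add: norm_mult del: of_real_mult of_real_minus)
  finally show ?thesis unfolding inverse_fourier_def by (simp add: norm_divide divide_right_mono)
qed

text \<open>
  The kernel in Levy's inversion formula is the Fourier transform of the indicator of \<open>[a, b]\<close>. The
  integral on the right is bounded by \<open>b - a\<close> and makes sense at \<open>t = 0\<close> as well.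
\<close>
lemma exponential_kernel_integral:
  assumes "a \<le> b" "t \<noteq> 0"
  shows "(iexp (-(t * a)) - iexp (-(t * b))) / (\<i> * t) = (CLINT x:{a..b}|lborel. iexp (- (t * x)))"
proof -
  have "(LBINT x=a..b. iexp (- (t * x))) = (\<lambda>x. \<i> / t * iexp (-(t * x))) b - (\<lambda>x. \<i> / t * iexp (-(t * x))) a"
  proof (intro interval_integral_FTC_finite)
    fix x
    have "((\<lambda>z. \<i> / t * exp (\<i> * - (t * z))) has_field_derivative exp (\<i> * - (t * complex_of_real x))) (at (complex_of_real x))"
      using assms by (auto intro!: derivative_eq_intros)
    from has_vector_derivative_real_field[OF this]
    show "((\<lambda>x. \<i> / t * iexp (-(t * x))) has_vector_derivative iexp (- (t * x))) (at x within {min a b..max a b})"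
      by simp
  qed (intro continuous_intros)
  also have "\<dots> = (iexp (-(t * a)) - iexp (-(t * b))) / (\<i> * t)"
    using assms by (simp add: field_simps)
  finally show ?thesis using assms by (simp add: interval_integral_Icc)
qed

text \<open>
  When \<open>char M\<close> is integrable, the truncated integrals in Levy's formula converge absolutely, and Fubini's
  theorem turns the limit into the integral of the inverse transform over \<open>[a, b]\<close>. The inverse transform is
  continuous, so a negative value would persist on a short interval and give it negative mass.
\<close>
theorem (in real_distribution) density_from_integrable_char:
  assumes int: "integrable lborel (char M)" and atoms: "\<And>x. measure M {x} = 0"
  shows "M = density lborel (\<lambda>x. ennreal (Re (inverse_fourier (char M) x)))"
    and "0 \<le> Re (inverse_fourier (char M) x)"
proof -
  let ?G = "inverse_fourier (char M)"
  have cont: "continuous_on UNIV ?G" by (rule inverse_fourier_continuous[OF int])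
  have [measurable]: "char M \<in> borel_measurable borel" by (rule char_measurable)
  have [measurable]: "?G \<in> borel_measurable borel" using cont by (rule borel_measurable_continuous_onI)
  have interval: "measure M {a<..b} = (LBINT x. Re (?G x) * indicator {a..b} x)" if ab: "a \<le> b" for a b
  proof -
    define K where "K t = (CLINT x:{a..b}|lborel. iexp (- (t * x)))" for t
    have K_le: "cmod (K t) \<le> b - a" for t
    proof -
      have "cmod (K t) \<le> (LBINT x. cmod (indicator {a..b} x *\<^sub>R iexp (- (t * x))))"
        unfolding K_def set_lebesgue_integral_def by (rule integral_norm_bound)
      also have "\<dots> = (LBINT x. indicator {a..b} x)" by (simp del: of_real_mult of_real_minus)
      finally show ?thesis using ab by simp
    qed
    have Kmeas [measurable]: "K \<in> borel_measurable borel"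
      unfolding K_def set_lebesgue_integral_def by measurable
    have Kint: "integrable lborel (\<lambda>t. K t * char M t)"
      by (rule Bochner_Integration.integrable_bound[OF integrable_mult_right[OF integrable_norm[OF int], of "b - a"]])
         (use K_le ab in \<open>auto simp: norm_mult intro!: mult_right_mono\<close>)
    \<comment> \<open>The quotient form of the kernel takes the default value \<open>0\<close> at \<open>t = 0\<close>, where it differs from \<open>K\<close>.\<close>
    have AE0: "AE t in lborel. (t::real) \<noteq> 0" by (rule AE_lborel_singleton)
    have eqK: "(CLBINT t=-T..T. (iexp (-(t * a)) - iexp (-(t * b))) / (\<i> * t) * char M t)
        = (CLBINT t. indicator {- real T..real T} t *\<^sub>R (K t * char M t))" for T :: nat
    proof -
      have "AE t in lborel. indicator {- real T..real T} t *\<^sub>R ((iexp (-(t * a)) - iexp (-(t * b))) / (\<i> * t) * char M t)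
          = indicator {- real T..real T} t *\<^sub>R (K t * char M t)"
        by (rule eventually_mono[OF AE0]) (subst exponential_kernel_integral[OF ab], simp, simp add: K_def)
      then show ?thesis
        by (subst interval_integral_Icc) (auto simp: set_lebesgue_integral_def intro!: integral_cong_AE)
    qed
    have lim1: "(\<lambda>T. CLBINT t. indicator {- real T..real T} t *\<^sub>R (K t * char M t)) \<longlonglongrightarrow> (CLBINT t. K t * char M t)"
    proof (rule integral_dominated_convergence[where w="\<lambda>t. cmod (K t * char M t)"])
      show "AE t in lborel. (\<lambda>T. indicator {- real T..real T} t *\<^sub>R (K t * char M t)) \<longlonglongrightarrow> K t * char M t"
      proof (rule AE_I2, rule tendsto_eventually)
        fix t :: real
        obtain N :: nat where "\<bar>t\<bar> \<le> real N" using real_arch_simple by blast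
        then show "\<forall>\<^sub>F T in sequentially. indicator {- real T..real T} t *\<^sub>R (K t * char M t) = K t * char M t"
          by (intro eventually_sequentiallyI[of N]) (auto simp: indicator_def)
      qed
    qed (use Kint in \<open>auto intro!: always_eventually simp: indicator_def\<close>)
    have "(\<lambda>T::nat. 1 / (2 * pi) * (CLBINT t=-T..T. (iexp (-(t * a)) - iexp (-(t * b))) / (\<i> * t) * char M t))
       \<longlonglongrightarrow> complex_of_real (measure M {a<..b})"
      by (rule Levy_Inversion[OF ab]) (auto simp: atoms)
    moreover have "(\<lambda>T::nat. 1 / (2 * pi) * (CLBINT t=-T..T. (iexp (-(t * a)) - iexp (-(t * b))) / (\<i> * t) * char M t))
       \<longlonglongrightarrow> 1 / (2 * pi) * (CLBINT t. K t * char M t)"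
      unfolding eqK by (intro tendsto_intros lim1)
    ultimately have m: "complex_of_real (measure M {a<..b}) = 1 / (2 * pi) * (CLBINT t. K t * char M t)"
      by (rule LIMSEQ_unique)
    have "(CLBINT t. K t * char M t) = (CLBINT t. (CLBINT x. indicator {a..b} x * (iexp (- (t * x)) * char M t)))"
      unfolding K_def set_lebesgue_integral_def
      by (subst integral_mult_left_zero[symmetric]) (simp add: scaleR_conv_of_real mult_ac of_real_indicator)
    also have "\<dots> = (CLBINT x. (CLBINT t. indicator {a..b} x * (iexp (- (t * x)) * char M t)))"
    proof (rule lborel_pair.Fubini_integral)
      have i1: "integrable lborel (indicator {a..b} :: real \<Rightarrow> real)" by (rule integrable_real_indicator) (auto simp: emeasure_lborel_Icc_eq)
      show "integrable (lborel \<Otimes>\<^sub>M lborel) (\<lambda>(x, t). indicator {a..b} x * (iexp (- (t * x)) * char M t))"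
      proof (rule lborel_pair.Fubini_integrable)
        have "(\<lambda>x. \<integral>t. cmod (case (x, t) of (x, t) \<Rightarrow> indicator {a..b} x * (iexp (- (t * x)) * char M t)) \<partial>lborel)
          = (\<lambda>x. indicator {a..b} x * (LBINT t. cmod (char M t)))"
          by (auto simp: norm_mult indicator_def simp del: of_real_mult of_real_minus)
        then show "integrable lborel (\<lambda>x. \<integral>t. cmod (case (x, t) of (x, t) \<Rightarrow> indicator {a..b} x * (iexp (- (t * x)) * char M t)) \<partial>lborel)"
          using integrable_mult_left[OF i1, of "\<integral>t. cmod (char M t) \<partial>lborel"] by simp
        show "AE x in lborel. integrable lborel (\<lambda>t. case (x, t) of (x, t) \<Rightarrow> indicator {a..b} x * (iexp (- (t * x)) * char M t))"
          by (auto intro!: always_eventually integrable_mult_right Bochner_Integration.integrable_bound[OF int] simp: norm_mult simp del: of_real_mult of_real_minus)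
      qed simp
    qed
    also have "\<dots> = (CLBINT x. 2 * pi * (indicator {a..b} x * ?G x))"
      by (auto intro!: Bochner_Integration.integral_cong simp: inverse_fourier_def indicator_def)
    finally have m2: "complex_of_real (measure M {a<..b}) = (CLBINT x. indicator {a..b} x * ?G x)"
      unfolding m by simp
    have "integrable lborel (\<lambda>x. indicator {a..b} x *\<^sub>R ?G x)"
      using borel_integrable_compact[OF compact_Icc continuous_on_subset[OF cont subset_UNIV], of a b] by (simp add: indicator_def if_distrib cong: if_cong)
    then have iG: "integrable lborel (\<lambda>x. indicator {a..b} x * ?G x)" by (simp add: scaleR_conv_of_real of_real_indicator)
    have "measure M {a<..b} = Re (CLBINT x. indicator {a..b} x * ?G x)" unfolding m2[symmetric] by simp
    also have "\<dots> = (LBINT x. Re (indicator {a..b} x * ?G x))" by (rule integral_Re[OF iG, symmetric])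
    also have "\<dots> = (LBINT x. Re (?G x) * indicator {a..b} x)"
      by (intro Bochner_Integration.integral_cong) (auto simp: indicator_def)
    finally show ?thesis .
  qed
  have contR: "continuous_on UNIV (\<lambda>x. Re (?G x))" by (intro continuous_intros cont)
  have Rint: "integrable lborel (\<lambda>x. Re (?G x) * indicator {a..b} x)" for a b
    using borel_integrable_compact[OF compact_Icc continuous_on_subset[OF contR subset_UNIV], of a b]
    by (simp add: mult.commute)
  show nonneg: "0 \<le> Re (?G x)" for x
  proof (rule ccontr)
    assume neg: "\<not> 0 \<le> Re (?G x)"
    have "isCont (\<lambda>x. Re (?G x)) x" using contR by (simp add: continuous_on_eq_continuous_at)
    then obtain d where d: "d > 0" "\<And>y. dist y x < d \<Longrightarrow> dist (Re (?G y)) (Re (?G x)) < - Re (?G x) / 2"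
      using neg unfolding continuous_at_eps_delta by (metis (no_types, lifting) half_gt_zero neg_0_less_iff_less not_le_imp_less)
    have "measure M {x<..x + d/2} = (LBINT y. Re (?G y) * indicator {x..x + d/2} y)"
      using d by (intro interval) auto
    also have "\<dots> \<le> (LBINT y. Re (?G x) / 2 * indicator {x..x + d/2} y)"
    proof (intro integral_mono Rint)
      fix y show "Re (?G y) * indicator {x..x + d/2} y \<le> Re (?G x) / 2 * indicator {x..x + d/2} y"
        using d(2)[of y] d(1) by (auto simp: indicator_def dist_real_def)
    qed (intro integrable_mult_right integrable_real_indicator, auto simp: emeasure_lborel_Icc_eq)
    also have "\<dots> < 0" using d neg by (simp add: mult_neg_pos)
    finally show False by (simp add: not_less[symmetric])
  qed
  show "M = density lborel (\<lambda>x. ennreal (Re (?G x)))"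
  proof (rule measure_eqI_generator_eq[where \<Omega>=UNIV and E="range (\<lambda>(a, b). {a<..b::real})"])
    fix X assume "X \<in> range (\<lambda>(a, b). {a<..b::real})"
    then obtain a b where X: "X = {a<..b}" by auto
    show "emeasure M X = emeasure (density lborel (\<lambda>x. ennreal (Re (?G x)))) X"
    proof (cases "a \<le> b")
      case True
      have AEa: "AE x in lborel. x \<noteq> a" by (rule AE_lborel_singleton)
      have "emeasure (density lborel (\<lambda>x. ennreal (Re (?G x)))) X = (\<integral>\<^sup>+x. ennreal (Re (?G x)) * indicator {a<..b} x \<partial>lborel)"
        unfolding X by (subst emeasure_density) auto
      also have "\<dots> = (\<integral>\<^sup>+x. ennreal (Re (?G x) * indicator {a..b} x) \<partial>lborel)"
        using AEa by (intro nn_integral_cong_AE) (auto elim!: eventually_mono simp: indicator_def)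
      also have "\<dots> = ennreal (LBINT x. Re (?G x) * indicator {a..b} x)"
        by (intro nn_integral_eq_integral Rint) (auto simp: nonneg)
      finally show ?thesis using interval[OF True] X by (simp add: emeasure_eq_measure)
    qed (simp add: X)
  next
    show "(\<Union>i. {- real (i::nat)<..real i}) = UNIV" by (rule UN_Ioc_eq_UNIV)
  qed (auto simp: Int_stable_def borel_sigma_sets_Ioc)
qed

section \<open>Fourier inversion for convolution powers\<close>

lemma char_convolution:
  assumes "real_distribution M" "real_distribution N"
  shows "char (M \<star> N) t = char M t * char N t"
proof -
  interpret M: real_distribution M by fact
  interpret N: real_distribution N by fact
  interpret MN: pair_prob_space M N ..
  have "char (M \<star> N) t = (CLINT z|M \<Otimes>\<^sub>M N. iexp (t * (fst z + snd z)))"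
    unfolding char_def convolution_def by (subst integral_distr) (auto simp: split_beta)
  also have "\<dots> = (CLINT x|M. (CLINT y|N. iexp (t * (x + y))))"
  proof -
    have "integrable (M \<Otimes>\<^sub>M N) (\<lambda>z. iexp (t * (fst z + snd z)))"
      by (rule MN.P.integrable_const_bound[where B=1]) (auto simp del: of_real_mult of_real_add)
    then show ?thesis using MN.integral_fst'[of "\<lambda>z. iexp (t * (fst z + snd z))"] by simp
  qed
  also have "\<dots> = (CLINT x|M. iexp (t * x) * char N t)"
    unfolding char_def by (subst integral_mult_right_zero[symmetric]) (simp add: algebra_simps exp_add)
  also have "\<dots> = char M t * char N t" by (simp add: char_def)
  finally show ?thesis .
qed

lemma sum_density_Suc:
  "k \<ge> 1 \<Longrightarrow> sum_density f (Suc k) = (\<lambda>x. \<integral>\<^sup>+y. ennreal (f (x - y)) * sum_density f k y \<partial>lborel)"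
  by (cases k) auto

context bounded_density
begin

abbreviation "G k \<equiv> inverse_fourier (\<lambda>u. \<phi> u ^ k)"

lemma char_measurable' [measurable]: "\<phi> \<in> borel_measurable borel"
  by (rule char_measurable)

lemma char_power_le: assumes "2 \<le> k" shows "cmod (\<phi> u ^ k) \<le> (cmod (\<phi> u))\<^sup>2"
  using assms cmod_char_le_1[of u] by (simp add: norm_power power_decreasing)

lemma char_power_integrable: assumes "2 \<le> k" shows "integrable lborel (\<lambda>u. \<phi> u ^ k)"
  by (rule Bochner_Integration.integrable_bound[OF char_square_integrable]) (use char_power_le[OF assms] in auto)

text \<open>
  An identity of measures, because \<open>f * f\<close> is determined by its characteristic function \<open>\<phi>\<^sup>2\<close> only up to null
  sets. The next convolution with \<open>f\<close> removes this ambiguity.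
\<close>
lemma density_sum_density_2:
  "density lborel (sum_density f 2) = density lborel (\<lambda>x. ennreal (Re (G 2 x)))"
  and G2_nonneg: "0 \<le> Re (G 2 x)"
proof -
  let ?M = "density lborel (sum_density f 2)"
  have eq: "\<mu> \<star> \<mu> = ?M"
    by (subst convolution_density) (auto simp: finite_measure_axioms numeral_2_eq_2)
  have [measurable]: "sum_density f 2 \<in> borel_measurable borel" by (simp add: numeral_2_eq_2)
  have "prob_space ?M" unfolding eq[symmetric] convolution_def
  proof (rule prob_space.prob_space_distr)
    interpret MM: pair_prob_space \<mu> \<mu> ..
    show "prob_space (\<mu> \<Otimes>\<^sub>M \<mu>)" by unfold_locales
  qed simp
  then interpret D: real_distribution ?M
    by (simp add: real_distribution_def real_distribution_axioms_def)
  have char: "char ?M = (\<lambda>u. \<phi> u ^ 2)"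
    unfolding eq[symmetric] by (rule ext) (simp add: char_convolution real_distribution_mu power2_eq_square)
  have atoms: "measure ?M {x} = 0" for x
  proof -
    have "AE y in lborel. sum_density f 2 y * indicator {x} y = 0"
      by (rule eventually_mono[OF AE_lborel_singleton[of x]]) auto
    then have "emeasure ?M {x} = 0" 
      by (subst emeasure_density) (auto simp: nn_integral_0_iff_AE)
    then show ?thesis by (simp add: measure_def)
  qed
  show "?M = density lborel (\<lambda>x. ennreal (Re (G 2 x)))" "0 \<le> Re (G 2 x)"
    using D.density_from_integrable_char[OF _ atoms] char_power_integrable[of 2] unfolding char by auto
qed

text \<open>
  Convolution with \<open>f\<close> multiplies the transform by \<open>\<phi>\<close>. The double integral converges absolutely because
  \<open>\<phi> ^ k\<close> and \<open>f\<close> are both integrable, so the identity holds at every \<open>x\<close>.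
\<close>
lemma convolution_inverse_fourier:
  assumes k: "2 \<le> k"
  shows "integrable lborel (\<lambda>y. f (x - y) * Re (G k y))"
    and "(LBINT y. f (x - y) * Re (G k y)) = Re (G (Suc k) x)"
proof -
  note ik = char_power_integrable[OF k]
  have [measurable]: "G k \<in> borel_measurable borel"
    by (rule borel_measurable_continuous_onI[OF inverse_fourier_continuous[OF ik]])
  have fx: "integrable lborel (\<lambda>y. f (x - y))"
    using lborel_integrable_real_affine[OF f_integrable, of "-1" x] by simp
  let ?C = "(LBINT u. cmod (\<phi> u ^ k))"
  have ifG: "integrable lborel (\<lambda>y. complex_of_real (f (x - y)) * G k y)"
  proof (rule Bochner_Integration.integrable_bound[OF integrable_mult_right[OF fx, of "?C / (2 * pi)"]])
    show "AE y in lborel. norm (complex_of_real (f (x - y)) * G k y) \<le> norm (?C / (2 * pi) * f (x - y))"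
    proof (rule AE_I2)
      fix y
      have "cmod (complex_of_real (f (x - y)) * G k y) \<le> ?C / (2 * pi) * f (x - y)"
        using mult_left_mono[OF inverse_fourier_bounded[OF ik, of y] f_nonneg[of "x - y"]]
        by (simp add: norm_mult f_nonneg mult.commute)
      then show "norm (complex_of_real (f (x - y)) * G k y) \<le> norm (?C / (2 * pi) * f (x - y))"
        unfolding real_norm_def by linarith
    qed
  qed simp
  have inner: "(CLBINT y. complex_of_real (f (x - y)) * iexp (- (u * y))) = iexp (- (u * x)) * \<phi> u" for u
  proof -
    have "(CLBINT y. complex_of_real (f (x - y)) * iexp (- (u * y)))
        = (CLBINT z. complex_of_real (f z) * iexp (- (u * (x - z))))"
      by (subst lborel_integral_real_affine[where c="-1" and t=x]) auto
    also have "\<dots> = (CLBINT z. iexp (- (u * x)) * (complex_of_real (f z) * iexp (u * z)))"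
      by (intro Bochner_Integration.integral_cong) (auto simp: algebra_simps exp_add[symmetric] exp_diff)
    finally show ?thesis by (simp add: char_eq)
  qed
  have "(CLBINT y. complex_of_real (f (x - y)) * G k y)
      = (CLBINT y. (CLBINT u. complex_of_real (f (x - y)) * (iexp (- (u * y)) * \<phi> u ^ k))) / (2 * pi)"
    by (simp add: inverse_fourier_def)
  also have "(CLBINT y. (CLBINT u. complex_of_real (f (x - y)) * (iexp (- (u * y)) * \<phi> u ^ k)))
      = (CLBINT u. (CLBINT y. complex_of_real (f (x - y)) * (iexp (- (u * y)) * \<phi> u ^ k)))"
  proof (rule lborel_pair.Fubini_integral[symmetric])
    show "integrable (lborel \<Otimes>\<^sub>M lborel) (\<lambda>(y, u). complex_of_real (f (x - y)) * (iexp (- (u * y)) * \<phi> u ^ k))"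
    proof (rule lborel_pair.Fubini_integrable)
      have "(\<lambda>y. \<integral>u. cmod (case (y, u) of (y, u) \<Rightarrow> complex_of_real (f (x - y)) * (iexp (- (u * y)) * \<phi> u ^ k)) \<partial>lborel)
        = (\<lambda>y. f (x - y) * ?C)"
        by (auto simp: norm_mult f_nonneg simp del: of_real_mult of_real_minus)
      then show "integrable lborel (\<lambda>y. \<integral>u. cmod (case (y, u) of (y, u) \<Rightarrow> complex_of_real (f (x - y)) * (iexp (- (u * y)) * \<phi> u ^ k)) \<partial>lborel)"
        using integrable_mult_left[OF fx, of ?C] by simp
      show "AE y in lborel. integrable lborel (\<lambda>u. case (y, u) of (y, u) \<Rightarrow> complex_of_real (f (x - y)) * (iexp (- (u * y)) * \<phi> u ^ k))"
        by (intro AE_I2, unfold split, intro integrable_mult_right Bochner_Integration.integrable_bound[OF ik])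
           (auto simp: norm_mult simp del: of_real_mult of_real_minus)
    qed simp
  qed
  also have "(CLBINT u. (CLBINT y. complex_of_real (f (x - y)) * (iexp (- (u * y)) * \<phi> u ^ k)))
      = (CLBINT u. iexp (- (u * x)) * \<phi> u ^ Suc k)"
  proof -
    have "(CLBINT y. complex_of_real (f (x - y)) * (iexp (- (u * y)) * \<phi> u ^ k))
        = (CLBINT y. complex_of_real (f (x - y)) * iexp (- (u * y))) * \<phi> u ^ k" for u
      by (subst integral_mult_left_zero[symmetric]) (simp add: mult.assoc)
    then show ?thesis unfolding inner by (simp add: mult.assoc)
  qed
  finally have *: "(CLBINT y. complex_of_real (f (x - y)) * G k y) = G (Suc k) x"
    by (simp add: inverse_fourier_def)
  show "integrable lborel (\<lambda>y. f (x - y) * Re (G k y))" using integrable_Re[OF ifG] by simp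
  show "(LBINT y. f (x - y) * Re (G k y)) = Re (G (Suc k) x)"
    using integral_Re[OF ifG] * by simp
qed

text \<open>
  The value of \<open>f * f * f\<close> at a point is an integral against the measure with density \<open>f * f\<close>, in which
  \<open>f * f\<close> may be replaced by its continuous version. From there on induction is pointwise.
\<close>
theorem sum_density_inversion:
  assumes "3 \<le> k"
  shows "sum_density f k x = ennreal (Re (G k x))" "0 \<le> Re (G k x)"
proof -
  have conv_step: "(\<integral>\<^sup>+y. ennreal (f (x - y)) * ennreal (Re (G k y)) \<partial>lborel) = ennreal (Re (G (Suc k) x))
      \<and> 0 \<le> Re (G (Suc k) x)" if k: "2 \<le> k" and nn: "\<And>y. 0 \<le> Re (G k y)" for k x
  proof
    have "(\<integral>\<^sup>+y. ennreal (f (x - y)) * ennreal (Re (G k y)) \<partial>lborel) = (\<integral>\<^sup>+y. ennreal (f (x - y) * Re (G k y)) \<partial>lborel)"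
      by (simp add: ennreal_mult f_nonneg nn)
    also have "\<dots> = ennreal (LBINT y. f (x - y) * Re (G k y))"
      by (intro nn_integral_eq_integral convolution_inverse_fourier[OF k]) (auto simp: f_nonneg nn)
    finally show "(\<integral>\<^sup>+y. ennreal (f (x - y)) * ennreal (Re (G k y)) \<partial>lborel) = ennreal (Re (G (Suc k) x))"
      using convolution_inverse_fourier(2)[OF k] by simp
    have "0 \<le> (LBINT y. f (x - y) * Re (G k y))" by (intro integral_nonneg_AE) (auto simp: f_nonneg nn)
    then show "0 \<le> Re (G (Suc k) x)" using convolution_inverse_fourier(2)[OF k] by simp
  qed
  have [measurable]: "sum_density f 2 \<in> borel_measurable borel" by (simp add: numeral_2_eq_2)
  have [measurable]: "G 2 \<in> borel_measurable borel"
    by (rule borel_measurable_continuous_onI[OF inverse_fourier_continuous[OF char_power_integrable]]) simp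
  have "\<forall>x. sum_density f k x = ennreal (Re (G k x)) \<and> 0 \<le> Re (G k x)"
    using assms
  proof (induction k rule: dec_induct)
    case base
    show ?case
    proof
      fix x
      have "sum_density f 3 x = (\<integral>\<^sup>+y. ennreal (f (x - y)) \<partial>density lborel (sum_density f 2))"
        using sum_density_Suc[of 2 f] by (subst nn_integral_density) (auto simp: numeral_3_eq_3 numeral_2_eq_2 mult.commute)
      also have "\<dots> = (\<integral>\<^sup>+y. ennreal (f (x - y)) * ennreal (Re (G 2 y)) \<partial>lborel)"
        unfolding density_sum_density_2 by (subst nn_integral_density) (auto simp: mult.commute)
      finally show "sum_density f 3 x = ennreal (Re (G 3 x)) \<and> 0 \<le> Re (G 3 x)"
        using conv_step[of 2 x] G2_nonneg by (simp add: numeral_3_eq_3 numeral_2_eq_2)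
    qed
  next
    case (step k)
    then show ?case using sum_density_Suc[of k f] conv_step[of k] by auto
  qed
  then show "sum_density f k x = ennreal (Re (G k x))" "0 \<le> Re (G k x)" by auto
qed

end

section \<open>Gaussian integrals and elementary estimates\<close>

lemma integrable_power_exp_abs:
  fixes c :: real assumes "c > 0"
  shows "integrable lborel (\<lambda>z. \<bar>z\<bar> ^ k * exp (- c * \<bar>z\<bar>))"
proof -
  let ?g = "\<lambda>x::real. x ^ k * exp (- x) * indicator {0..} x"
  have g: "integrable lborel ?g"
    using has_bochner_integral_I0i_power_exp_m'[of k] by (rule integrable.intros)
  have "integrable lborel (\<lambda>z. 1 / c ^ k * (?g (0 + c * z) + ?g (0 + (- c) * z)))"
    using assms by (intro integrable_mult_right Bochner_Integration.integrable_add lborel_integrable_real_affine[OF g]) auto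
  then show ?thesis
  proof (rule Bochner_Integration.integrable_bound)
    show "AE z in lborel. norm (\<bar>z\<bar> ^ k * exp (- c * \<bar>z\<bar>)) \<le> norm (1 / c ^ k * (?g (0 + c * z) + ?g (0 + (- c) * z)))"
    proof (rule AE_I2)
      fix z :: real
      have g0: "0 \<le> ?g y" for y by (auto simp: indicator_def)
      have gabs: "?g (c * \<bar>z\<bar>) = c ^ k * (\<bar>z\<bar> ^ k * exp (- c * \<bar>z\<bar>))"
        using assms by (simp add: power_mult_distrib)
      have "?g (c * \<bar>z\<bar>) \<le> ?g (0 + c * z) + ?g (0 + (- c) * z)"
        using g0[of "c * z"] g0[of "(- c) * z"] by (cases "z \<ge> 0") (simp_all add: abs_if del: mult_minus_left)
      then have "\<bar>z\<bar> ^ k * exp (- c * \<bar>z\<bar>) \<le> 1 / c ^ k * (?g (0 + c * z) + ?g (0 + (- c) * z))"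
        unfolding gabs using assms by (simp add: pos_le_divide_eq mult.commute)
      moreover have "0 \<le> \<bar>z\<bar> ^ k * exp (- c * \<bar>z\<bar>)" by simp
      ultimately show "norm (\<bar>z\<bar> ^ k * exp (- c * \<bar>z\<bar>)) \<le> norm (1 / c ^ k * (?g (0 + c * z) + ?g (0 + (- c) * z)))"
        unfolding real_norm_def by linarith
    qed
  qed simp
qed

text \<open>
  From \<open>sin u = 2 * sin (u/2) * cos (u/2)\<close> for \<open>\<bar>u\<bar> \<le> 2\<close>, and trivially beyond. It keeps \<open>sin u / u\<close>, the
  transform of the uniform law on \<open>[-1, 1]\<close>, away from \<open>1\<close> outside a neighbourhood of \<open>0\<close>.
\<close>
lemma abs_sin_le_cos_half:
  fixes u d :: real assumes "0 < d" "d \<le> 1" "d \<le> \<bar>u\<bar>"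
  shows "\<bar>sin u\<bar> \<le> max (1/2) (cos (d/2)) * \<bar>u\<bar>"
proof (cases "\<bar>u\<bar> \<le> 2")
  case True
  have "\<bar>sin u\<bar> = 2 * \<bar>sin (u/2)\<bar> * \<bar>cos (u/2)\<bar>"
    using sin_double[of "u/2"] by (simp add: abs_mult)
  also have "\<dots> \<le> \<bar>u\<bar> * \<bar>cos (u/2)\<bar>"
    using abs_sin_x_le_abs_x[of "u/2"] by (intro mult_right_mono) auto
  also have "\<bar>cos (u/2)\<bar> = cos (\<bar>u\<bar>/2)"
  proof -
    have "0 \<le> cos (\<bar>u\<bar>/2)" using True pi_gt3 by (intro cos_ge_zero) auto
    then show ?thesis by (cases "u \<ge> 0") auto
  qed
  also have "cos (\<bar>u\<bar>/2) \<le> cos (d/2)"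
    using assms True pi_gt3 by (subst cos_mono_le_eq) auto
  finally have "\<bar>sin u\<bar> \<le> \<bar>u\<bar> * cos (d/2)" by (simp add: mult_left_mono)
  also have "\<dots> \<le> \<bar>u\<bar> * max (1/2) (cos (d/2))" by (intro mult_left_mono) auto
  finally show ?thesis by (simp add: mult.commute)
next
  case False
  have "\<bar>sin u\<bar> \<le> 1" by simp
  also have "1 \<le> 1/2 * \<bar>u\<bar>" using False by simp
  also have "\<dots> \<le> max (1/2) (cos (d/2)) * \<bar>u\<bar>" by (intro mult_right_mono) auto
  finally show ?thesis .
qed

text \<open>
  Scaling reduces this to the unit disc. The factor \<open>r ^ (k - 1)\<close> carries the Gaussian decay when \<open>z\<close> and \<open>w\<close>
  are values of a characteristic function and of its Gaussian limit.
\<close>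
lemma norm_power_diff_le:
  fixes z w :: complex
  assumes "r > 0" "cmod z \<le> r" "cmod w \<le> r"
  shows "cmod (z ^ k - w ^ k) \<le> real k * r ^ (k - 1) * cmod (z - w)"
proof (cases k)
  case (Suc j)
  have "cmod ((z / r) ^ k - (w / r) ^ k) \<le> real k * cmod (z / r - w / r)"
    using assms by (intro norm_power_diff) (auto simp: norm_divide)
  moreover have "(z / r) ^ k - (w / r) ^ k = (z ^ k - w ^ k) / of_real (r ^ k)"
    by (simp add: power_divide diff_divide_distrib)
  moreover have "z / r - w / r = (z - w) / of_real r" by (simp add: diff_divide_distrib)
  ultimately have "cmod (z ^ k - w ^ k) / r ^ k \<le> real k * (cmod (z - w) / r)"
    using assms by (simp add: norm_divide norm_power)
  then have "cmod (z ^ k - w ^ k) \<le> real k * (cmod (z - w) / r) * r ^ k"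
    using assms by (simp add: pos_divide_le_eq)
  also have "\<dots> = real k * r ^ (k - 1) * cmod (z - w)" using assms Suc by simp
  finally show ?thesis .
qed simp

lemma inverse_fourier_gaussian:
  assumes "k > 0"
  shows "inverse_fourier (\<lambda>u. complex_of_real (exp (- (real k * u\<^sup>2 / 2)))) x
    = complex_of_real (exp (- (x\<^sup>2 / (2 * real k))) / sqrt (2 * pi * real k))"
proof -
  let ?r = "sqrt (real k)"
  have r: "?r > 0" using assms by simp
  have "(CLBINT v. complex_of_real (std_normal_density v) * iexp ((- x / ?r) * v)) = char std_normal_distribution (- x / ?r)"
    unfolding char_def by (subst integral_density) (auto simp: scaleR_conv_of_real)
  also have "\<dots> = complex_of_real (exp (- (x\<^sup>2 / (2 * real k))))"
    by (simp add: char_std_normal_distribution power_divide)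
  finally have *: "(CLBINT v. complex_of_real (std_normal_density v) * iexp ((- x / ?r) * v)) = complex_of_real (exp (- (x\<^sup>2 / (2 * real k))))" .
  have "(CLBINT u. iexp (- (u * x)) * complex_of_real (exp (- (real k * u\<^sup>2 / 2))))
     = (CLBINT v. iexp (- (v / ?r * x)) * complex_of_real (exp (- (real k * (v / ?r)\<^sup>2 / 2)))) / ?r"
    using r by (subst lborel_integral_real_affine[where c="1 / ?r" and t=0]) (auto simp: scaleR_conv_of_real)
  also have "(\<lambda>v. iexp (- (v / ?r * x)) * complex_of_real (exp (- (real k * (v / ?r)\<^sup>2 / 2)))) =
      (\<lambda>v. complex_of_real (sqrt (2 * pi)) * (complex_of_real (std_normal_density v) * iexp ((- x / ?r) * v)))"
    using assms by (auto simp: std_normal_density_def power_divide mult_ac)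
  finally have "(CLBINT u. iexp (- (u * x)) * complex_of_real (exp (- (real k * u\<^sup>2 / 2))))
      = complex_of_real (sqrt (2 * pi) * exp (- (x\<^sup>2 / (2 * real k))) / ?r)"
    using * by simp
  then have "inverse_fourier (\<lambda>u. complex_of_real (exp (- (real k * u\<^sup>2 / 2)))) x
      = complex_of_real (sqrt (2 * pi) * exp (- (x\<^sup>2 / (2 * real k))) / ?r / (2 * pi))"
    by (simp add: inverse_fourier_def)
  also have "sqrt (2 * pi) * exp (- (x\<^sup>2 / (2 * real k))) / ?r / (2 * pi) = exp (- (x\<^sup>2 / (2 * real k))) / sqrt (2 * pi * real k)"
    using assms r by (simp add: real_sqrt_mult field_simps)
  finally show ?thesis .
qed

text \<open>
  The substitution \<open>v = sqrt k * u\<close>. Its power of \<open>sqrt k\<close> fixes the order of each error term in the local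
  limit theorem.
\<close>
lemma scaled_gaussian_moment:
  fixes j k :: nat assumes "k > 0"
  shows "integrable lborel (\<lambda>u. \<bar>u\<bar> ^ j * exp (- (real k * u\<^sup>2 / 8)))"
    and "(LBINT u. \<bar>u\<bar> ^ j * exp (- (real k * u\<^sup>2 / 8)))
        = (LBINT v. \<bar>v\<bar> ^ j * exp (- (v\<^sup>2 / 8))) / sqrt (real k) ^ Suc j"
proof -
  let ?r = "sqrt (real k)"
  let ?h = "\<lambda>v::real. \<bar>v\<bar> ^ j * exp (- (v\<^sup>2 / 8))"
  have r: "?r > 0" using assms by simp
  have "integrable lborel (\<lambda>v. sqrt (8 * pi) * (normal_density 0 2 v * \<bar>v - 0\<bar> ^ j))"
    by (intro integrable_mult_right integrable_normal_moment_abs) auto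
  then have h: "integrable lborel ?h" by (simp add: normal_density_def mult.commute)
  have eq: "\<bar>u\<bar> ^ j * exp (- (real k * u\<^sup>2 / 8)) = ?h (0 + ?r * u) / ?r ^ j" for u
    using r by (simp add: abs_mult power_mult_distrib)
  show "integrable lborel (\<lambda>u. \<bar>u\<bar> ^ j * exp (- (real k * u\<^sup>2 / 8)))"
    unfolding eq using r by (intro integrable_divide lborel_integrable_real_affine[OF h]) auto
  have "(LBINT v. ?h v) = ?r * (LBINT u. ?h (0 + ?r * u))"
    using r by (subst lborel_integral_real_affine[where c="?r" and t=0]) auto
  then show "(LBINT u. \<bar>u\<bar> ^ j * exp (- (real k * u\<^sup>2 / 8))) = (LBINT v. ?h v) / ?r ^ Suc j"
    unfolding eq using r by (simp add: field_simps)
qed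

lemma exp_minus_linear_bound:
  fixes y :: real assumes "y \<ge> 0" shows "\<bar>exp (- y) - (1 - y)\<bar> \<le> y\<^sup>2 / 2"
proof -
  have e: "1 + y + y\<^sup>2 / 2 \<le> exp y" by (rule exp_lower_Taylor_quadratic[OF assms])
  have p: "0 < 1 + y + y\<^sup>2 / 2" using assms by (simp add: add_pos_nonneg)
  have "exp (- y) = 1 / exp y" by (simp add: exp_minus inverse_eq_divide)
  also have "\<dots> \<le> 1 / (1 + y + y\<^sup>2 / 2)"
    using e p by (intro divide_left_mono mult_pos_pos) auto
  also have "\<dots> \<le> 1 - y + y\<^sup>2 / 2"
  proof -
    have "(1 - y + y\<^sup>2 / 2) * (1 + y + y\<^sup>2 / 2) = 1 + y ^ 4 / 4"
      by (simp add: algebra_simps power2_eq_square power4_eq_xxxx)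
    then show ?thesis using p by (simp add: pos_divide_le_eq)
  qed
  finally have "exp (- y) \<le> 1 - y + y\<^sup>2 / 2" .
  moreover have "1 - y \<le> exp (- y)" using exp_ge_add_one_self[of "- y"] by simp
  ultimately show ?thesis by (simp add: abs_if)
qed

section \<open>The characteristic function of a standardized density\<close>

text \<open>
  The exponential envelope bounds all moments, and the lower bound on \<open>[-1, 1]\<close> keeps the law away from any
  lattice. Both are stated with explicit parameters so that the estimates below hold uniformly for a family of
  densities.
\<close>
locale standardized_density = bounded_density f A for f :: "real \<Rightarrow> real" and A :: real +
  fixes c \<kappa> :: real
  assumes c_pos: "c > 0" and kappa_pos: "\<kappa> > 0"
    and upper: "\<And>z. f z \<le> A * exp (- c * \<bar>z\<bar>)"
    and lower: "\<And>z. \<bar>z\<bar> \<le> 1 \<Longrightarrow> \<kappa> \<le> f z"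
    and mean: "(LBINT z. z * f z) = 0"
    and second_moment: "(LBINT z. z\<^sup>2 * f z) = 1"
begin

lemma moment_integrable: "integrable lborel (\<lambda>z. z ^ k * f z)"
proof (rule Bochner_Integration.integrable_bound[OF integrable_mult_right[OF integrable_power_exp_abs[OF c_pos, of k], of A]])
  show "AE z in lborel. norm (z ^ k * f z) \<le> norm (A * (\<bar>z\<bar> ^ k * exp (- c * \<bar>z\<bar>)))"
  proof (rule AE_I2)
    fix z
    have "\<bar>z\<bar> ^ k * f z \<le> \<bar>z\<bar> ^ k * (A * exp (- c * \<bar>z\<bar>))" by (intro mult_left_mono upper) auto
    then show "norm (z ^ k * f z) \<le> norm (A * (\<bar>z\<bar> ^ k * exp (- c * \<bar>z\<bar>)))"
      using B_nonneg f_nonneg[of z] by (simp add: abs_mult power_abs mult_ac)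
  qed
qed simp

definition "skew = (LBINT z. z ^ 3 * f z)"

text \<open>
  A bound for the fourth moment in terms of the parameters \<open>A\<close> and \<open>c\<close> alone.
\<close>
definition "fourth_bound = A * (LBINT z. \<bar>z\<bar> ^ 4 * exp (- c * \<bar>z\<bar>))"

lemma fourth_bound_nonneg: "0 \<le> fourth_bound" unfolding fourth_bound_def using B_nonneg by (intro mult_nonneg_nonneg integral_nonneg_AE) auto

lemma fourth_moment_le: "(LBINT z. z ^ 4 * f z) \<le> fourth_bound"
proof -
  have "(LBINT z. z ^ 4 * f z) \<le> (LBINT z. A * (\<bar>z\<bar> ^ 4 * exp (- c * \<bar>z\<bar>)))"
  proof (rule integral_mono[OF moment_integrable integrable_mult_right[OF integrable_power_exp_abs[OF c_pos]]])
    fix z :: real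
    have "\<bar>z\<bar> ^ 4 * f z \<le> \<bar>z\<bar> ^ 4 * (A * exp (- c * \<bar>z\<bar>))" by (intro mult_left_mono upper) auto
    then show "z ^ 4 * f z \<le> A * (\<bar>z\<bar> ^ 4 * exp (- c * \<bar>z\<bar>))" by (simp add: power_even_abs mult_ac)
  qed
  then show ?thesis by (simp add: fourth_bound_def)
qed

lemma char_taylor: "cmod (\<phi> u - (1 - u\<^sup>2 / 2 - \<i> * (skew * u ^ 3 / 6))) \<le> fourth_bound * u ^ 4 / 24"
proof -
  let ?T = "\<lambda>z. \<Sum>k\<le>3. (\<i> * complex_of_real (u * z)) ^ k / fact k"
  have T: "complex_of_real (f z) * ?T z = complex_of_real (z ^ 0 * f z) + \<i> * u * complex_of_real (z ^ 1 * f z)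
      - u\<^sup>2 / 2 * complex_of_real (z\<^sup>2 * f z) - \<i> * (u ^ 3 / 6) * complex_of_real (z ^ 3 * f z)" for z
    by (simp add: eval_nat_numeral field_simps)
  note mi = integrable_of_real[OF moment_integrable, where 'a=complex]
  have iT: "integrable lborel (\<lambda>z. complex_of_real (f z) * ?T z)"
    unfolding T by (intro Bochner_Integration.integrable_diff Bochner_Integration.integrable_add integrable_mult_right mi)
  have "(CLBINT z. complex_of_real (f z) * ?T z) =
      complex_of_real (LBINT z. z ^ 0 * f z) + \<i> * u * complex_of_real (LBINT z. z ^ 1 * f z)
      - u\<^sup>2 / 2 * complex_of_real (LBINT z. z\<^sup>2 * f z) - \<i> * (u ^ 3 / 6) * complex_of_real (LBINT z. z ^ 3 * f z)"
    unfolding T by (subst Bochner_Integration.integral_diff Bochner_Integration.integral_add,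
      intro Bochner_Integration.integrable_diff Bochner_Integration.integrable_add integrable_mult_right mi,
      intro Bochner_Integration.integrable_diff Bochner_Integration.integrable_add integrable_mult_right mi)+
      (simp only: integral_mult_right_zero integral_complex_of_real)
  also have "\<dots> = 1 - u\<^sup>2 / 2 - \<i> * (skew * u ^ 3 / 6)" by (simp add: f_integral mean second_moment skew_def)
  finally have I: "(CLBINT z. complex_of_real (f z) * ?T z) = 1 - u\<^sup>2 / 2 - \<i> * (skew * u ^ 3 / 6)" .
  have ie: "integrable lborel (\<lambda>z. complex_of_real (f z) * iexp (u * z))"
    by (rule Bochner_Integration.integrable_bound[OF f_integrable]) (auto simp: norm_mult simp del: of_real_mult)
  have "\<phi> u - (1 - u\<^sup>2 / 2 - \<i> * (skew * u ^ 3 / 6)) = (CLBINT z. complex_of_real (f z) * iexp (u * z) - complex_of_real (f z) * ?T z)"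
    unfolding char_eq I[symmetric] by (rule Bochner_Integration.integral_diff[symmetric, OF ie iT])
  also have "cmod \<dots> \<le> (LBINT z. cmod (complex_of_real (f z) * iexp (u * z) - complex_of_real (f z) * ?T z))"
    by (rule integral_norm_bound)
  also have "\<dots> \<le> (LBINT z. u ^ 4 / 24 * (z ^ 4 * f z))"
  proof (rule integral_mono)
    show "integrable lborel (\<lambda>z. cmod (complex_of_real (f z) * iexp (u * z) - complex_of_real (f z) * ?T z))"
      by (intro integrable_norm Bochner_Integration.integrable_diff ie iT)
    show "integrable lborel (\<lambda>z. u ^ 4 / 24 * (z ^ 4 * f z))" by (intro integrable_mult_right moment_integrable)
    fix z
    have "cmod (complex_of_real (f z) * iexp (u * z) - complex_of_real (f z) * ?T z) = f z * cmod (iexp (u * z) - ?T z)"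
      by (simp only: right_diff_distrib[symmetric] norm_mult norm_of_real abs_of_nonneg[OF f_nonneg])
    also have "\<dots> \<le> f z * (\<bar>u * z\<bar> ^ Suc 3 / fact (Suc 3))"
      by (intro mult_left_mono f_nonneg iexp_approx1)
    also have "\<dots> = u ^ 4 / 24 * (z ^ 4 * f z)"
    proof -
      have "\<bar>u * z\<bar> ^ 4 = u ^ 4 * z ^ 4" by (simp add: power_even_abs power_mult_distrib)
      then show ?thesis by (simp add: fact_numeral)
    qed
    finally show "cmod (complex_of_real (f z) * iexp (u * z) - complex_of_real (f z) * ?T z) \<le> u ^ 4 / 24 * (z ^ 4 * f z)" .
  qed
  also have "\<dots> \<le> u ^ 4 / 24 * fourth_bound" using fourth_moment_le by (simp add: mult_left_mono)
  finally show ?thesis by (simp add: mult.commute)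
qed

text \<open>
  Mean \<open>0\<close> and variance \<open>1\<close> make \<open>\<phi>\<close> and the Gaussian agree to second order; the third-order term is the
  third moment, kept separate because it vanishes in the applications.
\<close>
lemma char_gaussian_diff:
  "cmod (\<phi> u - complex_of_real (exp (- (u\<^sup>2 / 2)))) \<le> \<bar>skew\<bar> * \<bar>u\<bar> ^ 3 / 6 + (fourth_bound / 24 + 1 / 8) * \<bar>u\<bar> ^ 4"
proof -
  define g where "g = exp (- (u\<^sup>2 / 2)) - (1 - u\<^sup>2 / 2)"
  have "(u\<^sup>2 / 2)\<^sup>2 / 2 = u ^ 4 / 8" by (simp add: power2_eq_square power4_eq_xxxx)
  then have g: "\<bar>g\<bar> \<le> u ^ 4 / 8"
    unfolding g_def using exp_minus_linear_bound[of "u\<^sup>2 / 2"] by simp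
  define P where "P = 1 - (complex_of_real u)\<^sup>2 / 2 - \<i> * complex_of_real (skew * u ^ 3 / 6)"
  have "complex_of_real (exp (- (u\<^sup>2 / 2))) = complex_of_real g + (1 - (complex_of_real u)\<^sup>2 / 2)"
    unfolding g_def by simp
  then have E: "\<phi> u - complex_of_real (exp (- (u\<^sup>2 / 2))) = (\<phi> u - P) - \<i> * complex_of_real (skew * u ^ 3 / 6) - complex_of_real g"
    unfolding P_def by (simp only:) (simp only: algebra_simps)
  have "cmod (\<phi> u - complex_of_real (exp (- (u\<^sup>2 / 2)))) \<le> cmod (\<phi> u - P) + cmod (\<i> * complex_of_real (skew * u ^ 3 / 6)) + cmod (complex_of_real g)"
    unfolding E
    using norm_triangle_ineq4[of "(\<phi> u - P) - \<i> * complex_of_real (skew * u ^ 3 / 6)" "complex_of_real g"]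
      norm_triangle_ineq4[of "\<phi> u - P" "\<i> * complex_of_real (skew * u ^ 3 / 6)"] by linarith
  also have "cmod (\<i> * complex_of_real (skew * u ^ 3 / 6)) = \<bar>skew\<bar> * \<bar>u\<bar> ^ 3 / 6"
    by (simp add: norm_mult norm_power norm_divide)
  also have "cmod (\<phi> u - P) + \<bar>skew\<bar> * \<bar>u\<bar> ^ 3 / 6 + cmod (complex_of_real g)
      \<le> fourth_bound * u ^ 4 / 24 + \<bar>skew\<bar> * \<bar>u\<bar> ^ 3 / 6 + u ^ 4 / 8"
    using char_taylor[of u] g unfolding P_def norm_of_real by linarith
  also have "\<dots> = \<bar>skew\<bar> * \<bar>u\<bar> ^ 3 / 6 + (fourth_bound / 24 + 1 / 8) * \<bar>u\<bar> ^ 4"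
    by (simp add: distrib_right)
  finally show ?thesis .
qed

text \<open>
  In this neighbourhood the terms of order three and four cost at most \<open>u\<^sup>2 / 4\<close> of the main term \<open>u\<^sup>2 / 2\<close>.
\<close>
lemma char_near:
  assumes "\<bar>skew\<bar> \<le> 1" "\<bar>u\<bar> \<le> 1 / (1 + fourth_bound)"
  shows "cmod (\<phi> u) \<le> exp (- (u\<^sup>2 / 4))"
proof -
  have p: "0 < 1 + fourth_bound" using fourth_bound_nonneg by simp
  have um: "\<bar>u\<bar> * (1 + fourth_bound) \<le> 1" using assms(2) p by (simp add: pos_le_divide_eq)
  have u1: "\<bar>u\<bar> \<le> 1" using um fourth_bound_nonneg by (smt (verit) mult_le_cancel_left1 abs_ge_zero)
  have u2: "u\<^sup>2 \<le> 1" using u1 by (simp add: abs_square_le_1)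
  let ?P = "1 - (complex_of_real u)\<^sup>2 / 2 - \<i> * complex_of_real (skew * u ^ 3 / 6)"
  have "cmod ?P \<le> cmod (complex_of_real (1 - u\<^sup>2 / 2)) + cmod (\<i> * (skew * u ^ 3 / 6))"
    using norm_triangle_ineq4[of "complex_of_real (1 - u\<^sup>2 / 2)" "\<i> * (skew * u ^ 3 / 6)"]
    by (simp only: of_real_diff of_real_1 of_real_divide of_real_power of_real_numeral)
  also have "cmod (complex_of_real (1 - u\<^sup>2 / 2)) = 1 - u\<^sup>2 / 2" using u2 by (simp only: norm_of_real)
  also have "cmod (\<i> * (skew * u ^ 3 / 6)) = \<bar>skew\<bar> * \<bar>u\<bar> ^ 3 / 6" by (simp add: norm_mult norm_power norm_divide)
  also have "\<dots> \<le> u\<^sup>2 * \<bar>u\<bar> / 6"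
    using assms(1) mult_right_mono[of "\<bar>skew\<bar>" 1 "\<bar>u\<bar> ^ 3"] by (simp add: eval_nat_numeral)
  finally have P: "cmod ?P \<le> 1 - u\<^sup>2 / 2 + u\<^sup>2 * \<bar>u\<bar> / 6" by simp
  have "u ^ 4 \<le> u\<^sup>2 * \<bar>u\<bar>"
    proof -
    have "u ^ 4 = (u\<^sup>2 * \<bar>u\<bar>) * \<bar>u\<bar>" by (simp add: power2_eq_square power4_eq_xxxx mult.assoc)
    also have "\<dots> \<le> (u\<^sup>2 * \<bar>u\<bar>) * 1" by (intro mult_left_mono u1) auto
    finally show ?thesis by simp
  qed
  then have "fourth_bound * u ^ 4 / 24 \<le> u\<^sup>2 * (\<bar>u\<bar> * fourth_bound) / 24"
    using mult_left_mono[of "u ^ 4" "u\<^sup>2 * \<bar>u\<bar>" fourth_bound] fourth_bound_nonneg by (simp add: mult_ac)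
  also have "\<dots> \<le> u\<^sup>2 * (1 - \<bar>u\<bar>) / 24"
    using mult_left_mono[of "\<bar>u\<bar> * fourth_bound" "1 - \<bar>u\<bar>" "u\<^sup>2"] um by (simp add: algebra_simps)
  finally have Q: "fourth_bound * u ^ 4 / 24 \<le> u\<^sup>2 * (1 - \<bar>u\<bar>) / 24" .
  have "cmod (\<phi> u) \<le> cmod ?P + cmod (\<phi> u - ?P)" using norm_triangle_sub[of "\<phi> u" ?P] by simp
  also have "\<dots> \<le> (1 - u\<^sup>2 / 2 + u\<^sup>2 * \<bar>u\<bar> / 6) + u\<^sup>2 * (1 - \<bar>u\<bar>) / 24"
    using P Q char_taylor[of u] by linarith
  also have "\<dots> \<le> 1 - u\<^sup>2 / 4"
  proof -
    have "u\<^sup>2 * \<bar>u\<bar> \<le> u\<^sup>2 * 1" by (intro mult_left_mono u1) auto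
    moreover have "u\<^sup>2 * (1 - \<bar>u\<bar>) = u\<^sup>2 - u\<^sup>2 * \<bar>u\<bar>" by (simp add: right_diff_distrib)
    moreover have "0 \<le> u\<^sup>2" by simp
    ultimately show ?thesis by linarith
  qed
  also have "\<dots> \<le> exp (- (u\<^sup>2 / 4))" using exp_ge_add_one_self[of "- (u\<^sup>2 / 4)"] by simp
  finally show ?thesis .
qed

text \<open>
  Split \<open>f\<close> into \<open>\<kappa>\<close> times the indicator of \<open>[-1, 1]\<close>, whose transform is \<open>2 * \<kappa> * sin u / u\<close>, and a
  nonnegative remainder of mass \<open>1 - 2 * \<kappa>\<close>.
\<close>
lemma char_far:
  assumes d: "0 < d" "d \<le> 1" "d \<le> \<bar>u\<bar>"
  shows "cmod (\<phi> u) \<le> 1 - 2 * \<kappa> * (1 - max (1/2) (cos (d/2)))"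
proof -
  let ?I = "\<lambda>x::real. indicator {-1..1} x :: real"
  have iI: "integrable lborel ?I" by (rule integrable_real_indicator) (auto simp: emeasure_lborel_Icc_eq)
  have ge: "\<kappa> * ?I x \<le> f x" for x using lower[of x] f_nonneg[of x] by (auto simp: indicator_def)
  have i1: "integrable lborel (\<lambda>x. complex_of_real (f x - \<kappa> * ?I x) * iexp (u * x))"
    by (rule Bochner_Integration.integrable_bound[OF Bochner_Integration.integrable_diff[OF f_integrable integrable_mult_right[OF iI, of \<kappa>]]])
       (auto simp: norm_mult simp del: of_real_mult of_real_diff)
  have i2: "integrable lborel (\<lambda>x. complex_of_real (?I x) * iexp (u * x))"
    by (rule Bochner_Integration.integrable_bound[OF iI]) (auto simp: norm_mult simp del: of_real_mult)
  have "(CLBINT x. complex_of_real (?I x) * iexp (u * x)) = (CLINT x:{-1..1}|lborel. iexp (- ((- u) * x)))"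
    by (simp add: set_lebesgue_integral_def scaleR_conv_of_real)
  also have "\<dots> = (iexp (-((-u) * (-1))) - iexp (-((-u) * 1))) / (\<i> * (-u))"
    using d by (subst exponential_kernel_integral) auto
  also have "\<dots> = complex_of_real (2 * sin u / u)"
    using d sin_exp_eq[of "complex_of_real u"] by (simp add: sin_of_real[symmetric] divide_simps) (simp add: algebra_simps)
  finally have K: "(CLBINT x. complex_of_real (?I x) * iexp (u * x)) = complex_of_real (2 * sin u / u)" .
  have Kle: "cmod (complex_of_real (2 * sin u / u)) \<le> 2 * max (1/2) (cos (d/2))"
    using abs_sin_le_cos_half[OF d] d by (simp only: norm_of_real abs_divide abs_mult) (simp add: pos_divide_le_eq)
  have "\<phi> u = (CLBINT x. complex_of_real (f x - \<kappa> * ?I x) * iexp (u * x) + \<kappa> * (complex_of_real (?I x) * iexp (u * x)))"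
    unfolding char_eq by (intro Bochner_Integration.integral_cong) (auto simp: algebra_simps)
  also have "\<dots> = (CLBINT x. complex_of_real (f x - \<kappa> * ?I x) * iexp (u * x)) + \<kappa> * complex_of_real (2 * sin u / u)"
    unfolding K[symmetric] by (subst Bochner_Integration.integral_add[OF i1 integrable_mult_right[OF i2]]) simp
  finally have "cmod (\<phi> u) \<le> cmod (CLBINT x. complex_of_real (f x - \<kappa> * ?I x) * iexp (u * x)) + \<kappa> * cmod (complex_of_real (2 * sin u / u))"
    using norm_triangle_ineq[of "CLBINT x. complex_of_real (f x - \<kappa> * ?I x) * iexp (u * x)" "\<kappa> * complex_of_real (2 * sin u / u)"] kappa_pos
    by (simp only: norm_mult norm_of_real abs_of_pos)
  also have "cmod (CLBINT x. complex_of_real (f x - \<kappa> * ?I x) * iexp (u * x)) \<le> (LBINT x. cmod (complex_of_real (f x - \<kappa> * ?I x) * iexp (u * x)))"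
    by (rule integral_norm_bound)
  also have "\<dots> = (LBINT x. f x - \<kappa> * ?I x)"
    using ge by (intro Bochner_Integration.integral_cong) (auto simp: norm_mult simp del: of_real_mult of_real_diff)
  also have "\<dots> = 1 - 2 * \<kappa>"
    by (subst Bochner_Integration.integral_diff[OF f_integrable integrable_mult_right[OF iI]]) (simp add: f_integral)
  finally have "cmod (\<phi> u) \<le> 1 - 2 * \<kappa> + \<kappa> * cmod (complex_of_real (2 * sin u / u))" by simp
  also have "\<dots> \<le> 1 - 2 * \<kappa> + \<kappa> * (2 * max (1/2) (cos (d/2)))"
    using Kle kappa_pos by (intro add_left_mono mult_left_mono) auto
  finally show ?thesis by (simp add: algebra_simps)
qed

end

section \<open>A quantitative local limit theorem\<close>

lemma inverse_fourier_diff: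
  assumes "integrable lborel \<psi>" "integrable lborel \<xi>"
  shows "inverse_fourier (\<lambda>u. \<psi> u - \<xi> u) x = inverse_fourier \<psi> x - inverse_fourier \<xi> x"
proof -
  have i: "integrable lborel (\<lambda>u. iexp (- (u * x)) * \<theta> u)" if "integrable lborel \<theta>" for \<theta>
    by (rule Bochner_Integration.integrable_bound[OF that])
       (use that in \<open>auto simp: norm_mult simp del: of_real_mult of_real_minus\<close>)
  show ?thesis
    unfolding inverse_fourier_def right_diff_distrib
    by (subst Bochner_Integration.integral_diff[OF i[OF assms(1)] i[OF assms(2)]]) (rule diff_divide_distrib)
qed

context standardized_density
begin

text \<open>
  Within \<open>near_radius\<close> of \<open>0\<close> the function \<open>\<phi>\<close> is compared with the Gaussian; outside, \<open>decay\<close> dominates the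
  absolute values of both.
\<close>
definition "near_radius = 1 / (1 + fourth_bound)"
definition "decay = max (max (1/2) (1 - 2 * \<kappa> * (1 - max (1/2) (cos (near_radius/2))))) (exp (- (near_radius\<^sup>2 / 2)))"

lemma near_radius: "0 < near_radius" "near_radius \<le> 1"
  unfolding near_radius_def using fourth_bound_nonneg by (auto simp: pos_divide_le_eq)

lemma decay: "0 < decay" "decay < 1"
proof -
  show "0 < decay" unfolding decay_def by (auto simp: max_def)
  have "cos (near_radius/2) < 1" using cos_monotone_0_pi[of 0 "near_radius/2"] near_radius pi_gt3 by simp
  then have "0 < 2 * \<kappa> * (1 - max (1/2) (cos (near_radius/2)))" using kappa_pos by (auto simp: max_def)
  then show "decay < 1" unfolding decay_def using near_radius by simp
qed

text \<open>
  In the far region two of the \<open>k\<close> factors are set aside, since \<open>\<bar>\<phi>\<bar>\<^sup>2\<close> and the Gaussian are what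
  ensures integrability over the whole line.
\<close>
lemma char_power_gaussian_diff:
  assumes m: "\<bar>skew\<bar> \<le> 1" and k: "3 \<le> k"
  shows "cmod (\<phi> u ^ k - complex_of_real (exp (- (real k * u\<^sup>2 / 2)))) \<le>
      real k * (\<bar>skew\<bar> / 6) * (\<bar>u\<bar> ^ 3 * exp (- (real k * u\<^sup>2 / 8)))
      + real k * (fourth_bound / 24 + 1 / 8) * (\<bar>u\<bar> ^ 4 * exp (- (real k * u\<^sup>2 / 8)))
      + decay ^ (k - 2) * ((cmod (\<phi> u))\<^sup>2 + exp (- (u\<^sup>2 / 2)))" (is "?L \<le> ?N + ?F")
proof -
  let ?g = "complex_of_real (exp (- (u\<^sup>2 / 2)))"
  have gk: "complex_of_real (exp (- (real k * u\<^sup>2 / 2))) = ?g ^ k"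
    by (simp only: of_real_power[symmetric] exp_of_nat_mult[symmetric]) simp
  have N0: "0 \<le> ?N" using fourth_bound_nonneg by (intro add_nonneg_nonneg mult_nonneg_nonneg) auto
  have F0: "0 \<le> ?F" using decay by (intro mult_nonneg_nonneg add_nonneg_nonneg) auto
  show ?thesis
  proof (cases "\<bar>u\<bar> \<le> near_radius")
    case True
    let ?r = "exp (- (u\<^sup>2 / 4))"
    have "?L \<le> real k * ?r ^ (k - 1) * cmod (\<phi> u - ?g)"
      unfolding gk using char_near[OF m] True
      by (intro norm_power_diff_le) (auto simp: near_radius_def simp del: of_real_exp)
    also have "?r ^ (k - 1) = exp (- (real (k - 1) * (u\<^sup>2 / 4)))"
      by (simp only: exp_of_nat_mult[symmetric]) simp
    also have "real k * exp (- (real (k - 1) * (u\<^sup>2 / 4))) * cmod (\<phi> u - ?g) \<le>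
        real k * exp (- (real k * u\<^sup>2 / 8)) * (\<bar>skew\<bar> * \<bar>u\<bar> ^ 3 / 6 + (fourth_bound / 24 + 1 / 8) * \<bar>u\<bar> ^ 4)"
    proof (intro mult_mono char_gaussian_diff)
      have "real k * u\<^sup>2 \<le> (2 * real (k - 1)) * u\<^sup>2" using k by (intro mult_right_mono) auto
      then show "exp (- (real (k - 1) * (u\<^sup>2 / 4))) \<le> exp (- (real k * u\<^sup>2 / 8))" by simp
    qed auto
    also have "\<dots> = ?N" by (simp add: field_simps)
    finally show ?thesis using F0 by linarith
  next
    case False
    then have nu: "near_radius \<le> \<bar>u\<bar>" by simp
    have kk: "k = (k - 2) + 2" using k by simp
    have "cmod (\<phi> u ^ k) = cmod (\<phi> u) ^ (k - 2) * (cmod (\<phi> u))\<^sup>2"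
      by (subst kk) (simp only: norm_power norm_mult power_add)
    also have "\<dots> \<le> decay ^ (k - 2) * (cmod (\<phi> u))\<^sup>2"
    proof (intro mult_right_mono power_mono)
      show "cmod (\<phi> u) \<le> decay" using char_far[OF near_radius nu] unfolding decay_def by simp
    qed auto
    finally have 1: "cmod (\<phi> u ^ k) \<le> decay ^ (k - 2) * (cmod (\<phi> u))\<^sup>2" .
    have n2: "near_radius\<^sup>2 \<le> u\<^sup>2" using nu near_radius by (simp add: abs_le_square_iff[symmetric])
    have "cmod (?g ^ k) = exp (- (u\<^sup>2 / 2)) ^ k" by (simp only: norm_power norm_of_real) simp
    also have "\<dots> = exp (- (u\<^sup>2 / 2)) ^ (k - 2) * exp (- (u\<^sup>2 / 2)) ^ 2"
      by (subst kk) (simp only: power_add)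
    also have "\<dots> \<le> decay ^ (k - 2) * exp (- (u\<^sup>2 / 2))"
    proof (intro mult_mono power_mono)
      show "exp (- (u\<^sup>2 / 2)) \<le> decay" unfolding decay_def using n2 by (intro max.coboundedI2) simp
      show "exp (- (u\<^sup>2 / 2)) ^ 2 \<le> exp (- (u\<^sup>2 / 2))" unfolding power2_eq_square by (rule mult_left_le) auto
    qed (use decay in auto)
    finally have 2: "cmod (?g ^ k) \<le> decay ^ (k - 2) * exp (- (u\<^sup>2 / 2))" .
    have "?L \<le> cmod (\<phi> u ^ k) + cmod (?g ^ k)" unfolding gk by (rule norm_triangle_ineq4)
    also have "\<dots> \<le> ?F" using 1 2 unfolding distrib_left by linarith
    finally show ?thesis using N0 by linarith
  qed
qed

definition "I3 = (LBINT v. \<bar>v::real\<bar> ^ 3 * exp (- (v\<^sup>2 / 8)))"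
definition "I4 = (LBINT v. \<bar>v::real\<bar> ^ 4 * exp (- (v\<^sup>2 / 8)))"
definition "clt_const = I3 / 6 + (fourth_bound / 24 + 1 / 8) * I4 + (2 * pi * A + sqrt (2 * pi)) / decay\<^sup>2"

lemma clt_const_nonneg: "0 \<le> I3" "0 \<le> I4" "0 \<le> clt_const"
proof -
  show "0 \<le> I3" "0 \<le> I4" unfolding I3_def I4_def by (auto intro!: integral_nonneg_AE)
  then show "0 \<le> clt_const" unfolding clt_const_def using fourth_bound_nonneg B_nonneg
    by (intro add_nonneg_nonneg mult_nonneg_nonneg divide_nonneg_nonneg) auto
qed

text \<open>
  Integrating the preceding bound, the third-order term contributes \<open>k * \<bar>skew\<bar> * k powr (- 2)\<close>, the
  fourth-order term \<open>k * k powr (- 5/2)\<close>, and the far region a geometrically small amount. Relative to the main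
  term of order \<open>1 / sqrt k\<close> the error is thus \<open>O(\<bar>skew\<bar> / sqrt k + 1 / k)\<close>.
\<close>
theorem local_limit_estimate:
  assumes m: "\<bar>skew\<bar> \<le> 1" and k: "3 \<le> k"
  shows "\<bar>enn2real (sum_density f k x) - exp (- (x\<^sup>2 / (2 * real k))) / sqrt (2 * pi * real k)\<bar>
    \<le> clt_const * (\<bar>skew\<bar> / real k + 1 / (real k * sqrt (real k)) + decay ^ k)"
proof -
  let ?g = "\<lambda>u. complex_of_real (exp (- (real k * u\<^sup>2 / 2)))"
  let ?h3 = "\<lambda>u. \<bar>u\<bar> ^ 3 * exp (- (real k * u\<^sup>2 / 8))"
  let ?h4 = "\<lambda>u. \<bar>u\<bar> ^ 4 * exp (- (real k * u\<^sup>2 / 8))"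
  let ?N = "\<lambda>u. real k * (\<bar>skew\<bar> / 6) * ?h3 u + real k * (fourth_bound / 24 + 1 / 8) * ?h4 u
     + decay ^ (k - 2) * ((cmod (\<phi> u))\<^sup>2 + exp (- (u\<^sup>2 / 2)))"
  have k0: "0 < k" using k by simp
  have gauss: "integrable lborel (\<lambda>u::real. exp (- (u\<^sup>2 / 2)))" "(LBINT u. exp (- (u\<^sup>2 / 2))) = sqrt (2 * pi)"
  proof -
    have e: "exp (- (u\<^sup>2 / 2)) = sqrt (2 * pi) * std_normal_density u" for u :: real
      by (simp add: std_normal_density_def)
    show "integrable lborel (\<lambda>u::real. exp (- (u\<^sup>2 / 2)))" unfolding e by (intro integrable_mult_right) auto
    show "(LBINT u. exp (- (u\<^sup>2 / 2))) = sqrt (2 * pi)" unfolding e by simp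
  qed
  have ig: "integrable lborel ?g"
  proof (rule Bochner_Integration.integrable_bound[OF gauss(1)], simp, rule AE_I2)
    fix u :: real
    have "1 * u\<^sup>2 \<le> real k * u\<^sup>2" using k0 by (intro mult_right_mono) auto
    then show "norm (?g u) \<le> norm (exp (- (u\<^sup>2 / 2)))" by (simp only: norm_of_real) simp
  qed
  have ip: "integrable lborel (\<lambda>u. \<phi> u ^ k)" using k by (intro char_power_integrable) simp
  note h3 = scaled_gaussian_moment[OF k0, of 3] and h4 = scaled_gaussian_moment[OF k0, of 4]
  have iN: "integrable lborel ?N"
    by (intro Bochner_Integration.integrable_add integrable_mult_right h3(1) h4(1) char_square_integrable gauss(1))
  have "(LBINT u. cmod (\<phi> u ^ k - ?g u)) \<le> (LBINT u. ?N u)"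
    by (intro integral_mono integrable_norm Bochner_Integration.integrable_diff ip ig iN char_power_gaussian_diff[OF m k])
  also have "\<dots> = real k * (\<bar>skew\<bar> / 6) * (LBINT u. ?h3 u) + real k * (fourth_bound / 24 + 1 / 8) * (LBINT u. ?h4 u)
     + decay ^ (k - 2) * ((LBINT u. (cmod (\<phi> u))\<^sup>2) + sqrt (2 * pi))"
    using h3(1) h4(1) char_square_integrable gauss by (simp add: Bochner_Integration.integral_add)
  also have "\<dots> \<le> real k * (\<bar>skew\<bar> / 6) * (I3 / (real k)\<^sup>2) + real k * (fourth_bound / 24 + 1 / 8) * (I4 / ((real k)\<^sup>2 * sqrt (real k)))
     + decay ^ (k - 2) * (2 * pi * A + sqrt (2 * pi))"
  proof -
    have s4: "sqrt (real k) ^ Suc 3 = (real k)\<^sup>2" "sqrt (real k) ^ Suc 4 = (real k)\<^sup>2 * sqrt (real k)"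
      by (simp_all add: eval_nat_numeral)
    show ?thesis unfolding h3(2) h4(2) s4 I3_def[symmetric] I4_def[symmetric]
      using decay char_square_integral by (intro add_left_mono mult_left_mono add_right_mono) auto
  qed
  also have "\<dots> = (I3 / 6) * (\<bar>skew\<bar> / real k) + ((fourth_bound / 24 + 1 / 8) * I4) * (1 / (real k * sqrt (real k)))
     + (2 * pi * A + sqrt (2 * pi)) / decay\<^sup>2 * decay ^ k"
  proof -
    have "decay ^ k = decay ^ (k - 2) * decay\<^sup>2" 
    proof -
      have "k - 2 + 2 = k" using k by simp
      then show ?thesis by (metis power_add)
    qed
    then have "decay ^ (k - 2) = decay ^ k / decay\<^sup>2" using decay by simp
    then show ?thesis using k0 by (simp add: power2_eq_square mult.commute)
  qed
  also have "\<dots> \<le> clt_const * (\<bar>skew\<bar> / real k) + clt_const * (1 / (real k * sqrt (real k))) + clt_const * decay ^ k"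
  proof (intro add_mono mult_right_mono)
    have "0 \<le> (fourth_bound / 24 + 1 / 8) * I4" "0 \<le> I3 / 6" "0 \<le> (2 * pi * A + sqrt (2 * pi)) / decay\<^sup>2"
      using clt_const_nonneg fourth_bound_nonneg B_nonneg by auto
    then show "I3 / 6 \<le> clt_const" "(fourth_bound / 24 + 1 / 8) * I4 \<le> clt_const" "(2 * pi * A + sqrt (2 * pi)) / decay\<^sup>2 \<le> clt_const"
      unfolding clt_const_def by linarith+
  qed (use decay in auto)
  finally have int: "(LBINT u. cmod (\<phi> u ^ k - ?g u))
      \<le> clt_const * (\<bar>skew\<bar> / real k + 1 / (real k * sqrt (real k)) + decay ^ k)" by (simp add: distrib_left)
  have "enn2real (sum_density f k x) - exp (- (x\<^sup>2 / (2 * real k))) / sqrt (2 * pi * real k)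
      = Re (inverse_fourier (\<lambda>u. \<phi> u ^ k - ?g u) x)"
    using sum_density_inversion[OF k, of x] inverse_fourier_diff[OF ip ig, of x] inverse_fourier_gaussian[OF k0, of x] by simp
  then have "\<bar>enn2real (sum_density f k x) - exp (- (x\<^sup>2 / (2 * real k))) / sqrt (2 * pi * real k)\<bar>
      \<le> cmod (inverse_fourier (\<lambda>u. \<phi> u ^ k - ?g u) x)" using abs_Re_le_cmod by simp
  also have "\<dots> \<le> (LBINT u. cmod (\<phi> u ^ k - ?g u)) / (2 * pi)"
    by (intro inverse_fourier_bounded Bochner_Integration.integrable_diff ip ig)
  also have "\<dots> \<le> (LBINT u. cmod (\<phi> u ^ k - ?g u))"
  proof -
    have "1 \<le> 2 * pi" using pi_gt3 by simp
    moreover have "0 \<le> (LBINT u. cmod (\<phi> u ^ k - ?g u))" by (intro integral_nonneg_AE) auto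
    ultimately show ?thesis using divide_left_mono[of 1 "2 * pi" "\<integral>u. cmod (\<phi> u ^ k - ?g u) \<partial>lborel"] by simp
  qed
  finally show ?thesis using int by linarith
qed

end

section \<open>Slowly changing curvature: the regularly varying case\<close>

lemma eventually_at_top_beyond:
  fixes b :: real
  assumes "eventually P at_top"
  obtains X where "X > b" "\<And>x. x \<ge> X \<Longrightarrow> P x"
proof -
  obtain N where "\<And>x. x \<ge> N \<Longrightarrow> P x" using assms by (auto simp: eventually_at_top_linorder)
  then show thesis by (intro that[of "max N (b + 1)"]) auto
qed

lemma derivs_onD:
  assumes "derivs_on k S f D"
  shows "D 0 = f" and "\<And>i x. i < k \<Longrightarrow> x \<in> S \<Longrightarrow> (D i has_real_derivative D (Suc i) x) (at x within S)"
  using assms unfolding derivs_on_def by auto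

text \<open>
  If the elasticity \<open>x * f' x / f x\<close> is bounded, then \<open>ln f\<close> is Lipschitz with respect to relative changes of
  its argument.
\<close>
lemma log_difference_bound:
  fixes f :: "real \<Rightarrow> real"
  assumes X: "0 < X" "0 \<le> C"
    and f: "\<And>x. x \<ge> X \<Longrightarrow> f x > 0" "\<And>x. x \<ge> X \<Longrightarrow> (f has_real_derivative f' x) (at x)"
      "\<And>x. x \<ge> X \<Longrightarrow> \<bar>x * f' x\<bar> \<le> C * f x"
    and xy: "x / 2 \<ge> X" "\<bar>y - x\<bar> \<le> x / 2"
  shows "\<bar>ln (f y) - ln (f x)\<bar> \<le> 2 * C * (\<bar>y - x\<bar> / x)"
proof -
  have x0: "x > 0" using xy X by simp
  have "norm (ln (f y) - ln (f x)) \<le> (2 * C / x) * norm (y - x)"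
  proof (rule field_differentiable_bound)
    show "convex {x/2..}" by simp
    fix z assume z: "z \<in> {x/2..}"
    then have zX: "z \<ge> X" "z > 0" using xy X by auto
    have "(ln has_real_derivative 1 / f z) (at (f z))" by (rule DERIV_ln_divide[OF f(1)[OF zX(1)]])
    from DERIV_chain2[OF this f(2)[OF zX(1)]]
    show "((\<lambda>z. ln (f z)) has_field_derivative f' z / f z) (at z within {x/2..})"
      by (simp add: has_field_derivative_at_within)
    have "\<bar>f' z\<bar> * z \<le> C * f z" using f(3)[OF zX(1)] zX by (simp add: abs_mult mult.commute)
    then have "norm (f' z / f z) \<le> C / z"
      using f(1)[OF zX(1)] zX by (simp add: pos_divide_le_eq pos_le_divide_eq)
    also have "\<dots> \<le> C / (x / 2)" using z X x0 by (intro divide_left_mono) auto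
    finally show "norm (f' z / f z) \<le> 2 * C / x" by (simp add: mult.commute)
  next
    show "x \<in> {x/2..}" "y \<in> {x/2..}" unfolding atLeast_iff using xy x0 by linarith+
  qed
  then show ?thesis by simp
qed

text \<open>
  A function of bounded elasticity is asymptotically constant over windows of relative size \<open>o(1)\<close>. Below, this
  applies to \<open>h\<close> in the regularly varying case and to the derivative of its inverse in the rapidly varying case.
\<close>
lemma ratio_tendsto_one:
  fixes f :: "real \<Rightarrow> real" and x y :: "nat \<Rightarrow> real"
  assumes ev: "\<forall>\<^sub>F z in at_top. f z > 0 \<and> (f has_real_derivative f' z) (at z) \<and> \<bar>z * f' z\<bar> \<le> C * f z"
    and x: "filterlim x at_top sequentially" and y: "(\<lambda>n. (y n - x n) / x n) \<longlonglongrightarrow> 0"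
  shows "(\<lambda>n. f (y n) / f (x n)) \<longlonglongrightarrow> 1"
proof -
  obtain X where X: "X > 0" "\<And>z. z \<ge> X \<Longrightarrow> f z > 0 \<and> (f has_real_derivative f' z) (at z) \<and> \<bar>z * f' z\<bar> \<le> C * f z"
    using eventually_at_top_beyond[OF ev, of 0] by blast
  have C: "0 \<le> C" using X(2)[of X] by (smt (verit) mult_nonneg_nonpos2 mult_neg_pos)
  have ex: "\<forall>\<^sub>F n in sequentially. x n / 2 \<ge> X \<and> \<bar>y n - x n\<bar> \<le> x n / 2"
  proof -
    have "\<forall>\<^sub>F n in sequentially. x n \<ge> 2 * X" using x by (auto simp: filterlim_at_top)
    moreover have "\<forall>\<^sub>F n in sequentially. \<bar>(y n - x n) / x n\<bar> < 1 / 2"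
      using tendstoD[OF y, of "1/2"] by (simp add: dist_real_def)
    ultimately show ?thesis
    proof eventually_elim
      case (elim n)
      then have "x n > 0" using X by simp
      then show ?case using elim by (simp add: abs_divide pos_divide_less_eq)
    qed
  qed
  have "(\<lambda>n. ln (f (y n)) - ln (f (x n))) \<longlonglongrightarrow> 0"
  proof (rule Lim_null_comparison)
    show "\<forall>\<^sub>F n in sequentially. norm (ln (f (y n)) - ln (f (x n))) \<le> 2 * C * \<bar>(y n - x n) / x n\<bar>"
      using ex
    proof eventually_elim
      case (elim n)
      then have "\<bar>ln (f (y n)) - ln (f (x n))\<bar> \<le> 2 * C * (\<bar>y n - x n\<bar> / x n)"
        using X C by (intro log_difference_bound[of X]) auto
      moreover have "x n > 0" using elim X by simp
      ultimately show ?case by (simp add: abs_divide)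
    qed
    show "(\<lambda>n. 2 * C * \<bar>(y n - x n) / x n\<bar>) \<longlonglongrightarrow> 0"
      using tendsto_mult_right_zero[OF tendsto_rabs_zero[OF y]] by simp
  qed
  then have "(\<lambda>n. exp (ln (f (y n)) - ln (f (x n)))) \<longlonglongrightarrow> exp 0" by (intro tendsto_intros)
  then have "(\<lambda>n. exp (ln (f (y n)) - ln (f (x n)))) \<longlonglongrightarrow> 1" by simp
  moreover have "\<forall>\<^sub>F n in sequentially. exp (ln (f (y n)) - ln (f (x n))) = f (y n) / f (x n)"
    using ex
  proof eventually_elim
    case (elim n)
    have "x n \<ge> X" "y n \<ge> X" using elim X(1) by linarith+
    then show ?case using X(2) by (simp add: exp_diff)
  qed
  ultimately show ?thesis by (rule Lim_transform_eventually)
qed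

lemma karamata_derivative:
  assumes e: "continuous_on {1..} \<epsilon>" and x: "x > 1"
  shows "(karamata c \<epsilon> has_real_derivative karamata c \<epsilon> x * (\<epsilon> x / x)) (at x)"
proof -
  have "continuous_on {1..x + 1} (\<lambda>u. \<epsilon> u / u)"
    by (intro continuous_intros continuous_on_subset[OF e]) auto
  then have "((\<lambda>x. integral {1..x} (\<lambda>u. \<epsilon> u / u)) has_real_derivative \<epsilon> x / x) (at x within {1..x + 1})"
    using x by (intro integral_has_real_derivative) auto
  moreover have "at x within {1..x + 1} = at x" using x by (intro at_within_interior) auto
  ultimately have "((\<lambda>x. integral {1..x} (\<lambda>u. \<epsilon> u / u)) has_real_derivative \<epsilon> x / x) (at x)" by simp
  then show ?thesis unfolding karamata_def[abs_def] by (auto intro!: derivative_eq_intros)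
qed

text \<open>
  Applied to \<open>k = h'\<close>, this says that \<open>1 / sqrt (k x)\<close>, the width of the tilted law whose mode is near \<open>x\<close>, is a
  self-neglecting function: \<open>k\<close> is asymptotically constant over any bounded number of widths. The sequential
  form of the locally uniform limit fits the intermediate points that Taylor's theorem supplies.
\<close>
definition slowly_changing_curvature :: "(real \<Rightarrow> real) \<Rightarrow> bool" where
  "slowly_changing_curvature k \<longleftrightarrow>
     filterlim (\<lambda>x. x * k x) at_top at_top \<and>
     (\<forall>x y K. filterlim x at_top sequentially \<longrightarrow>
        (\<forall>\<^sub>F n in sequentially. \<bar>y n - x n\<bar> \<le> K / sqrt (k (x n))) \<longrightarrow>
        (\<lambda>n::nat. k (y n) / k (x n)) \<longlonglongrightarrow> 1)"

text \<open>
  The window has relative size \<open>K / sqrt (x * (x * k x))\<close>, and both factors under the root tend to infinity.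
\<close>
lemma relative_window:
  fixes x y :: "nat \<Rightarrow> real"
  assumes k: "filterlim (\<lambda>x. x * k x) at_top at_top" and x: "filterlim x at_top sequentially"
    and y: "\<forall>\<^sub>F n in sequentially. \<bar>y n - x n\<bar> \<le> K / sqrt (k (x n))"
  shows "(\<lambda>n. (y n - x n) / x n) \<longlonglongrightarrow> 0"
proof (rule Lim_null_comparison)
  have xk: "filterlim (\<lambda>n. x n * k (x n)) at_top sequentially" by (rule filterlim_compose[OF k x])
  have "filterlim (\<lambda>n. sqrt (x n * (x n * k (x n)))) at_top sequentially"
    by (intro filterlim_compose[OF sqrt_at_top] filterlim_at_top_mult_at_top x xk)
  then show "(\<lambda>n. K / sqrt (x n * (x n * k (x n)))) \<longlonglongrightarrow> 0"
    by (intro tendsto_divide_0[OF tendsto_const] filterlim_at_top_imp_at_infinity)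
  have "\<forall>\<^sub>F n in sequentially. x n > 0" "\<forall>\<^sub>F n in sequentially. x n * k (x n) > 0"
    using x xk by (simp_all add: filterlim_at_top_dense)
  with y show "\<forall>\<^sub>F n in sequentially. norm ((y n - x n) / x n) \<le> K / sqrt (x n * (x n * k (x n)))"
  proof eventually_elim
    case (elim n)
    have "sqrt (x n * (x n * k (x n))) = x n * sqrt (k (x n))"
      using elim by (simp add: real_sqrt_mult mult.assoc[symmetric])
    then show ?case using elim by (simp add: abs_divide divide_right_mono field_simps)
  qed
qed

lemma eventually_abs_less:
  fixes e :: "real \<Rightarrow> real"
  assumes "(e \<longlongrightarrow> 0) at_top" "b > 0"
  shows "\<forall>\<^sub>F x in at_top. \<bar>e x\<bar> < b"
  using tendstoD[OF assms] by (simp add: dist_real_def)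

text \<open>
  Here \<open>x * k x = h x * (\<beta> + \<epsilon> x)\<close>. Hence \<open>h\<close> has bounded elasticity, its ratio over a window of relative size
  \<open>o(1)\<close> tends to \<open>1\<close>, and the ratio of \<open>k\<close> follows.
\<close>
lemma regular_case_curvature:
  assumes hd: "\<And>x. x > 0 \<Longrightarrow> (h has_real_derivative k x) (at x)"
    and h_top: "filterlim h at_top at_top" and reg: "regular_case h h2 q"
  shows "slowly_changing_curvature k"
proof -
  from reg obtain \<beta> c \<epsilon> E where b: "\<beta> > 0" and c: "c > 0"
    and h: "\<forall>\<^sub>F x in at_top. h x = x powr \<beta> * karamata c \<epsilon> x"
    and E: "derivs_on 2 {1..} \<epsilon> E" and e0: "(\<epsilon> \<longlongrightarrow> 0) at_top"
    unfolding regular_case_def by blast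
  have ce: "continuous_on {1..} \<epsilon>"
    using derivs_onD(2)[OF E, of 0] derivs_onD(1)[OF E] by (auto intro!: DERIV_continuous_on)
  obtain X where X: "X > 1" "\<And>x. x \<ge> X \<Longrightarrow> h x = x powr \<beta> * karamata c \<epsilon> x"
    using eventually_at_top_beyond[OF h, of 1] by blast
  have kx: "k x = h x * (\<beta> + \<epsilon> x) / x" if x: "x > X" for x
  proof -
    have "((\<lambda>x. x powr \<beta> * karamata c \<epsilon> x) has_real_derivative x powr \<beta> * karamata c \<epsilon> x * (\<beta> + \<epsilon> x) / x) (at x)"
      using x X(1) by (auto intro!: derivative_eq_intros karamata_derivative[OF ce] simp: powr_diff field_simps)
    then have "(h has_real_derivative x powr \<beta> * karamata c \<epsilon> x * (\<beta> + \<epsilon> x) / x) (at x)"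
      using x X by (elim has_field_derivative_transform_within_open[where S="{X<..}"]) auto
    then show ?thesis using DERIV_unique[OF hd[of x]] x X by simp
  qed
  have ev1: "\<forall>\<^sub>F x in at_top. x > X" by (rule eventually_gt_at_top)
  have ev2: "\<forall>\<^sub>F x in at_top. \<bar>\<epsilon> x\<bar> < \<beta> / 2" using b by (intro eventually_abs_less[OF e0]) auto
  have ev3: "\<forall>\<^sub>F x in at_top. h x > 0" using h_top by (simp add: filterlim_at_top_dense)
  have lim: "((\<lambda>x. \<beta> + \<epsilon> x) \<longlongrightarrow> \<beta>) at_top" using tendsto_add[OF tendsto_const e0] by simp
  have top: "filterlim (\<lambda>x. x * k x) at_top at_top"
  proof (rule filterlim_cong[THEN iffD1, OF refl refl _ filterlim_tendsto_pos_mult_at_top[OF lim b h_top]])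
    show "\<forall>\<^sub>F x in at_top. (\<beta> + \<epsilon> x) * h x = x * k x"
      using ev1 by eventually_elim (use kx X in auto)
  qed
  have rate: "\<forall>\<^sub>F z in at_top. h z > 0 \<and> (h has_real_derivative k z) (at z) \<and> \<bar>z * k z\<bar> \<le> (2 * \<beta>) * h z"
    using ev1 ev2 ev3
  proof eventually_elim
    case (elim z)
    have "\<bar>\<beta> + \<epsilon> z\<bar> \<le> 2 * \<beta>" using elim b by simp
    then have "h z * \<bar>\<beta> + \<epsilon> z\<bar> \<le> h z * (2 * \<beta>)" using elim by (intro mult_left_mono) auto
    moreover have zk: "z * k z = h z * (\<beta> + \<epsilon> z)" using kx[of z] elim(1) X(1) by simp
    ultimately have "\<bar>z * k z\<bar> \<le> (2 * \<beta>) * h z"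
      unfolding zk abs_mult abs_of_pos[OF elim(3)] by (simp only: mult.commute)
    then show ?case using elim hd[of z] X(1) by simp
  qed
  show ?thesis unfolding slowly_changing_curvature_def
  proof (intro conjI allI impI top)
    fix x y :: "nat \<Rightarrow> real" and K
    assume x: "filterlim x at_top sequentially"
      and y: "\<forall>\<^sub>F n in sequentially. \<bar>y n - x n\<bar> \<le> K / sqrt (k (x n))"
    have w: "(\<lambda>n. (y n - x n) / x n) \<longlonglongrightarrow> 0" by (rule relative_window[OF top x y])
    have x0: "\<forall>\<^sub>F n in sequentially. x n > X" using x by (simp add: filterlim_at_top_dense)
    have "(\<lambda>n. 1 + (y n - x n) / x n) \<longlonglongrightarrow> 1" using tendsto_add[OF tendsto_const w, of 1] by simp
    then have yx: "(\<lambda>n. y n / x n) \<longlonglongrightarrow> 1"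
      by (rule Lim_transform_eventually) (use x0 X in \<open>auto elim!: eventually_mono simp: field_simps\<close>)
    have y_top: "filterlim y at_top sequentially"
    proof (rule filterlim_cong[THEN iffD1, OF refl refl _ filterlim_tendsto_pos_mult_at_top[OF yx _ x]])
      show "\<forall>\<^sub>F n in sequentially. y n / x n * x n = y n" using x0 by eventually_elim (use X in auto)
    qed simp
    then have y0: "\<forall>\<^sub>F n in sequentially. y n > X" by (simp add: filterlim_at_top_dense)
    have "(\<lambda>n. (h (y n) / h (x n)) * ((\<beta> + \<epsilon> (y n)) / (\<beta> + \<epsilon> (x n))) / (y n / x n)) \<longlonglongrightarrow> 1 * (\<beta> / \<beta>) / 1"
      using b by (intro tendsto_mult tendsto_divide ratio_tendsto_one[OF rate x w] yx
        filterlim_compose[OF lim x] filterlim_compose[OF lim y_top]) auto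
    then have "(\<lambda>n. (h (y n) / h (x n)) * ((\<beta> + \<epsilon> (y n)) / (\<beta> + \<epsilon> (x n))) / (y n / x n)) \<longlonglongrightarrow> 1" using b by simp
    then show "(\<lambda>n. k (y n) / k (x n)) \<longlonglongrightarrow> 1"
    proof (rule Lim_transform_eventually)
      show "\<forall>\<^sub>F n in sequentially. (h (y n) / h (x n)) * ((\<beta> + \<epsilon> (y n)) / (\<beta> + \<epsilon> (x n))) / (y n / x n) = k (y n) / k (x n)"
        using x0 y0 by eventually_elim (use kx in auto)
    qed
  qed
qed

text \<open>
  Far out \<open>f (2 * x) \<le> r * f x\<close> for some \<open>r < 1\<close>. Boundedness provides a common starting value \<open>B\<close> for the
  geometric decay along all the sequences \<open>x, 2 * x, 4 * x, \<dots>\<close>, whence a uniform rate.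
\<close>
lemma regularly_varying_bounded_tendsto_zero:
  assumes f: "regularly_varying \<eta> f" and eta: "\<eta> < 0" and bd: "\<forall>\<^sub>F x in at_top. f x \<le> B"
  shows "(f \<longlongrightarrow> 0) at_top"
proof -
  \<comment> \<open>Any \<open>r\<close> strictly between \<open>2 powr \<eta>\<close> and \<open>1\<close> would do.\<close>
  define r where "r = (2 powr \<eta> + 1) / 2"
  have p: "2 powr \<eta> < 1" using eta powr_less_mono[of \<eta> 0 2] by simp
  have r: "2 powr \<eta> < r" "r < 1" "0 < r" using p unfolding r_def by (auto simp: add_pos_pos)
  have pos: "\<forall>\<^sub>F x in at_top. f x > 0" using f by (simp add: regularly_varying_def)
  have "((\<lambda>x. f (2 * x) / f x) \<longlongrightarrow> 2 powr \<eta>) at_top" using f by (simp add: regularly_varying_def)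
  then have "\<forall>\<^sub>F x in at_top. f (2 * x) / f x < r" using r by (intro order_tendstoD) auto
  then have ev: "\<forall>\<^sub>F x in at_top. f x > 0 \<and> f (2 * x) / f x < r \<and> f x \<le> B" using pos bd by eventually_elim auto
  then obtain X where X: "X > 0" "\<And>x. x \<ge> X \<Longrightarrow> f x > 0 \<and> f (2 * x) / f x < r \<and> f x \<le> B"
    using eventually_at_top_beyond[OF ev, of 0] by blast
  have iter: "f x \<le> r ^ j * B" if "x \<ge> 2 ^ j * X" for j x
    using that
  proof (induction j arbitrary: x)
    case 0 then show ?case using X by simp
  next
    case (Suc j)
    have x2: "x / 2 \<ge> 2 ^ j * X" using Suc.prems by simp
    have "X \<le> 2 ^ j * X" using X(1) by simp
    then have "X \<le> x / 2" using x2 by linarith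
    from X(2)[OF this] have "f x / f (x / 2) < r" "f (x / 2) > 0" by simp_all
    then have "f x \<le> r * f (x / 2)" by (simp add: pos_divide_less_eq)
    also have "\<dots> \<le> r * (r ^ j * B)" using Suc.IH[OF x2] r by (intro mult_left_mono) auto
    finally show ?case by simp
  qed
  show ?thesis
  proof (rule tendstoI)
    fix e :: real assume e: "e > 0"
    have "(\<lambda>j. r ^ j * B) \<longlonglongrightarrow> 0" using r by (intro tendsto_mult_left_zero LIMSEQ_power_zero) auto
    then have "\<forall>\<^sub>F j in sequentially. r ^ j * B < e" using e by (intro order_tendstoD) auto
    then obtain j where j: "r ^ j * B < e" by (meson eventually_sequentially order_refl)
    show "\<forall>\<^sub>F x in at_top. dist (f x) 0 < e"
      using eventually_ge_at_top[of "2 ^ j * X"] pos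
      by eventually_elim (use iter[of j] j in \<open>force simp: dist_real_def\<close>)
  qed
qed

section \<open>Slowly changing curvature: the rapidly varying case\<close>

text \<open>
  In the variable \<open>u = h x\<close> the curvature is \<open>k x = 1 / d u\<close>, where \<open>d = \<psi>' = \<psi> * \<epsilon> / u\<close> has bounded
  elasticity \<open>\<epsilon> + u * \<epsilon>' / \<epsilon> - 1\<close>. It remains to see that a window of width \<open>K / sqrt (k x) = K * sqrt (d u)\<close> in
  \<open>x\<close> has relative size \<open>o(1)\<close> in \<open>u\<close>: a relative step \<open>r\<close> in \<open>u\<close> moves \<open>\<psi>\<close> by about \<open>r * u * d u\<close>, and this
  exceeds \<open>K * sqrt (d u)\<close> because \<open>u * sqrt (d u) = sqrt (u * \<psi> u * \<epsilon> u)\<close> tends to infinity.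
\<close>
lemma rapid_case_curvature:
  assumes hd: "\<And>x. x > 0 \<Longrightarrow> (h has_real_derivative k x) (at x)"
    and h_mono: "\<And>x y. 0 < x \<Longrightarrow> x \<le> y \<Longrightarrow> h x \<le> h y"
    and h_top: "filterlim h at_top at_top" and rap: "rapid_case h q"
  shows "slowly_changing_curvature k"
proof -
  from rap obtain \<psi> c \<epsilon> E where inv: "inverse_at_top h \<psi>" and c: "c > 0"
    and kar: "\<forall>\<^sub>F u in at_top. \<psi> u = karamata c \<epsilon> u"
    and E: "derivs_on 2 {1..} \<epsilon> E" and e0: "(\<epsilon> \<longlongrightarrow> 0) at_top"
    and ene: "\<forall>\<^sub>F u in at_top. \<epsilon> u \<noteq> 0"
    and e1: "((\<lambda>u. u * E 1 u / \<epsilon> u) \<longlongrightarrow> 0) at_top"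
    unfolding rapid_case_def by blast
  have ed: "(\<epsilon> has_real_derivative E 1 x) (at x)" if "x > 1" for x
  proof -
    have "(\<epsilon> has_real_derivative E 1 x) (at x within {1..})"
      using derivs_onD(2)[OF E, of 0 x] derivs_onD(1)[OF E] that by simp
    moreover have "at x within {1..} = at x" using that by (intro at_within_interior) auto
    ultimately show ?thesis by simp
  qed
  have ce: "continuous_on {1..} \<epsilon>"
    using derivs_onD(2)[OF E, of 0] derivs_onD(1)[OF E] by (auto intro!: DERIV_continuous_on)
  have inv1: "\<forall>\<^sub>F x in at_top. \<psi> (h x) = x" and inv2: "\<forall>\<^sub>F u in at_top. \<psi> u \<ge> 0 \<and> h (\<psi> u) = u"
    using inv by (auto simp: inverse_at_top_def)
  have ev: "\<forall>\<^sub>F u in at_top. \<psi> u = karamata c \<epsilon> u \<and> \<epsilon> u \<noteq> 0 \<and> h (\<psi> u) = u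
      \<and> \<bar>\<epsilon> u\<bar> < 1 \<and> \<bar>u * E 1 u / \<epsilon> u\<bar> < 1 / 2"
    using kar ene inv2 eventually_abs_less[OF e0, of 1] eventually_abs_less[OF e1, of "1/2"] by (simp add: eventually_conj_iff)
  obtain U where U: "U > 1" and UU: "\<And>u. u \<ge> U \<Longrightarrow> \<psi> u = karamata c \<epsilon> u \<and> \<epsilon> u \<noteq> 0 \<and> h (\<psi> u) = u
      \<and> \<bar>\<epsilon> u\<bar> < 1 \<and> \<bar>u * E 1 u / \<epsilon> u\<bar> < 1 / 2"
    using eventually_at_top_beyond[OF ev, of 1] by blast
  have U1: "\<psi> u = karamata c \<epsilon> u" and U3: "h (\<psi> u) = u"
    and U4: "\<bar>\<epsilon> u\<bar> < 1" and U5: "\<bar>u * E 1 u / \<epsilon> u\<bar> < 1 / 2" if "u \<ge> U" for u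
    using UU[OF that] by blast+
  define d where "d u = \<psi> u * \<epsilon> u / u" for u
  have psi_pos: "\<psi> u > 0" if "u \<ge> U" for u using U1[OF that] c by (simp add: karamata_def)
  have psi_d: "(\<psi> has_real_derivative d u) (at u)" if u: "u > U" for u
  proof -
    have "(karamata c \<epsilon> has_real_derivative karamata c \<epsilon> u * (\<epsilon> u / u)) (at u)"
      using u U by (intro karamata_derivative[OF ce]) auto
    then have "(\<psi> has_real_derivative karamata c \<epsilon> u * (\<epsilon> u / u)) (at u)"
      by (rule has_field_derivative_transform_within_open[where S="{U<..}"]) (use u U1 in auto)
    then show ?thesis using U1[of u] u by (simp add: d_def)
  qed
  have kd: "k (\<psi> u) * d u = 1" if u: "u > U" for u
  proof -
    have "((\<lambda>u. h (\<psi> u)) has_real_derivative k (\<psi> u) * d u) (at u)"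
      using u by (intro DERIV_chain2[OF hd psi_d] psi_pos) auto
    then have "((\<lambda>u. u) has_real_derivative k (\<psi> u) * d u) (at u)"
      by (rule has_field_derivative_transform_within_open[where S="{U<..}"]) (use u U3 in auto)
    then show ?thesis using DERIV_unique DERIV_ident by blast
  qed
  have k_nonneg: "k x \<ge> 0" if x: "x > 0" for x
  proof -
    have "mono_on {0<..} h" using h_mono by (auto intro!: mono_onI)
    then show ?thesis by (rule mono_on_imp_deriv_nonneg[OF _ hd[OF x]]) (use x in \<open>auto simp: interior_open\<close>)
  qed
  have d_pos: "d u > 0" if u: "u > U" for u
    using kd[OF u] k_nonneg[OF psi_pos[of u]] u by (smt (verit) mult_nonneg_nonpos)
  have psi_mono: "\<psi> u \<le> \<psi> v" if "U < u" "u \<le> v" for u v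
  proof (rule DERIV_nonneg_imp_nondecreasing[OF that(2)])
    fix w assume "u \<le> w" "w \<le> v"
    then show "\<exists>y. (\<psi> has_real_derivative y) (at w) \<and> 0 \<le> y"
      using that(1) by (intro exI[of _ "d w"] conjI psi_d less_imp_le[OF d_pos]) auto
  qed
  have e_pos: "\<epsilon> u > 0" if u: "u > U" for u
    using d_pos[OF u] psi_pos[of u] u U unfolding d_def by (simp add: zero_less_divide_iff zero_less_mult_iff)
  have rate_d: "d u > 0 \<and> (d has_real_derivative (d u * \<epsilon> u / u + \<psi> u * E 1 u / u - d u / u)) (at u)
      \<and> \<bar>u * (d u * \<epsilon> u / u + \<psi> u * E 1 u / u - d u / u)\<bar> \<le> 3 * d u" if u: "u > U" for u
  proof (intro conjI d_pos[OF u])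
    show "(d has_real_derivative (d u * \<epsilon> u / u + \<psi> u * E 1 u / u - d u / u)) (at u)"
      unfolding d_def[abs_def] using u U
      by (auto intro!: derivative_eq_intros psi_d[OF u] ed simp: d_def field_simps power2_eq_square)
    have eq: "u * (d u * \<epsilon> u / u + \<psi> u * E 1 u / u - d u / u) = d u * (\<epsilon> u + u * E 1 u / \<epsilon> u - 1)"
      using u U e_pos[OF u] by (simp add: d_def field_simps)
    have "\<bar>\<epsilon> u + u * E 1 u / \<epsilon> u - 1\<bar> \<le> 3" using U4[of u] U5[of u] u by linarith
    then show "\<bar>u * (d u * \<epsilon> u / u + \<psi> u * E 1 u / u - d u / u)\<bar> \<le> 3 * d u"
      unfolding eq abs_mult abs_of_pos[OF d_pos[OF u]] using d_pos[OF u] by (simp add: mult.commute)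
  qed
  have psi_top: "filterlim \<psi> at_top at_top"
    unfolding filterlim_at_top_dense
  proof
    fix Z :: real
    have "\<forall>\<^sub>F u in at_top. u > max (h (max 1 Z)) U" by (rule eventually_gt_at_top)
    then show "\<forall>\<^sub>F u in at_top. \<psi> u > Z"
    proof eventually_elim
      case (elim u)
      show ?case
      proof (rule ccontr)
        assume "\<not> \<psi> u > Z"
        then have "h (\<psi> u) \<le> h (max 1 Z)" using psi_pos[of u] elim by (intro h_mono) auto
        then show False using U3[of u] elim by simp
      qed
    qed
  qed
  \<comment> \<open>The logarithmic derivative of \<open>u * \<epsilon> u\<close> is \<open>(1 + o(1)) / u\<close>, so \<open>u * \<epsilon> u\<close> outgrows \<open>sqrt u\<close>.\<close>
  have growth: "u * \<epsilon> u / sqrt u \<ge> (U + 1) * \<epsilon> (U + 1) / sqrt (U + 1)" if u: "u \<ge> U + 1" for u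
  proof (rule DERIV_nonneg_imp_nondecreasing[OF u, of "\<lambda>u. u * \<epsilon> u / sqrt u"])
    fix v assume v: "U + 1 \<le> v" "v \<le> u"
    have v0: "v > 0" "v > 1" "v > U" using v U by auto
    \<comment> \<open>\<open>u * \<epsilon> u / sqrt u\<close> is \<open>sqrt u * \<epsilon> u\<close>, and \<open>\<bar>v * \<epsilon>' v\<bar> \<le> \<epsilon> v / 2\<close> makes its derivative nonnegative.\<close>
    have "((\<lambda>u. sqrt u * \<epsilon> u) has_real_derivative (inverse (sqrt v) / 2 * \<epsilon> v + E 1 v * sqrt v)) (at v)"
      using DERIV_mult[OF DERIV_real_sqrt[OF v0(1)] ed[OF v0(2)]] by simp
    then have "((\<lambda>u. u * \<epsilon> u / sqrt u) has_real_derivative (inverse (sqrt v) / 2 * \<epsilon> v + E 1 v * sqrt v)) (at v)"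
      by (rule has_field_derivative_transform_within_open[where S="{0<..}"]) (use v0 in \<open>auto simp: field_simps\<close>)
    moreover have "0 \<le> inverse (sqrt v) / 2 * \<epsilon> v + E 1 v * sqrt v"
    proof -
      have "\<bar>v * E 1 v\<bar> \<le> \<epsilon> v / 2" using U5[of v] e_pos[OF v0(3)] v0 by (simp add: pos_divide_less_eq)
      then have "0 \<le> inverse (sqrt v) * (\<epsilon> v / 2 + v * E 1 v)" using v0 by (intro mult_nonneg_nonneg) auto
      also have "\<dots> = inverse (sqrt v) / 2 * \<epsilon> v + E 1 v * sqrt v" using v0 by (simp add: field_simps)
      finally show ?thesis .
    qed
    ultimately show "\<exists>y. ((\<lambda>u. u * \<epsilon> u / sqrt u) has_real_derivative y) (at v) \<and> 0 \<le> y" by blast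
  qed
  define b where "b = (U + 1) * \<epsilon> (U + 1) / sqrt (U + 1)"
  have b: "b > 0" using e_pos[of "U + 1"] U by (simp add: b_def)
  have d_top: "filterlim (\<lambda>u. u * sqrt (d u)) at_top at_top"
  proof -
    have "filterlim (\<lambda>u. b * (sqrt u * \<psi> u)) at_top at_top"
      by (intro filterlim_tendsto_pos_mult_at_top[OF tendsto_const b] filterlim_at_top_mult_at_top sqrt_at_top psi_top)
    then have "filterlim (\<lambda>u. sqrt (b * (sqrt u * \<psi> u))) at_top at_top" by (rule filterlim_compose[OF sqrt_at_top])
    moreover have "\<forall>\<^sub>F u in at_top. sqrt (b * (sqrt u * \<psi> u)) \<le> u * sqrt (d u)"
      using eventually_ge_at_top[of "U + 1"]
    proof eventually_elim
      case (elim u)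
      have u0: "u > 0" "u > U" using elim U by auto
      have "b * sqrt u \<le> u * \<epsilon> u" using growth[OF elim] u0 by (simp add: b_def pos_le_divide_eq)
      then have "b * sqrt u * \<psi> u \<le> u * \<epsilon> u * \<psi> u" using psi_pos[of u] u0 by (intro mult_right_mono) auto
      also have "\<dots> = u\<^sup>2 * d u" using u0 by (simp add: d_def power2_eq_square)
      finally have "sqrt (b * (sqrt u * \<psi> u)) \<le> sqrt (u\<^sup>2 * d u)" by (simp add: mult.assoc)
      then show ?case using u0 by (simp add: real_sqrt_mult)
    qed
    ultimately show ?thesis by (rule filterlim_at_top_mono)
  qed
  have k_eq: "k x = 1 / d (h x)" "\<psi> (h x) = x" if "\<psi> (h x) = x" "h x > U" for x
    using kd[OF that(2)] d_pos[OF that(2)] that by (auto simp: field_simps)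
  have hU: "\<forall>\<^sub>F x in at_top. h x > U" using h_top by (simp add: filterlim_at_top_dense)
  have top: "filterlim (\<lambda>x. x * k x) at_top at_top"
  proof -
    have "\<forall>\<^sub>F u in at_top. 0 < \<epsilon> u \<and> \<epsilon> u \<noteq> 0"
      using eventually_gt_at_top[of U] by eventually_elim (use e_pos in force)
    then have "filterlim \<epsilon> (at_right 0) at_top" using e0 by (simp add: filterlim_at)
    then have "filterlim (\<lambda>u. inverse (\<epsilon> u)) at_top at_top" by (rule filterlim_compose[OF filterlim_inverse_at_top_right])
    then have "filterlim (\<lambda>u. u * inverse (\<epsilon> u)) at_top at_top"
      by (intro filterlim_at_top_mult_at_top filterlim_ident)
    then have "filterlim (\<lambda>x. h x * inverse (\<epsilon> (h x))) at_top at_top" by (rule filterlim_compose[OF _ h_top])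
    then show ?thesis
    proof (rule filterlim_cong[THEN iffD1, OF refl refl, rotated])
      show "\<forall>\<^sub>F x in at_top. h x * inverse (\<epsilon> (h x)) = x * k x"
        using inv1 hU
      proof eventually_elim
        case (elim x)
        have "x > 0" using psi_pos[of "h x"] elim by simp
        then show ?case using k_eq(1)[OF elim] elim e_pos[OF elim(2)] by (simp add: d_def field_simps)
      qed
    qed
  qed
  have evd: "\<forall>\<^sub>F z in at_top. d z > 0 \<and> (d has_real_derivative (d z * \<epsilon> z / z + \<psi> z * E 1 z / z - d z / z)) (at z)
      \<and> \<bar>z * (d z * \<epsilon> z / z + \<psi> z * E 1 z / z - d z / z)\<bar> \<le> 3 * d z"
    using eventually_gt_at_top[of U] by eventually_elim (rule rate_d)
  \<comment> \<open>Over \<open>[u/2, 3u/2]\<close> the function \<open>ln d\<close> varies by at most \<open>2 * 3 * (1/2) = 3\<close>, so \<open>\<psi>\<close> moves at least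
    at the speed \<open>exp (- 3) * d u\<close> there.\<close>
  have step: "\<bar>\<psi> v - \<psi> u\<bar> \<ge> \<bar>v - u\<bar> * (exp (- 3) * d u)" if uv: "u / 2 > U" "\<bar>v - u\<bar> \<le> u / 2" for u v
  proof -
    have lower: "d w \<ge> exp (- 3) * d u" if w: "\<bar>w - u\<bar> \<le> u / 2" for w
    proof -
      have u0: "u > U" using uv U by simp
      have wU: "w > U" using uv w by linarith
      have "\<bar>ln (d w) - ln (d u)\<bar> \<le> 2 * 3 * (\<bar>w - u\<bar> / u)"
      proof (rule log_difference_bound[where f'="\<lambda>u. d u * \<epsilon> u / u + \<psi> u * E 1 u / u - d u / u" and X="u/2"])
        fix x assume "x \<ge> u / 2"
        then have "x > U" using uv by simp
        from rate_d[OF this] show "d x > 0" "(d has_real_derivative (d x * \<epsilon> x / x + \<psi> x * E 1 x / x - d x / x)) (at x)"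
          "\<bar>x * (d x * \<epsilon> x / x + \<psi> x * E 1 x / x - d x / x)\<bar> \<le> 3 * d x" by blast+
      qed (use uv U w in auto)
      also have "\<dots> \<le> 3" using w u0 U by (simp add: pos_divide_le_eq)
      finally have "ln (d u) - 3 \<le> ln (d w)" by linarith
      then have "exp (ln (d u) - 3) \<le> exp (ln (d w))" by simp
      then show ?thesis using d_pos[OF u0] d_pos[OF wU] by (simp add: exp_diff exp_minus field_simps)
    qed
    have "\<bar>\<psi> v - \<psi> u\<bar> \<ge> \<bar>v - u\<bar> * (exp (- 3) * d u)"
    proof (cases v u rule: linorder_cases)
      case less
      have "\<exists>w>v. w < u \<and> \<psi> u - \<psi> v = (u - v) * d w"
        by (rule MVT2[OF less], rule psi_d) (use uv in linarith)
      then obtain w where w: "v < w" "w < u" "\<psi> u - \<psi> v = (u - v) * d w" by blast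
      have "(u - v) * (exp (- 3) * d u) \<le> (u - v) * d w"
        using w uv less by (intro mult_left_mono lower) auto
      moreover have vu: "\<bar>v - u\<bar> = u - v" using less by simp
      ultimately show ?thesis unfolding vu w(3)[symmetric] by linarith
    next
      case greater
      have "\<exists>w>u. w < v \<and> \<psi> v - \<psi> u = (v - u) * d w"
        by (rule MVT2[OF greater], rule psi_d) (use uv in linarith)
      then obtain w where w: "u < w" "w < v" "\<psi> v - \<psi> u = (v - u) * d w" by blast
      have "(v - u) * (exp (- 3) * d u) \<le> (v - u) * d w"
        using w uv greater by (intro mult_left_mono lower) auto
      moreover have vu: "\<bar>v - u\<bar> = v - u" using greater by simp
      ultimately show ?thesis unfolding vu w(3)[symmetric] by linarith
    qed simp
    then show ?thesis .
  qed
  show ?thesis unfolding slowly_changing_curvature_def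
  proof (intro conjI allI impI top)
    fix x y :: "nat \<Rightarrow> real" and K
    assume x: "filterlim x at_top sequentially"
      and y: "\<forall>\<^sub>F n in sequentially. \<bar>y n - x n\<bar> \<le> K / sqrt (k (x n))"
    have w: "(\<lambda>n. (y n - x n) / x n) \<longlonglongrightarrow> 0" by (rule relative_window[OF top x y])
    have x0: "\<forall>\<^sub>F n in sequentially. x n > 0" using x by (simp add: filterlim_at_top_dense)
    have "(\<lambda>n. 1 + (y n - x n) / x n) \<longlonglongrightarrow> 1" using tendsto_add[OF tendsto_const w, of 1] by simp
    then have yx: "(\<lambda>n. y n / x n) \<longlonglongrightarrow> 1"
      by (rule Lim_transform_eventually) (use x0 in \<open>auto elim!: eventually_mono simp: field_simps\<close>)
    have y_top: "filterlim y at_top sequentially"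
    proof (rule filterlim_cong[THEN iffD1, OF refl refl _ filterlim_tendsto_pos_mult_at_top[OF yx _ x]])
      show "\<forall>\<^sub>F n in sequentially. y n / x n * x n = y n" using x0 by eventually_elim auto
    qed simp
    have hx: "filterlim (\<lambda>n. h (x n)) at_top sequentially" by (rule filterlim_compose[OF h_top x])
    have fx: "\<forall>\<^sub>F n in sequentially. \<psi> (h (x n)) = x n \<and> h (x n) > U \<and> h (x n) / 2 > U"
      using eventually_compose_filterlim[OF inv1 x] eventually_compose_filterlim[OF eventually_gt_at_top[of "max U (2 * U)"] hx]
      by eventually_elim auto
    have fy: "\<forall>\<^sub>F n in sequentially. \<psi> (h (y n)) = y n \<and> h (y n) > U"
      using eventually_compose_filterlim[OF inv1 y_top] eventually_compose_filterlim[OF hU y_top]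
      by eventually_elim auto
    have hyx: "(\<lambda>n. (h (y n) - h (x n)) / h (x n)) \<longlonglongrightarrow> 0"
    proof (rule tendstoI)
      fix e :: real assume e: "e > 0"
      \<comment> \<open>A relative step \<open>r < e\<close>, short enough to stay in the range of \<open>step\<close>.\<close>
      define r where "r = min (e / 2) (1 / 2)"
      have r: "r > 0" "r \<le> 1 / 2" "r < e" using e by (auto simp: r_def)
      have big: "\<forall>\<^sub>F n in sequentially. h (x n) * sqrt (d (h (x n))) > \<bar>K\<bar> / (r * exp (- 3))"
        using filterlim_compose[OF d_top hx] by (simp add: filterlim_at_top_dense)
      show "\<forall>\<^sub>F n in sequentially. dist ((h (y n) - h (x n)) / h (x n)) 0 < e"
        using fx fy big y x0 filterlim_at_top_dense[THEN iffD1, OF y_top, THEN spec, of 0]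
      proof eventually_elim
        case (elim n)
        define u where "u = h (x n)"
        have u: "u > U" "u / 2 > U" "\<psi> u = x n" "u > 0" using elim U by (auto simp: u_def)
        have du: "d u > 0" using d_pos u by simp
        have kx: "K / sqrt (k (x n)) = K * sqrt (d u)"
          using k_eq(1)[of "x n"] elim u by (simp add: u_def real_sqrt_divide)
        have "\<bar>K\<bar> < u * sqrt (d u) * (r * exp (- 3))"
          using elim r by (simp add: u_def pos_divide_less_eq)
        then have "\<bar>K\<bar> * sqrt (d u) < u * sqrt (d u) * (r * exp (- 3)) * sqrt (d u)"
          using du by (intro mult_strict_right_mono) auto
        also have "\<dots> = r * u * (exp (- 3) * (sqrt (d u) * sqrt (d u)))" by (simp only: mult_ac)
        also have "\<dots> = r * u * (exp (- 3) * d u)" using du by simp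
        finally have Kd: "\<bar>K\<bar> * sqrt (d u) < r * u * (exp (- 3) * d u)" .
        have "K * sqrt (d u) \<le> \<bar>K\<bar> * sqrt (d u)" using du by (intro mult_right_mono) auto
        then have yd: "\<bar>y n - x n\<bar> < r * u * (exp (- 3) * d u)" using elim kx Kd by linarith
        have ru: "r * u \<le> u / 2" "0 \<le> r * u" using r u by auto
        have up: "y n < \<psi> (u + r * u)"
        proof -
          have "\<psi> (u + r * u) - \<psi> u \<ge> 0"
            using psi_mono[of u "u + r * u"] ru u by simp
          moreover have "\<bar>\<psi> (u + r * u) - \<psi> u\<bar> \<ge> r * u * (exp (- 3) * d u)"
            using step[of u "u + r * u"] u ru by simp
          ultimately show ?thesis using yd u by linarith
        qed
        have lo: "y n > \<psi> (u - r * u)"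
        proof -
          have "U < u - r * u" using ru u by linarith
          then have "\<psi> u - \<psi> (u - r * u) \<ge> 0"
            using psi_mono[of "u - r * u" u] ru by simp
          moreover have "\<bar>\<psi> (u - r * u) - \<psi> u\<bar> \<ge> r * u * (exp (- 3) * d u)"
            using step[of u "u - r * u"] u ru by simp
          ultimately show ?thesis using yd u by linarith
        qed
        have U': "u + r * u \<ge> U" "u - r * u \<ge> U" using u ru by linarith+
        have "h (y n) \<le> h (\<psi> (u + r * u))" using up elim by (intro h_mono) auto
        moreover have "h (\<psi> (u - r * u)) \<le> h (y n)" using lo psi_pos[OF U'(2)] by (intro h_mono) auto
        ultimately have "\<bar>h (y n) - u\<bar> \<le> r * u" using U3 U' by (simp add: abs_le_iff)
        also have "\<dots> < e * u" using r u by (intro mult_strict_right_mono) auto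
        finally have "\<bar>h (y n) - u\<bar> / u < e" using u by (simp add: pos_divide_less_eq)
        then show ?case using u by (simp add: dist_real_def u_def abs_divide)
      qed
    qed
    have "(\<lambda>n. inverse (d (h (y n)) / d (h (x n)))) \<longlonglongrightarrow> 1"
      by (rule tendsto_eq_rhs[where x="inverse 1"]) (intro tendsto_inverse ratio_tendsto_one[OF evd hx hyx], simp_all)
    then show "(\<lambda>n. k (y n) / k (x n)) \<longlonglongrightarrow> 1"
    proof (rule Lim_transform_eventually)
      show "\<forall>\<^sub>F n in sequentially. inverse (d (h (y n)) / d (h (x n))) = k (y n) / k (x n)"
        using fx fy by eventually_elim (auto simp: k_eq)
    qed
  qed
qed

section \<open>Exponential tilting\<close>

lemma exp_second_order: "\<bar>exp (y::real) - 1 - y\<bar> \<le> y\<^sup>2 * exp \<bar>y\<bar>"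
proof -
  have "\<exists>\<xi>. \<bar>\<xi>\<bar> \<le> \<bar>y\<bar> \<and> exp y = (\<Sum>m<2. y ^ m / fact m) + exp \<xi> / fact 2 * y ^ 2"
    by (rule Maclaurin_exp_le)
  then obtain \<xi> where x: "\<bar>\<xi>\<bar> \<le> \<bar>y\<bar>" "exp y = 1 + y + exp \<xi> / 2 * y\<^sup>2" by (auto simp: numeral_2_eq_2)
  have "\<bar>exp y - 1 - y\<bar> = exp \<xi> / 2 * y\<^sup>2" using x(2) by simp
  also have "\<dots> \<le> exp \<bar>y\<bar> * y\<^sup>2" 
  proof (rule mult_right_mono)
    have "exp \<xi> \<le> exp \<bar>y\<bar>" using x(1) by simp
    then show "exp \<xi> / 2 \<le> exp \<bar>y\<bar>" using exp_gt_zero[of \<xi>] by linarith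
  qed simp
  finally show ?thesis by (simp add: mult.commute)
qed

text \<open>
  As \<open>t\<close> is arbitrary, the bound by \<open>exp (- \<bar>x\<bar>)\<close> expresses that every tilt of \<open>p\<close> still has exponential
  tails.
\<close>
locale light_tailed_density =
  fixes p :: "real \<Rightarrow> real"
  assumes p_measurable [measurable]: "p \<in> borel_measurable borel"
    and p_nonneg: "\<And>x. 0 \<le> p x"
    and p_light: "\<And>t. \<exists>C. \<forall>x. exp (t * x) * p x \<le> C * exp (- \<bar>x\<bar>)"
    and p_integral: "(LBINT x. p x) = 1"
begin

definition expmom :: "nat \<Rightarrow> real \<Rightarrow> real" where
  "expmom j t = (LBINT x. x ^ j * exp (t * x) * p x)"

lemma expmom_abs_integrable: "integrable lborel (\<lambda>x. \<bar>x\<bar> ^ j * exp (t * x) * p x)"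
proof -
  obtain C where C: "\<And>x. exp (t * x) * p x \<le> C * exp (- \<bar>x\<bar>)" using p_light by blast
  have "integrable lborel (\<lambda>x. C * (\<bar>x\<bar> ^ j * exp (- 1 * \<bar>x\<bar>)))"
    by (intro integrable_mult_right integrable_power_exp_abs) simp
  then show ?thesis
  proof (rule Bochner_Integration.integrable_bound)
    show "AE x in lborel. norm (\<bar>x\<bar> ^ j * exp (t * x) * p x) \<le> norm (C * (\<bar>x\<bar> ^ j * exp (- 1 * \<bar>x\<bar>)))"
    proof (rule AE_I2)
      fix x
      have "\<bar>x\<bar> ^ j * (exp (t * x) * p x) \<le> \<bar>x\<bar> ^ j * (C * exp (- \<bar>x\<bar>))" by (intro mult_left_mono C) auto
      moreover have "0 \<le> \<bar>x\<bar> ^ j * (exp (t * x) * p x)" using p_nonneg by simp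
      ultimately show "norm (\<bar>x\<bar> ^ j * exp (t * x) * p x) \<le> norm (C * (\<bar>x\<bar> ^ j * exp (- 1 * \<bar>x\<bar>)))"
        unfolding real_norm_def by (simp add: mult_ac)
    qed
  qed simp
qed

lemma expmom_integrable: "integrable lborel (\<lambda>x. x ^ j * exp (t * x) * p x)"
  by (rule Bochner_Integration.integrable_bound[OF expmom_abs_integrable[of j t]])
     (auto simp: abs_mult power_abs)

text \<open>
  Differentiation under the integral sign: the second-order remainder of \<open>exp (e * x)\<close> is at most
  \<open>(e * x)\<^sup>2 * (exp x + exp (- x))\<close>, which the tilts \<open>t + 1\<close> and \<open>t - 1\<close> integrate.
\<close>
lemma expmom_derivative: "(expmom j has_real_derivative expmom (Suc j) t) (at t)"
proof -
  define H where "H = (LBINT x. \<bar>x\<bar> ^ (j + 2) * exp ((t + 1) * x) * p x) + (LBINT x. \<bar>x\<bar> ^ (j + 2) * exp ((t - 1) * x) * p x)"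
  have bound: "\<bar>expmom j (t + e) - expmom j t - e * expmom (Suc j) t\<bar> \<le> H * e\<^sup>2" if e: "\<bar>e\<bar> \<le> 1" for e
  proof -
    let ?d = "\<lambda>x. x ^ j * exp ((t + e) * x) * p x - x ^ j * exp (t * x) * p x - e * (x ^ Suc j * exp (t * x) * p x)"
    let ?b = "\<lambda>x. (\<bar>x\<bar> ^ (j + 2) * exp ((t + 1) * x) * p x + \<bar>x\<bar> ^ (j + 2) * exp ((t - 1) * x) * p x) * e\<^sup>2"
    have id: "integrable lborel ?d" by (intro Bochner_Integration.integrable_diff integrable_mult_right expmom_integrable)
    have ib: "integrable lborel ?b" by (intro Bochner_Integration.integrable_add integrable_mult_left expmom_abs_integrable)
    have "(LBINT x. ?d x) = (LBINT x. x ^ j * exp ((t + e) * x) * p x - x ^ j * exp (t * x) * p x)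
        - (LBINT x. e * (x ^ Suc j * exp (t * x) * p x))"
      by (rule Bochner_Integration.integral_diff[OF Bochner_Integration.integrable_diff[OF expmom_integrable expmom_integrable] integrable_mult_right[OF expmom_integrable]])
    also have "(LBINT x. x ^ j * exp ((t + e) * x) * p x - x ^ j * exp (t * x) * p x) = expmom j (t + e) - expmom j t"
      unfolding expmom_def by (rule Bochner_Integration.integral_diff[OF expmom_integrable expmom_integrable])
    also have "(LBINT x. e * (x ^ Suc j * exp (t * x) * p x)) = e * expmom (Suc j) t"
      unfolding expmom_def by (rule integral_mult_right_zero)
    finally have eq: "expmom j (t + e) - expmom j t - e * expmom (Suc j) t = (LBINT x. ?d x)" by (rule sym)
    have "\<bar>expmom j (t + e) - expmom j t - e * expmom (Suc j) t\<bar> \<le> (LBINT x. \<bar>?d x\<bar>)"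
      unfolding eq by (rule integral_abs_bound)
    also have "\<dots> \<le> (LBINT x. ?b x)"
    proof (rule integral_mono[OF integrable_abs[OF id] ib])
      fix x :: real
      have "?d x = x ^ j * exp (t * x) * p x * (exp (e * x) - 1 - e * x)"
      proof -
        have "exp ((t + e) * x) = exp (t * x) * exp (e * x)" by (simp only: distrib_right exp_add)
        then show ?thesis by (simp only: power_Suc right_diff_distrib mult_1_right mult_ac)
      qed
      then have "\<bar>?d x\<bar> = \<bar>x\<bar> ^ j * exp (t * x) * p x * \<bar>exp (e * x) - 1 - e * x\<bar>"
        using p_nonneg[of x] by (simp add: abs_mult power_abs)
      also have "\<dots> \<le> \<bar>x\<bar> ^ j * exp (t * x) * p x * ((e * x)\<^sup>2 * (exp x + exp (- x)))"
      proof (rule mult_left_mono)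
        have "\<bar>e * x\<bar> \<le> \<bar>x\<bar>" using mult_right_mono[OF e, of "\<bar>x\<bar>"] by (simp add: abs_mult)
        then have "exp \<bar>e * x\<bar> \<le> exp \<bar>x\<bar>" by simp
        also have "\<dots> \<le> exp x + exp (- x)" by (cases "x \<ge> 0") auto
        finally have "(e * x)\<^sup>2 * exp \<bar>e * x\<bar> \<le> (e * x)\<^sup>2 * (exp x + exp (- x))" by (intro mult_left_mono) auto
        then show "\<bar>exp (e * x) - 1 - e * x\<bar> \<le> (e * x)\<^sup>2 * (exp x + exp (- x))"
          using exp_second_order[of "e * x"] by linarith
      qed (use p_nonneg in simp)
      also have "\<dots> = ?b x"
      proof -
        have pw: "\<bar>x\<bar> ^ (j + 2) = \<bar>x\<bar> ^ j * x\<^sup>2" by (simp only: power_add power2_abs)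
        have ex: "exp ((t + 1) * x) = exp (t * x) * exp x" "exp ((t - 1) * x) = exp (t * x) * exp (- x)"
          by (simp_all only: exp_add[symmetric] distrib_right mult_1 mult_minus1 diff_conv_add_uminus)
        show ?thesis unfolding pw ex power_mult_distrib by (simp only: distrib_left distrib_right mult_ac)
      qed
      finally show "\<bar>?d x\<bar> \<le> ?b x" .
    qed
    also have "\<dots> = H * e\<^sup>2" unfolding H_def
      unfolding integral_mult_left_zero Bochner_Integration.integral_add[OF expmom_abs_integrable expmom_abs_integrable] ..
    finally show ?thesis .
  qed
  have "(\<lambda>e. (expmom j (t + e) - expmom j t) / e - expmom (Suc j) t) \<midarrow>0\<rightarrow> 0"
  proof (rule Lim_null_comparison)
    show "\<forall>\<^sub>F e in at 0. norm ((expmom j (t + e) - expmom j t) / e - expmom (Suc j) t) \<le> \<bar>H\<bar> * \<bar>e\<bar>"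
      unfolding eventually_at
    proof (intro exI[of _ 1] conjI ballI impI)
      fix e :: real assume "e \<in> UNIV" "e \<noteq> 0 \<and> dist e 0 < 1"
      then have e: "e \<noteq> 0" "\<bar>e\<bar> \<le> 1" by (auto simp: dist_real_def)
      have "(expmom j (t + e) - expmom j t) / e - expmom (Suc j) t = (expmom j (t + e) - expmom j t - e * expmom (Suc j) t) / e"
        unfolding diff_divide_distrib[of "expmom j (t + e) - expmom j t"] using e by simp
      then have "norm ((expmom j (t + e) - expmom j t) / e - expmom (Suc j) t) =
          \<bar>expmom j (t + e) - expmom j t - e * expmom (Suc j) t\<bar> / \<bar>e\<bar>"
        by (simp only: real_norm_def abs_divide)
      also have "\<dots> \<le> H * e\<^sup>2 / \<bar>e\<bar>" by (intro divide_right_mono bound e) simp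
      also have "\<dots> = H * \<bar>e\<bar>" using e by (simp add: power2_eq_square abs_if)
      also have "\<dots> \<le> \<bar>H\<bar> * \<bar>e\<bar>" by (intro mult_right_mono) auto
      finally show "norm ((expmom j (t + e) - expmom j t) / e - expmom (Suc j) t) \<le> \<bar>H\<bar> * \<bar>e\<bar>" .
    qed simp
    show "(\<lambda>e. \<bar>H\<bar> * \<bar>e\<bar>) \<midarrow>0\<rightarrow> 0" by (rule tendsto_mult_right_zero[OF tendsto_rabs_zero[OF tendsto_ident_at]])
  qed
  then show ?thesis unfolding DERIV_def by (rule LIM_zero_cancel)
qed

lemma expmom_0_pos: "0 < expmom 0 t"
proof -
  have "0 \<le> expmom 0 t" unfolding expmom_def by (intro integral_nonneg_AE) (auto simp: p_nonneg)
  moreover have "expmom 0 t \<noteq> 0"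
  proof
    assume "expmom 0 t = 0"
    then have "AE x in lborel. x ^ 0 * exp (t * x) * p x = 0"
      unfolding expmom_def by (subst (asm) integral_nonneg_eq_0_iff_AE[OF expmom_integrable]) (auto simp: p_nonneg)
    then have "AE x in lborel. p x = 0" by (auto elim!: eventually_mono)
    from integral_eq_zero_AE[OF this] show False using p_integral by simp
  qed
  ultimately show ?thesis by simp
qed

definition tilted :: "real \<Rightarrow> real \<Rightarrow> real" where "tilted t x = exp (t * x) * p x / expmom 0 t"
definition tmean :: "real \<Rightarrow> real" where "tmean t = expmom 1 t / expmom 0 t"
definition tvar :: "real \<Rightarrow> real" where "tvar t = expmom 2 t / expmom 0 t - (tmean t)\<^sup>2"

text \<open>
  The third central moment of the tilted law, which is also the third derivative of \<open>ln \<Phi>\<close>.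
\<close>
definition tthird :: "real \<Rightarrow> real" where
  "tthird t = expmom 3 t / expmom 0 t - 3 * tmean t * (expmom 2 t / expmom 0 t) + 2 * tmean t ^ 3"

lemma tilted_measurable [measurable]: "tilted t \<in> borel_measurable borel"
  unfolding tilted_def[abs_def] by simp

lemma tilted_nonneg: "0 \<le> tilted t x"
  unfolding tilted_def using p_nonneg expmom_0_pos[of t] by simp

lemma tilted_moment: "integrable lborel (\<lambda>x. x ^ j * tilted t x)"
  "(LBINT x. x ^ j * tilted t x) = expmom j t / expmom 0 t"
proof -
  have eq: "x ^ j * tilted t x = x ^ j * exp (t * x) * p x / expmom 0 t" for x by (simp add: tilted_def)
  show "integrable lborel (\<lambda>x. x ^ j * tilted t x)" unfolding eq by (intro integrable_divide expmom_integrable)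
  show "(LBINT x. x ^ j * tilted t x) = expmom j t / expmom 0 t" unfolding eq by (simp add: expmom_def)
qed

lemma tilted_integrable: "integrable lborel (tilted t)" and tilted_integral: "(LBINT x. tilted t x) = 1"
  using tilted_moment[of 0 t] expmom_0_pos[of t] by auto

text \<open>
  The centre \<open>b\<close> is free because moments are taken about the saddle point in Laplace's method and about
  the mean afterwards.
\<close>
lemma tilted_central_moments:
  "integrable lborel (\<lambda>x. (x - b) ^ j * tilted t x)"
  "(LBINT x. (x - b) * tilted t x) = tmean t - b"
  "(LBINT x. (x - b)\<^sup>2 * tilted t x) = tvar t + (tmean t - b)\<^sup>2"
  "(LBINT x. (x - b) ^ 3 * tilted t x) = tthird t + 3 * (tmean t - b) * tvar t + (tmean t - b) ^ 3"
proof -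
  note i = tilted_moment(1)
  have i1: "integrable lborel (\<lambda>x. x * tilted t x)" using i[of 1 t] by simp
  have m: "(LBINT x. tilted t x) = 1" "(LBINT x. x * tilted t x) = tmean t"
    "(LBINT x. x\<^sup>2 * tilted t x) = tvar t + (tmean t)\<^sup>2"
    "(LBINT x. x ^ 3 * tilted t x) = tthird t + 3 * tmean t * (tvar t + (tmean t)\<^sup>2) - 2 * tmean t ^ 3"
    using tilted_integral tilted_moment(2)[of 1 t] tilted_moment(2)[of 2 t] tilted_moment(2)[of 3 t]
    by (auto simp: tmean_def tvar_def tthird_def)
  have "(x - b) ^ j * tilted t x = (\<Sum>l\<le>j. of_nat (j choose l) * (- b) ^ (j - l) * (x ^ l * tilted t x))" for x
    using binomial_ring[of x "- b" j] by (simp add: sum_distrib_left mult_ac)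
  then show "integrable lborel (\<lambda>x. (x - b) ^ j * tilted t x)"
    by (simp only:) (intro Bochner_Integration.integrable_sum integrable_mult_right i)
  have "(LBINT x. (x - b) * tilted t x) = (LBINT x. x * tilted t x - b * tilted t x)"
    by (simp add: left_diff_distrib)
  also have "\<dots> = tmean t - b"
    by (subst Bochner_Integration.integral_diff) (auto intro: i1 tilted_integrable simp: m)
  finally show "(LBINT x. (x - b) * tilted t x) = tmean t - b" .
  have "(LBINT x. (x - b)\<^sup>2 * tilted t x) = (LBINT x. x\<^sup>2 * tilted t x + ((- 2 * b) * (x * tilted t x) + b\<^sup>2 * tilted t x))"
    by (intro Bochner_Integration.integral_cong) (auto simp: power2_eq_square algebra_simps)
  also have "\<dots> = (LBINT x. x\<^sup>2 * tilted t x) + ((- 2 * b) * (LBINT x. x * tilted t x) + b\<^sup>2 * (LBINT x. tilted t x))"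
    using i[of 2 t] i1 tilted_integrable[of t] by simp
  also have "\<dots> = tvar t + (tmean t - b)\<^sup>2" unfolding m by (simp add: power2_eq_square algebra_simps)
  finally show "(LBINT x. (x - b)\<^sup>2 * tilted t x) = tvar t + (tmean t - b)\<^sup>2" .
  have "(LBINT x. (x - b) ^ 3 * tilted t x) =
    (LBINT x. x ^ 3 * tilted t x + ((- 3 * b) * (x\<^sup>2 * tilted t x) + ((3 * b\<^sup>2) * (x * tilted t x) + (- (b ^ 3)) * tilted t x)))"
    by (intro Bochner_Integration.integral_cong) (auto simp: power2_eq_square power3_eq_cube algebra_simps)
  also have "\<dots> = (LBINT x. x ^ 3 * tilted t x) + ((- 3 * b) * (LBINT x. x\<^sup>2 * tilted t x)
      + ((3 * b\<^sup>2) * (LBINT x. x * tilted t x) + (- (b ^ 3)) * (LBINT x. tilted t x)))"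
    using i[of 3 t] i[of 2 t] i1 tilted_integrable[of t] by simp
  also have "\<dots> = tthird t + 3 * (tmean t - b) * tvar t + (tmean t - b) ^ 3"
    unfolding m by (simp add: power2_eq_square power3_eq_cube algebra_simps)
  finally show "(LBINT x. (x - b) ^ 3 * tilted t x) = tthird t + 3 * (tmean t - b) * tvar t + (tmean t - b) ^ 3" .
qed

lemma tvar_pos: "0 < tvar t"
proof -
  have eq: "tvar t = (LBINT x. (x - tmean t)\<^sup>2 * tilted t x)"
    using tilted_central_moments(3)[of "tmean t" t] by simp
  have "0 \<le> tvar t" unfolding eq by (intro integral_nonneg_AE) (auto simp: tilted_nonneg)
  moreover have "tvar t \<noteq> 0"
  proof
    assume "tvar t = 0"
    then have "AE x in lborel. (x - tmean t)\<^sup>2 * tilted t x = 0"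
      unfolding eq by (subst (asm) integral_nonneg_eq_0_iff_AE[OF tilted_central_moments(1)]) (auto simp: tilted_nonneg)
    moreover have "AE x in lborel. x \<noteq> tmean t" by (rule AE_lborel_singleton)
    ultimately have "AE x in lborel. tilted t x = 0" by eventually_elim auto
    from integral_eq_zero_AE[OF this] show False using tilted_integral[of t] by simp
  qed
  ultimately show ?thesis by simp
qed

lemma log_expmom_derivative: "((\<lambda>t. ln (expmom 0 t)) has_real_derivative tmean t) (at t)"
proof -
  have "((\<lambda>t. ln (expmom 0 t)) has_real_derivative 1 / expmom 0 t * expmom (Suc 0) t) (at t)"
    by (rule DERIV_chain2[where g="expmom 0"], rule DERIV_ln_divide[OF expmom_0_pos], rule expmom_derivative)
  moreover have "1 / expmom 0 t * expmom (Suc 0) t = tmean t" by (simp add: tmean_def)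
  ultimately show ?thesis by (simp only:)
qed

lemma expmom_derivatives:
  "(expmom 1 has_real_derivative expmom 2 t) (at t)" "(expmom 2 has_real_derivative expmom 3 t) (at t)"
proof -
  have "Suc 1 = 2" "Suc 2 = 3" by simp_all
  then show "(expmom 1 has_real_derivative expmom 2 t) (at t)" "(expmom 2 has_real_derivative expmom 3 t) (at t)"
    using expmom_derivative[of 1 t] expmom_derivative[of 2 t] by (simp_all only:)
qed

lemma tmean_derivative: "(tmean has_real_derivative tvar t) (at t)"
proof -
  have z: "expmom 0 t \<noteq> 0" using expmom_0_pos[of t] by simp
  have "(tmean has_real_derivative
      (expmom 2 t * expmom 0 t - expmom 1 t * expmom (Suc 0) t) / (expmom 0 t * expmom 0 t)) (at t)"
    unfolding tmean_def[abs_def] by (rule DERIV_divide[OF expmom_derivatives(1) expmom_derivative z])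
  moreover have "(expmom 2 t * expmom 0 t - expmom 1 t * expmom (Suc 0) t) / (expmom 0 t * expmom 0 t) = tvar t"
    using z by (simp add: tvar_def tmean_def power2_eq_square diff_divide_distrib)
  ultimately show ?thesis by simp
qed

lemma tvar_derivative: "(tvar has_real_derivative tthird t) (at t)"
proof -
  have z: "expmom 0 t \<noteq> 0" using expmom_0_pos[of t] by simp
  have sq: "((\<lambda>t. (tmean t)\<^sup>2) has_real_derivative 2 * tmean t * tvar t) (at t)"
    using DERIV_power[OF tmean_derivative, of 2 t] by (simp add: mult_ac)
  have "(tvar has_real_derivative
      (expmom 3 t * expmom 0 t - expmom 2 t * expmom (Suc 0) t) / (expmom 0 t * expmom 0 t) - 2 * tmean t * tvar t) (at t)"
    unfolding tvar_def[abs_def]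
    by (rule DERIV_diff[OF DERIV_divide[OF expmom_derivatives(2) expmom_derivative z] sq[unfolded tvar_def]])
  moreover have "(expmom 3 t * expmom 0 t - expmom 2 t * expmom (Suc 0) t) / (expmom 0 t * expmom 0 t) - 2 * tmean t * tvar t = tthird t"
  proof -
    have "(c * z - b * (m * z)) / (z * z) - 2 * m * (b / z - m\<^sup>2) = c / z - 3 * m * (b / z) + 2 * m ^ 3" if "z \<noteq> 0" for b c m z :: real
      using that by (simp add: diff_divide_distrib power2_eq_square power3_eq_cube algebra_simps)
    from this[OF z, of "expmom 3 t" "expmom 2 t" "tmean t"] show ?thesis
      using z by (simp add: tthird_def tvar_def) (simp add: tmean_def)
  qed
  ultimately show ?thesis by simp
qed

lemma tmean_strict_mono: "s < t \<Longrightarrow> tmean s < tmean t"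
  by (rule DERIV_pos_imp_increasing[of s t tmean]) (use tmean_derivative tvar_pos in blast)+

context
  fixes M :: "'a measure" and Y :: "'a \<Rightarrow> real"
  assumes Y: "distributed M lborel Y (\<lambda>x. ennreal (p x))"
begin

lemma mgf_eq: "mgf M Y t = expmom 0 t"
  unfolding mgf_def expmom_def
  by (subst distributed_integral[OF Y, symmetric]) (auto simp: p_nonneg mult.commute)

lemma tilt_mean_eq: "tilt_mean M Y = tmean"
  unfolding tilt_mean_def mgf_eq by (rule ext) (rule DERIV_imp_deriv[OF log_expmom_derivative])

lemma tilt_sd_eq: "tilt_sd M Y t = sqrt (tvar t)"
  unfolding tilt_sd_def tilt_mean_eq using DERIV_imp_deriv[OF tmean_derivative] by simp

lemma tilt_mu3_eq: "tilt_mu3 M Y t = tthird t"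
proof -
  have "tilt_mu3 M Y = deriv (deriv (tilt_mean M Y))"
    unfolding tilt_mu3_def tilt_mean_def by (simp only: numeral_3_eq_3 funpow.simps o_apply id_apply)
  also have "deriv (tilt_mean M Y) = tvar"
    unfolding tilt_mean_eq by (rule ext) (rule DERIV_imp_deriv[OF tmean_derivative])
  also have "deriv tvar = tthird" by (rule ext) (rule DERIV_imp_deriv[OF tvar_derivative])
  finally show ?thesis by simp
qed

lemma tilted_density_eq: "tilted_density M Y p t x = tilted t x"
  by (simp add: tilted_density_def tilted_def mgf_eq)

end

end

section \<open>Laplace's method at the saddle point\<close>

lemma convex_tangent:
  fixes g h :: "real \<Rightarrow> real"
  assumes "convex_on {0..} g" "(g has_real_derivative h x) (at x)" "x > 0" "y \<ge> 0"
  shows "h x * (y - x) \<le> g y - g x"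
  using assms by (intro convex_on_imp_above_tangent[of "{0..}"]) (auto intro: has_field_derivative_at_within)

lemma convex_derivative_mono:
  fixes g h :: "real \<Rightarrow> real"
  assumes g: "convex_on {0..} g" "\<And>x. x > 0 \<Longrightarrow> (g has_real_derivative h x) (at x)" and xy: "0 < x" "x \<le> y"
  shows "h x \<le> h y"
proof (cases "x = y")
  case False
  then have lt: "x < y" using xy by simp
  have "h x * (y - x) \<le> g y - g x" "h y * (x - y) \<le> g x - g y"
    using g xy lt by (auto intro!: convex_tangent)
  then have "(h x - h y) * (y - x) \<le> 0" by (simp add: algebra_simps)
  then show ?thesis using lt by (simp add: mult_le_0_iff)
qed simp

text \<open>
  The tangent at \<open>x\<close>, evaluated at \<open>0\<close>, gives \<open>h x \<ge> (g x - g 0) / x\<close>.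
\<close>
lemma convex_derivative_at_top:
  fixes g h :: "real \<Rightarrow> real"
  assumes g: "convex_on {0..} g" "\<And>x. x > 0 \<Longrightarrow> (g has_real_derivative h x) (at x)"
    and top: "filterlim (\<lambda>x. g x / x) at_top at_top"
  shows "filterlim h at_top at_top"
proof (rule filterlim_at_top_mono)
  have "((\<lambda>x. g 0 / x) \<longlongrightarrow> 0) at_top"
    by (intro tendsto_divide_0[OF tendsto_const] filterlim_at_top_imp_at_infinity filterlim_ident)
  then have "((\<lambda>x. - (g 0 / x)) \<longlongrightarrow> 0) at_top" using tendsto_minus by fastforce
  then show "filterlim (\<lambda>x. - (g 0 / x) + g x / x) at_top at_top"
    by (rule filterlim_tendsto_add_at_top[OF _ top])
  show "\<forall>\<^sub>F x in at_top. - (g 0 / x) + g x / x \<le> h x"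
    using eventually_gt_at_top[of 0]
  proof eventually_elim
    case (elim x)
    have "h x * (0 - x) \<le> g 0 - g x" using elim g by (intro convex_tangent) auto
    then have "(g x - g 0) / x \<le> h x" using elim by (simp add: pos_divide_le_eq)
    then show ?case by (simp add: diff_divide_distrib)
  qed
qed

locale convex_tail =
  fixes p g q h k :: "real \<Rightarrow> real" and B :: real
  assumes p_eq: "\<And>x. p x = (if x \<ge> 0 then exp (- (g x - q x)) else 0)"
    and p_meas [measurable]: "p \<in> borel_measurable borel" and p_mass: "(LBINT x. p x) = 1"
    and g_pos: "\<And>x. x \<ge> 0 \<Longrightarrow> g x > 0" and g_convex: "convex_on {0..} g"
    and g_deriv: "\<And>x. x > 0 \<Longrightarrow> (g has_real_derivative h x) (at x)"
    and h_deriv: "\<And>x. x > 0 \<Longrightarrow> (h has_real_derivative k x) (at x)"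
    and g_top: "filterlim (\<lambda>x. g x / x) at_top at_top"
    and q_bound: "\<And>x. x \<ge> 0 \<Longrightarrow> \<bar>q x\<bar> \<le> B" and q_lim: "(q \<longlongrightarrow> 0) at_top"
    and curvature: "slowly_changing_curvature k"
begin

text \<open>
  Beyond some \<open>X\<close> superlinearity gives \<open>g x \<ge> (t + 1) * x\<close>; on \<open>[0, X]\<close> everything is bounded.
\<close>
lemma p_light_tail: "\<exists>C. \<forall>x. exp (t * x) * p x \<le> C * exp (- \<bar>x\<bar>)"
proof -
  have "\<forall>\<^sub>F x in at_top. g x / x > t + 1" using g_top by (simp add: filterlim_at_top_dense)
  then obtain X where X: "X > 0" "\<And>x. x \<ge> X \<Longrightarrow> g x / x > t + 1"
    using eventually_at_top_beyond[of _ 0] by blast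
  have "exp (t * x) * p x \<le> exp (\<bar>t\<bar> * X + B + X) * exp (- \<bar>x\<bar>)" for x
  proof (cases "x \<ge> 0")
    case True
    have "t * x - g x + q x \<le> \<bar>t\<bar> * X + B + X - x"
    proof (cases "x \<ge> X")
      case True
      then have "(t + 1) * x < g x" using X(1) X(2)[OF True] by (simp add: pos_less_divide_eq)
      then have "t * x - g x \<le> - x" by (simp add: distrib_right)
      moreover have "q x \<le> B" using q_bound[of x] True X(1) by simp
      moreover have "0 \<le> \<bar>t\<bar> * X" using X(1) by simp
      ultimately show ?thesis using X(1) by linarith
    next
      case False
      have "t * x \<le> \<bar>t\<bar> * x" using True by (intro mult_right_mono) auto
      also have "\<dots> \<le> \<bar>t\<bar> * X" using False by (intro mult_left_mono) auto
      finally show ?thesis using q_bound[OF True] g_pos[OF True] False by linarith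
    qed
    then have "exp (t * x - g x + q x) \<le> exp (\<bar>t\<bar> * X + B + X - x)" by simp
    also have "exp (t * x - g x + q x) = exp (t * x) * p x"
      using True by (simp add: p_eq exp_add[symmetric])
    also have "exp (\<bar>t\<bar> * X + B + X - x) = exp (\<bar>t\<bar> * X + B + X) * exp (- \<bar>x\<bar>)"
      using True by (simp add: exp_add[symmetric])
    finally show ?thesis .
  qed (simp add: p_eq)
  then show ?thesis by blast
qed

sublocale light_tailed_density p
  by (unfold_locales, rule p_meas, simp add: p_eq, rule p_light_tail, rule p_mass)

lemma h_mono: "0 < x \<Longrightarrow> x \<le> y \<Longrightarrow> h x \<le> h y"
  using convex_derivative_mono[OF g_convex g_deriv] by blast

lemma h_top: "filterlim h at_top at_top"
  using convex_derivative_at_top[OF g_convex g_deriv g_top] by blast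

lemma h_surj:
  assumes "t \<ge> h 1" shows "\<exists>x\<ge>1. h x = t"
proof -
  have "\<forall>\<^sub>F x in at_top. h x > t" using h_top by (simp add: filterlim_at_top_dense)
  then obtain X where X: "X > 1" "\<And>x. x \<ge> X \<Longrightarrow> h x > t" using eventually_at_top_beyond[of _ 1] by blast
  have "continuous_on {1..X} h"
    by (intro continuous_at_imp_continuous_on ballI DERIV_isCont[OF h_deriv]) auto
  then have "\<exists>x. 1 \<le> x \<and> x \<le> X \<and> h x = t"
    using X(1) less_imp_le[OF X(2)[of X]] assms by (intro IVT') auto
  then show ?thesis by blast
qed

lemma saddle_point:
  fixes t :: "nat \<Rightarrow> real"
  assumes t: "filterlim t at_top sequentially"
  obtains x where "filterlim x at_top sequentially" "\<forall>\<^sub>F n in sequentially. h (x n) = t n"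
proof -
  define x where "x n = (SOME x. x \<ge> 1 \<and> h x = t n)" for n
  have ev: "\<forall>\<^sub>F n in sequentially. x n \<ge> 1 \<and> h (x n) = t n"
    using t[unfolded filterlim_at_top, THEN spec, of "h 1"]
  proof eventually_elim
    case (elim n)
    then show ?case unfolding x_def using someI_ex[of "\<lambda>x. x \<ge> 1 \<and> h x = t n"] h_surj by blast
  qed
  have "filterlim x at_top sequentially"
    unfolding filterlim_at_top_dense
  proof
    fix Z
    show "\<forall>\<^sub>F n in sequentially. x n > Z"
      using ev t[unfolded filterlim_at_top_dense, THEN spec, of "h (max 1 Z)"]
    proof eventually_elim
      case (elim n)
      show ?case
      proof (rule ccontr)
        assume "\<not> x n > Z"
        then have "h (x n) \<le> h (max 1 Z)" using elim by (intro h_mono) auto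
        then show False using elim by simp
      qed
    qed
  qed
  moreover have "\<forall>\<^sub>F n in sequentially. h (x n) = t n" using ev by eventually_elim simp
  ultimately show thesis by (rule that)
qed

end

locale laplace_sequence = convex_tail +
  fixes x :: "nat \<Rightarrow> real"
  assumes x_top: "filterlim x at_top sequentially"
begin

text \<open>
  The tilted law with parameter \<open>h (x n)\<close> is examined at its saddle point \<open>x n\<close> on the scale \<open>\<sigma> n\<close>. In this
  coordinate \<open>excess\<close> is the exponent above its minimum, and \<open>w\<close> is the tilted density up to normalization, with
  the value at \<open>z = 0\<close> reduced to \<open>exp (q (x n))\<close>.
\<close>
definition "\<sigma> n = 1 / sqrt (k (x n))"
definition "excess n z = g (x n + \<sigma> n * z) - g (x n) - h (x n) * \<sigma> n * z"
definition "w n z = exp (g (x n) + h (x n) * \<sigma> n * z) * p (x n + \<sigma> n * z)"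

lemma xk_top: "filterlim (\<lambda>n. x n * k (x n)) at_top sequentially"
  using curvature x_top unfolding slowly_changing_curvature_def by (auto intro: filterlim_compose)

lemma ev_pos: "\<forall>\<^sub>F n in sequentially. x n > 0 \<and> k (x n) > 0 \<and> \<sigma> n > 0"
  using x_top[unfolded filterlim_at_top_dense, THEN spec, of 0] xk_top[unfolded filterlim_at_top_dense, THEN spec, of 0]
  by eventually_elim (auto simp: \<sigma>_def zero_less_mult_iff)

lemma sigma_x: "(\<lambda>n. \<sigma> n * z / x n) \<longlonglongrightarrow> 0"
proof -
  have "(\<lambda>n. ((x n + \<sigma> n * z) - x n) / x n) \<longlonglongrightarrow> 0"
  proof (rule relative_window[OF _ x_top])
    show "filterlim (\<lambda>x. x * k x) at_top at_top" using curvature by (simp add: slowly_changing_curvature_def)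
    show "\<forall>\<^sub>F n in sequentially. \<bar>(x n + \<sigma> n * z) - x n\<bar> \<le> \<bar>z\<bar> / sqrt (k (x n))"
      using ev_pos by eventually_elim (simp add: \<sigma>_def abs_mult)
  qed
  then show ?thesis by simp
qed

lemma window_pos: "\<forall>\<^sub>F n in sequentially. \<bar>\<sigma> n * z\<bar> < x n / 2"
proof -
  have "\<forall>\<^sub>F n in sequentially. dist (\<sigma> n * z / x n) 0 < 1 / 2" by (rule tendstoD[OF sigma_x]) simp
  with ev_pos show ?thesis
    by eventually_elim (simp add: dist_real_def abs_mult abs_divide pos_divide_less_eq)
qed

text \<open>
  Taylor's theorem gives \<open>excess n z = k \<xi> / k (x n) * (z\<^sup>2 / 2)\<close> with \<open>\<xi>\<close> within \<open>\<bar>z\<bar>\<close> widths of \<open>x n\<close>.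
\<close>
lemma excess_lim: "(\<lambda>n. excess n z) \<longlonglongrightarrow> z\<^sup>2 / 2"
proof (cases "z = 0")
  case False
  have ex: "\<forall>\<^sub>F n in sequentially. \<exists>\<xi>. \<bar>\<xi> - x n\<bar> \<le> \<bar>z\<bar> / sqrt (k (x n)) \<and> excess n z = k \<xi> / k (x n) * (z\<^sup>2 / 2)"
    using ev_pos window_pos[of z]
  proof eventually_elim
    case (elim n)
    define y where "y = x n + \<sigma> n * z"
    define df where "df m = (if m = 0 then g else if m = (1::nat) then h else k)" for m
    have y: "y \<noteq> x n" "y > 0" using elim False by (auto simp: y_def abs_less_iff)
    let ?a = "min y (x n)" and ?b = "max y (x n)"
    have "\<exists>t. (if y < x n then y < t \<and> t < x n else x n < t \<and> t < y) \<and>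
      g y = (\<Sum>m<2. (df m (x n) / fact m) * (y - x n) ^ m) + (df 2 t / fact 2) * (y - x n) ^ 2"
    proof (rule Taylor[where a="?a" and b="?b"])
      show "\<forall>m t. m < 2 \<and> ?a \<le> t \<and> t \<le> ?b \<longrightarrow> (df m has_real_derivative df (Suc m) t) (at t)"
      proof (intro allI impI)
        fix m :: nat and t assume a: "m < 2 \<and> ?a \<le> t \<and> t \<le> ?b"
        then have "t > 0" using y elim by auto
        moreover have "m = 0 \<or> m = 1" using a by auto
        ultimately show "(df m has_real_derivative df (Suc m) t) (at t)"
          using g_deriv h_deriv by (auto simp: df_def)
      qed
    qed (use y in \<open>auto simp: df_def\<close>)
    then obtain \<xi> where xi: "if y < x n then y < \<xi> \<and> \<xi> < x n else x n < \<xi> \<and> \<xi> < y"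
      and gy: "g y = g (x n) + h (x n) * (y - x n) + k \<xi> / 2 * (y - x n)\<^sup>2"
      by (auto simp: df_def numeral_2_eq_2)
    have "excess n z = k \<xi> / 2 * (\<sigma> n * z)\<^sup>2" using gy by (simp add: excess_def y_def mult.assoc)
    moreover have "(\<sigma> n * z)\<^sup>2 = z\<^sup>2 / k (x n)" using elim by (simp add: \<sigma>_def power_mult_distrib power_divide)
    moreover have "\<bar>\<xi> - x n\<bar> \<le> \<bar>y - x n\<bar>" using xi by (auto split: if_splits)
    moreover have "\<bar>y - x n\<bar> = \<bar>z\<bar> / sqrt (k (x n))" using elim by (simp add: y_def \<sigma>_def abs_mult)
    ultimately show ?case by (intro exI[of _ \<xi>]) (simp add: mult.commute)
  qed
  define \<xi> where "\<xi> n = (SOME \<xi>. \<bar>\<xi> - x n\<bar> \<le> \<bar>z\<bar> / sqrt (k (x n)) \<and> excess n z = k \<xi> / k (x n) * (z\<^sup>2 / 2))" for n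
  have xi: "\<forall>\<^sub>F n in sequentially. \<bar>\<xi> n - x n\<bar> \<le> \<bar>z\<bar> / sqrt (k (x n)) \<and> excess n z = k (\<xi> n) / k (x n) * (z\<^sup>2 / 2)"
    using ex by eventually_elim (unfold \<xi>_def, rule someI_ex)
  have "\<forall>\<^sub>F n in sequentially. \<bar>\<xi> n - x n\<bar> \<le> \<bar>z\<bar> / sqrt (k (x n))" using xi by eventually_elim simp
  then have "(\<lambda>n. k (\<xi> n) / k (x n)) \<longlonglongrightarrow> 1"
    using curvature x_top unfolding slowly_changing_curvature_def by blast
  then have "(\<lambda>n. k (\<xi> n) / k (x n) * (z\<^sup>2 / 2)) \<longlonglongrightarrow> 1 * (z\<^sup>2 / 2)" by (intro tendsto_mult tendsto_const)
  then have "(\<lambda>n. k (\<xi> n) / k (x n) * (z\<^sup>2 / 2)) \<longlonglongrightarrow> z\<^sup>2 / 2" by simp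
  then show ?thesis by (rule Lim_transform_eventually) (use xi in \<open>auto elim!: eventually_mono\<close>)
qed (simp add: excess_def)

lemma w_eq: "w n z = (if x n + \<sigma> n * z \<ge> 0 then exp (- excess n z + q (x n + \<sigma> n * z)) else 0)"
  unfolding w_def excess_def by (simp add: p_eq exp_add[symmetric] algebra_simps)

lemma w_measurable [measurable]: "w n \<in> borel_measurable borel"
  unfolding w_def[abs_def] by simp

lemma w_lim: "(\<lambda>n. w n z) \<longlonglongrightarrow> exp (- (z\<^sup>2 / 2))"
proof -
  have ev: "\<forall>\<^sub>F n in sequentially. x n + \<sigma> n * z > x n / 2" using window_pos[of z] by eventually_elim (simp add: abs_less_iff)
  have "filterlim (\<lambda>n. x n + \<sigma> n * z) at_top sequentially"
  proof (rule filterlim_at_top_mono)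
    have "filterlim (\<lambda>n. 1/2 * x n) at_top sequentially"
      by (rule filterlim_tendsto_pos_mult_at_top[OF tendsto_const _ x_top]) simp
    then show "filterlim (\<lambda>n. x n / 2) at_top sequentially" by simp
    show "\<forall>\<^sub>F n in sequentially. x n / 2 \<le> x n + \<sigma> n * z" using ev by eventually_elim simp
  qed
  then have ql: "(\<lambda>n. q (x n + \<sigma> n * z)) \<longlonglongrightarrow> 0" by (rule filterlim_compose[OF q_lim])
  have "(\<lambda>n. exp (- excess n z + q (x n + \<sigma> n * z))) \<longlonglongrightarrow> exp (- (z\<^sup>2 / 2))"
    by (rule tendsto_eq_rhs[where x="exp (- (z\<^sup>2 / 2) + 0)"]) (intro tendsto_exp tendsto_add tendsto_minus excess_lim ql, simp_all)
  then show ?thesis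
  proof (rule Lim_transform_eventually)
    show "\<forall>\<^sub>F n in sequentially. exp (- excess n z + q (x n + \<sigma> n * z)) = w n z"
      using ev ev_pos by eventually_elim (simp add: w_eq)
  qed
qed

lemma excess_convex:
  assumes "x n + \<sigma> n * u \<ge> 0" "x n + \<sigma> n * v \<ge> 0" "0 \<le> l" "l \<le> 1"
  shows "excess n ((1 - l) * u + l * v) \<le> (1 - l) * excess n u + l * excess n v"
proof -
  have "g ((1 - l) *\<^sub>R (x n + \<sigma> n * u) + l *\<^sub>R (x n + \<sigma> n * v)) \<le> (1 - l) * g (x n + \<sigma> n * u) + l * g (x n + \<sigma> n * v)"
    using assms by (intro convex_onD[OF g_convex]) auto
  moreover have "(1 - l) *\<^sub>R (x n + \<sigma> n * u) + l *\<^sub>R (x n + \<sigma> n * v) = x n + \<sigma> n * ((1 - l) * u + l * v)"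
    by (simp add: algebra_simps)
  ultimately have "g (x n + \<sigma> n * ((1 - l) * u + l * v)) \<le> (1 - l) * g (x n + \<sigma> n * u) + l * g (x n + \<sigma> n * v)"
    by simp
  then show ?thesis unfolding excess_def by (simp add: algebra_simps)
qed

text \<open>
  The limits at \<open>z = 1\<close> and \<open>z = -1\<close> are \<open>1/2 > 1/4\<close>, and a convex function vanishing at \<open>0\<close> grows at least
  linearly from there. The limits at \<open>z = 2\<close> and \<open>z = -2\<close> are \<open>2 < 3\<close>, and convexity interpolates between them.
\<close>
lemma excess_bounds:
  "\<forall>\<^sub>F n in sequentially. (\<forall>z. x n + \<sigma> n * z \<ge> 0 \<longrightarrow> excess n z \<ge> (\<bar>z\<bar> - 1) / 4)
     \<and> (\<forall>z. \<bar>z\<bar> \<le> 2 \<longrightarrow> x n + \<sigma> n * z \<ge> 0 \<and> excess n z \<le> 3)"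
proof -
  have l1: "\<forall>\<^sub>F n in sequentially. excess n 1 > 1/4" by (rule order_tendstoD[OF excess_lim]) simp
  have l2: "\<forall>\<^sub>F n in sequentially. excess n (-1) > 1/4" by (rule order_tendstoD[OF excess_lim]) simp
  have l3: "\<forall>\<^sub>F n in sequentially. excess n 2 < 3" by (rule order_tendstoD[OF excess_lim]) simp
  have l4: "\<forall>\<^sub>F n in sequentially. excess n (-2) < 3" by (rule order_tendstoD[OF excess_lim]) simp
  show ?thesis
    using l1 l2 l3 l4 ev_pos window_pos[of 2]
  proof eventually_elim
    case (elim n)
    have x2: "x n + \<sigma> n * 2 \<ge> 0" "x n + \<sigma> n * (-2) \<ge> 0" using elim by (auto simp: abs_less_iff)
    have e0: "excess n 0 = 0" by (simp add: excess_def)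
    have "excess n z \<ge> (\<bar>z\<bar> - 1) / 4" if z: "x n + \<sigma> n * z \<ge> 0" for z
    proof (cases "\<bar>z\<bar> \<le> 1")
      case True
      have "h (x n) * (x n + \<sigma> n * z - x n) \<le> g (x n + \<sigma> n * z) - g (x n)"
        using elim z by (intro convex_tangent g_convex g_deriv) auto
      then have "0 \<le> excess n z" by (simp add: excess_def mult.assoc)
      moreover have "(\<bar>z\<bar> - 1) / 4 \<le> 0" using True by simp
      ultimately show ?thesis by linarith
    next
      case False
      \<comment> \<open>The point \<open>l * z\<close> is \<open>1\<close> or \<open>-1\<close>.\<close>
      define l where "l = 1 / \<bar>z\<bar>"
      have l: "0 \<le> l" "l \<le> 1" "l * \<bar>z\<bar> = 1" using False by (auto simp: l_def)
      have "excess n ((1 - l) * 0 + l * z) \<le> (1 - l) * excess n 0 + l * excess n z"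
        using elim z l by (intro excess_convex) auto
      then have le: "excess n (l * z) \<le> l * excess n z" by (simp add: e0)
      have "l * z = 1 \<or> l * z = -1" using l(3) by (cases "z \<ge> 0") (auto simp: abs_if split: if_splits)
      then have "1/4 \<le> excess n (l * z)" using elim by auto
      then have "1/4 * \<bar>z\<bar> \<le> l * excess n z * \<bar>z\<bar>" using le by (intro mult_right_mono) auto
      also have "\<dots> = (l * \<bar>z\<bar>) * excess n z" by (simp only: mult_ac)
      also have "\<dots> = excess n z" using l(3) by simp
      finally show ?thesis by simp
    qed
    moreover have "x n + \<sigma> n * z \<ge> 0 \<and> excess n z \<le> 3" if z: "\<bar>z\<bar> \<le> 2" for z
    proof
      have "\<bar>\<sigma> n * z\<bar> \<le> \<bar>\<sigma> n * 2\<bar>" unfolding abs_mult using z by (intro mult_left_mono) auto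
      then show "x n + \<sigma> n * z \<ge> 0" using elim by linarith
      define l where "l = (z + 2) / 4"
      have l: "0 \<le> l" "l \<le> 1" "(1 - l) * (-2) + l * 2 = z"
        using z by (auto simp: l_def abs_le_iff) (simp add: field_simps)
      have "excess n z \<le> (1 - l) * excess n (-2) + l * excess n 2"
        using excess_convex[OF x2(2) x2(1) l(1,2)] unfolding l(3) .
      also have "\<dots> \<le> (1 - l) * 3 + l * 3" using l elim by (intro add_mono mult_left_mono) auto
      finally show "excess n z \<le> 3" by simp
    qed
    ultimately show ?case by blast
  qed
qed

lemma w_bounds:
  "\<forall>\<^sub>F n in sequentially. (\<forall>z. 0 \<le> w n z \<and> w n z \<le> exp (B + 1/4) * exp (- (1/4) * \<bar>z\<bar>)) \<and> (\<forall>z. \<bar>z\<bar> \<le> 2 \<longrightarrow> exp (- B - 3) \<le> w n z)"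
  using excess_bounds
proof eventually_elim
  case (elim n)
  have "w n z \<le> exp (B + 1/4) * exp (- (1/4) * \<bar>z\<bar>)" for z
  proof (cases "x n + \<sigma> n * z \<ge> 0")
    case True
    have "- excess n z + q (x n + \<sigma> n * z) \<le> B + 1/4 + (- (1/4) * \<bar>z\<bar>)"
      using elim True q_bound[OF True] by (auto simp: abs_le_iff diff_divide_distrib dest!: spec[of _ z])
    then show ?thesis using True unfolding w_eq exp_add[symmetric] by simp
  qed (simp add: w_eq)
  moreover have "exp (- B - 3) \<le> w n z" if "\<bar>z\<bar> \<le> 2" for z
  proof -
    have "x n + \<sigma> n * z \<ge> 0" "excess n z \<le> 3" using elim that by auto
    then show ?thesis using q_bound[of "x n + \<sigma> n * z"] by (simp add: w_eq abs_le_iff)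
  qed
  moreover have "0 \<le> w n z" for z by (simp add: w_eq)
  ultimately show ?case by blast
qed

end

section \<open>Asymptotic normality of the tilted law\<close>

lemma dominated_convergence_eventually:
  fixes s :: "nat \<Rightarrow> real \<Rightarrow> real"
  assumes "\<And>n. s n \<in> borel_measurable borel" "f \<in> borel_measurable borel" "integrable lborel u"
    and "\<forall>\<^sub>F n in sequentially. \<forall>x. \<bar>s n x\<bar> \<le> u x" and "\<And>x. (\<lambda>n. s n x) \<longlonglongrightarrow> f x"
  shows "(\<lambda>n. LBINT x. s n x) \<longlonglongrightarrow> (LBINT x. f x)"
proof -
  obtain N where N: "\<And>n. n \<ge> N \<Longrightarrow> \<forall>x. \<bar>s n x\<bar> \<le> u x" using assms(4) by (auto simp: eventually_sequentially)
  have "(\<lambda>n. LBINT x. s (n + N) x) \<longlonglongrightarrow> (LBINT x. f x)"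
    by (rule integral_dominated_convergence[where w=u])
       (use assms N in \<open>auto intro!: LIMSEQ_ignore_initial_segment AE_I2\<close>)
  then show ?thesis by (rule LIMSEQ_offset)
qed

lemma gaussian_moments:
  "(LBINT z. exp (- ((z::real)\<^sup>2 / 2))) = sqrt (2 * pi)"
  "(LBINT z. (z::real) * exp (- (z\<^sup>2 / 2))) = 0"
  "(LBINT z. (z::real)\<^sup>2 * exp (- (z\<^sup>2 / 2))) = sqrt (2 * pi)"
  "(LBINT z. (z::real) ^ 3 * exp (- (z\<^sup>2 / 2))) = 0"
proof -
  have e: "y * exp (- (z\<^sup>2 / 2)) = sqrt (2 * pi) * (std_normal_density z * y)" for y z :: real
    by (simp add: std_normal_density_def)
  have e1: "exp (- (z\<^sup>2 / 2)) = sqrt (2 * pi) * std_normal_density z" for z :: real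
    by (simp add: std_normal_density_def)
  have m2: "(LBINT z. std_normal_density z * z\<^sup>2) = 1"
    using integral_std_normal_moment_even[of 1] by (simp add: fact_numeral)
  have m1: "(LBINT z. std_normal_density z * z) = 0" using integral_std_normal_moment_odd[of 0] by simp
  have m3: "(LBINT z. std_normal_density z * z ^ 3) = 0"
    using integral_std_normal_moment_odd[of 1] by (simp add: numeral_3_eq_3)
  show "(LBINT z. exp (- ((z::real)\<^sup>2 / 2))) = sqrt (2 * pi)" unfolding e1 by simp
  show "(LBINT z. (z::real) * exp (- (z\<^sup>2 / 2))) = 0" unfolding e integral_mult_right_zero m1 by simp
  show "(LBINT z. (z::real)\<^sup>2 * exp (- (z\<^sup>2 / 2))) = sqrt (2 * pi)" unfolding e integral_mult_right_zero m2 by simp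
  show "(LBINT z. (z::real) ^ 3 * exp (- (z\<^sup>2 / 2))) = 0" unfolding e integral_mult_right_zero m3 by simp
qed

context light_tailed_density
begin

lemma rescaled_moment:
  assumes "r > 0"
  shows "integrable lborel (\<lambda>z. z ^ j * (r * tilted t (b + r * z)))"
    and "(LBINT z. z ^ j * (r * tilted t (b + r * z))) = (LBINT y. (y - b) ^ j * tilted t y) / r ^ j"
proof -
  let ?F = "\<lambda>y. (y - b) ^ j * tilted t y"
  have eq: "z ^ j * (r * tilted t (b + r * z)) = r / r ^ j * ?F (b + r * z)" for z
    using assms by (simp add: power_mult_distrib)
  show "integrable lborel (\<lambda>z. z ^ j * (r * tilted t (b + r * z)))"
    unfolding eq using assms by (intro integrable_mult_right lborel_integrable_real_affine tilted_central_moments(1)) auto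
  have "(LBINT y. ?F y) = r * (LBINT z. ?F (b + r * z))"
    using lborel_integral_real_affine[of r ?F b] assms by simp
  then show "(LBINT z. z ^ j * (r * tilted t (b + r * z))) = (LBINT y. ?F y) / r ^ j"
    unfolding eq integral_mult_right_zero using assms by simp
qed

end

context laplace_sequence
begin

abbreviation "\<rho> n z \<equiv> \<sigma> n * tilted (h (x n)) (x n + \<sigma> n * z)"

definition "W n = (LBINT z. w n z)"

lemma w_moment_lim: "(\<lambda>n. LBINT z. z ^ j * w n z) \<longlonglongrightarrow> (LBINT z. z ^ j * exp (- (z\<^sup>2 / 2)))"
proof (rule dominated_convergence_eventually)
  show "integrable lborel (\<lambda>z. exp (B + 1/4) * (\<bar>z\<bar> ^ j * exp (- (1/4) * \<bar>z\<bar>)))"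
    by (intro integrable_mult_right integrable_power_exp_abs) simp
  show "\<forall>\<^sub>F n in sequentially. \<forall>z. \<bar>z ^ j * w n z\<bar> \<le> exp (B + 1/4) * (\<bar>z\<bar> ^ j * exp (- (1/4) * \<bar>z\<bar>))"
    using w_bounds
  proof eventually_elim
    case (elim n)
    show ?case
    proof
      fix z
      have w: "0 \<le> w n z" "w n z \<le> exp (B + 1/4) * exp (- (1/4) * \<bar>z\<bar>)" using elim by blast+
      have "\<bar>z\<bar> ^ j * w n z \<le> \<bar>z\<bar> ^ j * (exp (B + 1/4) * exp (- (1/4) * \<bar>z\<bar>))" using w by (intro mult_left_mono) auto
      then show "\<bar>z ^ j * w n z\<bar> \<le> exp (B + 1/4) * (\<bar>z\<bar> ^ j * exp (- (1/4) * \<bar>z\<bar>))"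
        using w(1) by (simp only: abs_mult power_abs abs_of_nonneg mult.left_commute)
    qed
  qed
  show "(\<lambda>n. z ^ j * w n z) \<longlonglongrightarrow> z ^ j * exp (- (z\<^sup>2 / 2))" for z
    by (intro tendsto_mult tendsto_const w_lim)
qed simp_all

lemma W_lim: "W \<longlonglongrightarrow> sqrt (2 * pi)"
  using w_moment_lim[of 0] unfolding W_def[abs_def] by (simp add: gaussian_moments)

lemma W_ev: "\<forall>\<^sub>F n in sequentially. 2 < W n \<and> W n < 3"
proof -
  have "2\<^sup>2 < 2 * pi" using pi_gt3 by simp
  then have "2 < sqrt (2 * pi)" by (rule real_less_rsqrt)
  moreover have "sqrt (2 * pi) < 3" using pi_less_4 by (intro real_less_lsqrt) auto
  ultimately have "\<forall>\<^sub>F n in sequentially. 2 < W n" "\<forall>\<^sub>F n in sequentially. W n < 3"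
    using order_tendstoD[OF W_lim] by auto
  then show ?thesis by eventually_elim simp
qed

text \<open>
  Both sides are proportional to \<open>exp (h (x n) * y) * p y\<close> at \<open>y = x n + \<sigma> n * z\<close> and have integral \<open>1\<close>.
\<close>
lemma rho_eq: "\<forall>\<^sub>F n in sequentially. \<forall>z. \<rho> n z = w n z / W n"
  using ev_pos W_ev
proof eventually_elim
  case (elim n)
  define c where "c = exp (g (x n) - h (x n) * x n) * expmom 0 (h (x n)) / \<sigma> n"
  have w: "w n z = c * \<rho> n z" for z
  proof -
    have "exp (g (x n) + h (x n) * \<sigma> n * z) = exp (g (x n) - h (x n) * x n) * exp (h (x n) * (x n + \<sigma> n * z))"
      by (simp add: exp_add[symmetric] algebra_simps)
    then show ?thesis using elim expmom_0_pos[of "h (x n)"] by (simp add: w_def c_def tilted_def)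
  qed
  have "W n = c"
    unfolding W_def w using rescaled_moment(2)[of "\<sigma> n" 0 "h (x n)" "x n"] elim tilted_integral by simp
  then show ?case using w elim by simp
qed

lemma rho_moment_lim:
  "(\<lambda>n. LBINT z. z ^ j * \<rho> n z) \<longlonglongrightarrow> (LBINT z. z ^ j * exp (- (z\<^sup>2 / 2))) / sqrt (2 * pi)"
proof -
  have "(\<lambda>n. (LBINT z. z ^ j * w n z) / W n) \<longlonglongrightarrow> (LBINT z. z ^ j * exp (- (z\<^sup>2 / 2))) / sqrt (2 * pi)"
    by (intro tendsto_divide w_moment_lim W_lim) simp
  then show ?thesis
  proof (rule Lim_transform_eventually)
    show "\<forall>\<^sub>F n in sequentially. (LBINT z. z ^ j * w n z) / W n = (LBINT z. z ^ j * \<rho> n z)"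
      using rho_eq
    proof eventually_elim
      case (elim n)
      then have eq: "z ^ j * \<rho> n z = (z ^ j * w n z) / W n" for z by simp
      show ?case unfolding eq by simp
    qed
  qed
qed

lemma tmean_lim: "(\<lambda>n. (tmean (h (x n)) - x n) / \<sigma> n) \<longlonglongrightarrow> 0"
proof -
  have "(\<lambda>n. LBINT z. z ^ 1 * \<rho> n z) \<longlonglongrightarrow> 0" using rho_moment_lim[of 1] by (simp add: gaussian_moments)
  then show ?thesis
    by (rule Lim_transform_eventually)
       (use ev_pos rescaled_moment(2)[where j=1] in \<open>auto elim!: eventually_mono simp: tilted_central_moments\<close>)
qed

lemma tvar_lim: "(\<lambda>n. tvar (h (x n)) / (\<sigma> n)\<^sup>2) \<longlonglongrightarrow> 1"
proof -
  have m: "(\<lambda>n. LBINT z. z\<^sup>2 * \<rho> n z) \<longlonglongrightarrow> 1" using rho_moment_lim[of 2] by (simp add: gaussian_moments)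
  have "(\<lambda>n. (LBINT z. z\<^sup>2 * \<rho> n z) - ((tmean (h (x n)) - x n) / \<sigma> n)\<^sup>2) \<longlonglongrightarrow> 1"
    by (rule tendsto_eq_rhs[where x="1 - 0\<^sup>2"]) (intro tendsto_diff m tendsto_power tmean_lim, simp_all)
  then show ?thesis
    by (rule Lim_transform_eventually)
       (use ev_pos rescaled_moment(2)[where j=2] in \<open>auto elim!: eventually_mono simp: tilted_central_moments add_divide_distrib power_divide\<close>)
qed

text \<open>
  About the saddle point the third moment tends to that of the normal law, and shifting the centre to the
  mean changes it by terms with the factor \<open>(tmean - x) / \<sigma>\<close>, which tends to \<open>0\<close>.
\<close>
lemma tthird_lim: "(\<lambda>n. tthird (h (x n)) / (\<sigma> n) ^ 3) \<longlonglongrightarrow> 0"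
proof -
  let ?b = "\<lambda>n. (tmean (h (x n)) - x n) / \<sigma> n"
  have m: "(\<lambda>n. LBINT z. z ^ 3 * \<rho> n z) \<longlonglongrightarrow> 0" using rho_moment_lim[of 3] by (simp add: gaussian_moments)
  have "(\<lambda>n. (LBINT z. z ^ 3 * \<rho> n z) - 3 * ?b n * (tvar (h (x n)) / (\<sigma> n)\<^sup>2) - ?b n ^ 3) \<longlonglongrightarrow> 0"
    by (rule tendsto_eq_rhs[where x="0 - 3 * 0 * 1 - 0 ^ 3"]) (intro tendsto_diff m tendsto_mult tendsto_const tendsto_power tmean_lim tvar_lim, simp_all)
  then show ?thesis
  proof (rule Lim_transform_eventually)
    show "\<forall>\<^sub>F n in sequentially. (LBINT z. z ^ 3 * \<rho> n z) - 3 * ?b n * (tvar (h (x n)) / (\<sigma> n)\<^sup>2) - ?b n ^ 3 = tthird (h (x n)) / (\<sigma> n) ^ 3"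
      using ev_pos
    proof eventually_elim
      case (elim n)
      have "(LBINT z. z ^ 3 * \<rho> n z) = tthird (h (x n)) / \<sigma> n ^ 3 + 3 * (tmean (h (x n)) - x n) * tvar (h (x n)) / \<sigma> n ^ 3
          + (tmean (h (x n)) - x n) ^ 3 / \<sigma> n ^ 3"
        using elim by (simp add: rescaled_moment(2)[where j=3] tilted_central_moments add_divide_distrib)
      moreover have "3 * (tmean (h (x n)) - x n) * tvar (h (x n)) / \<sigma> n ^ 3 = 3 * ?b n * (tvar (h (x n)) / (\<sigma> n)\<^sup>2)"
        by (simp add: power2_eq_square power3_eq_cube)
      moreover have "(tmean (h (x n)) - x n) ^ 3 / \<sigma> n ^ 3 = ?b n ^ 3" by (simp only: power_divide)
      ultimately show ?case by linarith
    qed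
  qed
qed

lemma sd_lim: "(\<lambda>n. sqrt (tvar (h (x n))) / \<sigma> n) \<longlonglongrightarrow> 1"
proof -
  have "(\<lambda>n. sqrt (tvar (h (x n)) / (\<sigma> n)\<^sup>2)) \<longlonglongrightarrow> sqrt 1" by (intro tendsto_real_sqrt tvar_lim)
  then have "(\<lambda>n. sqrt (tvar (h (x n)) / (\<sigma> n)\<^sup>2)) \<longlonglongrightarrow> 1" by simp
  then show ?thesis
    by (rule Lim_transform_eventually) (use ev_pos in \<open>auto elim!: eventually_mono simp: real_sqrt_divide\<close>)
qed

lemma skewness_lim: "(\<lambda>n. tthird (h (x n)) / sqrt (tvar (h (x n))) ^ 3) \<longlonglongrightarrow> 0"
proof -
  have "(\<lambda>n. (tthird (h (x n)) / (\<sigma> n) ^ 3) / (sqrt (tvar (h (x n))) / \<sigma> n) ^ 3) \<longlonglongrightarrow> 0"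
    by (rule tendsto_eq_rhs[where x="0 / 1 ^ 3"]) (intro tendsto_divide tthird_lim tendsto_power sd_lim, simp_all)
  then show ?thesis
    by (rule Lim_transform_eventually) (use ev_pos in \<open>auto elim!: eventually_mono simp: power_divide\<close>)
qed

text \<open>
  The variance is asymptotic to \<open>(\<sigma> n)\<^sup>2 = 1 / k (x n)\<close> and the mean to \<open>x n\<close>, so the quotient behaves like
  \<open>1 / (x n * k (x n))\<close>.
\<close>
lemma variance_mean_lim: "(\<lambda>n. tvar (h (x n)) / tmean (h (x n))) \<longlonglongrightarrow> 0"
proof -
  let ?b = "\<lambda>n. (tmean (h (x n)) - x n) / \<sigma> n"
  have s: "(\<lambda>n. 1 / (x n * k (x n))) \<longlonglongrightarrow> 0"
    by (intro tendsto_divide_0[OF tendsto_const] filterlim_at_top_imp_at_infinity xk_top)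
  have m: "(\<lambda>n. 1 + ?b n * (\<sigma> n * 1 / x n)) \<longlonglongrightarrow> 1"
    by (rule tendsto_eq_rhs[where x="1 + 0 * 0"]) (intro tendsto_add tendsto_const tendsto_mult tmean_lim sigma_x, simp_all)
  have "(\<lambda>n. (tvar (h (x n)) / (\<sigma> n)\<^sup>2) * (1 / (x n * k (x n))) / (1 + ?b n * (\<sigma> n * 1 / x n))) \<longlonglongrightarrow> 0"
    by (rule tendsto_eq_rhs[where x="1 * 0 / 1"]) (intro tendsto_divide tendsto_mult tvar_lim s m, simp_all)
  then show ?thesis
  proof (rule Lim_transform_eventually)
    show "\<forall>\<^sub>F n in sequentially. (tvar (h (x n)) / (\<sigma> n)\<^sup>2) * (1 / (x n * k (x n))) / (1 + ?b n * (\<sigma> n * 1 / x n))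
        = tvar (h (x n)) / tmean (h (x n))"
      using ev_pos
    proof eventually_elim
      case (elim n)
      have "1 + ?b n * (\<sigma> n * 1 / x n) = tmean (h (x n)) / x n" using elim by (simp add: field_simps)
      moreover have "(\<sigma> n)\<^sup>2 = 1 / k (x n)" using elim by (simp add: \<sigma>_def power_divide)
      ultimately show ?case using elim by simp
    qed
  qed
qed

text \<open>
  Standardizing by mean and standard deviation replaces \<open>z\<close> by \<open>b + c * z\<close> with \<open>b \<rightarrow> 0\<close> and \<open>c \<rightarrow> 1\<close>. Once
  \<open>\<bar>b\<bar> < 1/2\<close> and \<open>1/2 < c < 3/2\<close>, the envelope survives with half the exponent and a factor \<open>exp (1/8)\<close>, and
  \<open>[-1, 1]\<close> is mapped into \<open>[-2, 2]\<close>, where \<open>w\<close> is bounded below.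
\<close>
lemma standardized_tilted:
  "\<forall>\<^sub>F n in sequentially. standardized_density
     (\<lambda>z. sqrt (tvar (h (x n))) * tilted (h (x n)) (tmean (h (x n)) + sqrt (tvar (h (x n))) * z))
     (2 * exp (B + 1/4 + 1/8)) (1/8) (exp (- B - 3) / 6)"
proof -
  have c1: "\<forall>\<^sub>F n in sequentially. sqrt (tvar (h (x n))) / \<sigma> n > 1/2" by (rule order_tendstoD[OF sd_lim]) simp
  have c2: "\<forall>\<^sub>F n in sequentially. sqrt (tvar (h (x n))) / \<sigma> n < 3/2" by (rule order_tendstoD[OF sd_lim]) simp
  have b1: "\<forall>\<^sub>F n in sequentially. (tmean (h (x n)) - x n) / \<sigma> n > -1/2" by (rule order_tendstoD[OF tmean_lim]) simp
  have b2: "\<forall>\<^sub>F n in sequentially. (tmean (h (x n)) - x n) / \<sigma> n < 1/2" by (rule order_tendstoD[OF tmean_lim]) simp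
  show ?thesis
    using ev_pos W_ev rho_eq w_bounds c1 c2 b1 b2
  proof eventually_elim
    case (elim n)
    define s a t where "s = sqrt (tvar (h (x n)))" and "a = tmean (h (x n))" and "t = h (x n)"
    define c b where "c = s / \<sigma> n" and "b = (a - x n) / \<sigma> n"
    have sg: "\<sigma> n > 0" and W2: "2 < W n" "W n < 3" using elim by auto
    have c: "1/2 < c" "c < 3/2" using elim by (simp_all only: c_def s_def)
    have "- 1/2 < b" "b < 1/2" using elim by (simp_all only: b_def a_def)
    then have b: "\<bar>b\<bar> < 1/2" by linarith
    have s0: "s > 0" using tvar_pos[of t] by (simp add: s_def t_def)
    have f_eq: "s * tilted t (a + s * z) = c * (w n (b + c * z) / W n)" for z
    proof -
      have e1: "a + s * z = x n + \<sigma> n * (b + c * z)" using sg by (simp add: b_def c_def field_simps)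
      have e2: "s = c * \<sigma> n" using sg by (simp add: c_def)
      have e3: "\<sigma> n * tilted t (x n + \<sigma> n * (b + c * z)) = w n (b + c * z) / W n" using elim by (simp add: t_def)
      show ?thesis unfolding e1 e3[symmetric] using e2 by simp
    qed
    have w0: "0 \<le> w n z" and wu: "w n z \<le> exp (B + 1/4) * exp (- (1/4) * \<bar>z\<bar>)" for z using elim by blast+
    have wl: "\<bar>z\<bar> \<le> 2 \<Longrightarrow> exp (- B - 3) \<le> w n z" for z using elim by blast
    have up: "s * tilted t (a + s * z) \<le> (2 * exp (B + 1/4 + 1/8)) * exp (- (1/8) * \<bar>z\<bar>)" for z
    proof -
      have bcz: "c * \<bar>z\<bar> - \<bar>b\<bar> \<le> \<bar>b + c * z\<bar>" 
      proof -
        have "\<bar>c * z\<bar> = c * \<bar>z\<bar>" using c by (simp add: abs_mult)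
        then show ?thesis by linarith
      qed
      have "1/2 * \<bar>z\<bar> - 1/2 \<le> c * \<bar>z\<bar> - \<bar>b\<bar>" using c b by (intro diff_mono mult_right_mono) auto
      from order_trans[OF this bcz] have "- (1/4) * \<bar>b + c * z\<bar> \<le> 1/8 + - (1/8) * \<bar>z\<bar>" by simp
      then have "exp (- (1/4) * \<bar>b + c * z\<bar>) \<le> exp (1/8 + - (1/8) * \<bar>z\<bar>)" by simp
      then have w: "w n (b + c * z) \<le> exp (B + 1/4) * exp (1/8 + - (1/8) * \<bar>z\<bar>)"
        by (intro order_trans[OF wu] mult_left_mono) auto
      have "w n (b + c * z) / W n \<le> w n (b + c * z)" using W2 w0[of "b + c * z"] by (simp add: pos_divide_le_eq mult_le_cancel_left1)
      then have "c * (w n (b + c * z) / W n) \<le> 2 * (exp (B + 1/4) * exp (1/8 + - (1/8) * \<bar>z\<bar>))"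
        using c w W2 w0[of "b + c * z"] by (intro mult_mono) auto
      also have "\<dots> = (2 * exp (B + 1/4 + 1/8)) * exp (- (1/8) * \<bar>z\<bar>)" by (simp only: exp_add mult.assoc)
      finally show ?thesis unfolding f_eq .
    qed
    have lo: "exp (- B - 3) / 6 \<le> s * tilted t (a + s * z)" if z: "\<bar>z\<bar> \<le> 1" for z
    proof -
      have "\<bar>c * z\<bar> \<le> 3/2 * 1" unfolding abs_mult using c z by (intro mult_mono) auto
      then have "\<bar>b + c * z\<bar> \<le> 2" using b by linarith
      then have "exp (- B - 3) / 3 \<le> w n (b + c * z) / W n" using W2 wl w0 by (intro frac_le) auto
      then have "1/2 * (exp (- B - 3) / 3) \<le> c * (w n (b + c * z) / W n)" using c by (intro mult_mono) auto
      then show ?thesis unfolding f_eq by simp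
    qed
    note m = rescaled_moment[OF s0, where t=t and b=a]
    have s2: "s\<^sup>2 = tvar t" using tvar_pos[of t] by (simp add: s_def t_def)
    have a: "a = tmean t" by (simp add: a_def t_def)
    have "standardized_density (\<lambda>z. s * tilted t (a + s * z)) (2 * exp (B + 1/4 + 1/8)) (1/8) (exp (- B - 3) / 6)"
    proof
      show "(\<lambda>z. s * tilted t (a + s * z)) \<in> borel_measurable borel" by simp
      show "0 \<le> s * tilted t (a + s * z)" for z using s0 by (simp add: tilted_nonneg)
      show "s * tilted t (a + s * z) \<le> 2 * exp (B + 1/4 + 1/8)" for z
      proof (rule order_trans[OF up])
        show "2 * exp (B + 1/4 + 1/8) * exp (- (1/8) * \<bar>z\<bar>) \<le> 2 * exp (B + 1/4 + 1/8)" by (rule mult_left_le) auto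
      qed
      show "integrable lborel (\<lambda>z. s * tilted t (a + s * z))" using m(1)[of 0] by simp
      show "(LBINT z. s * tilted t (a + s * z)) = 1" using m(2)[of 0] tilted_integral by simp
      show "(LBINT z. z * (s * tilted t (a + s * z))) = 0"
        using m(2)[of 1] tilted_central_moments(2)[of a t] by (simp add: a)
      show "(LBINT z. z\<^sup>2 * (s * tilted t (a + s * z))) = 1"
        using m(2)[of 2] tilted_central_moments(3)[of a t] tvar_pos[of t] by (simp add: a s2)
    qed (use up lo in auto)
    then show ?case by (simp only: s_def a_def t_def)
  qed
qed

end

section \<open>The conditional density as a ratio of convolution powers\<close>

lemma sum_density_measurable [measurable]:
  assumes [measurable]: "f \<in> borel_measurable borel"
  shows "sum_density f n \<in> borel_measurable borel"
proof (induction n)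
  case (Suc n)
  note [measurable] = Suc
  show ?case
  proof (cases "n = 0")
    case False
    then have "sum_density f (Suc n) = (\<lambda>x. \<integral>\<^sup>+y. ennreal (f (x - y)) * sum_density f n y \<partial>lborel)"
      by (intro sum_density_Suc) simp
    then show ?thesis by simp
  qed simp
qed simp

text \<open>
  Tilting commutes with convolution, since the exponential factors multiply to \<open>exp (t * w)\<close>; the affine
  normalization of the summands is undone at the level of the sum.
\<close>
lemma (in light_tailed_density) sum_density_tilt:
  assumes s: "s > 0" and n: "n \<ge> 1"
  shows "sum_density p n w = ennreal (expmom 0 t ^ n * exp (- t * w) / s)
     * sum_density (\<lambda>z. s * tilted t (a + s * z)) n ((w - real n * a) / s)"
  using n
proof (induction n arbitrary: w rule: dec_induct)
  case base
  have "p w = expmom 0 t ^ 1 * exp (- t * w) / s * (s * tilted t (a + s * ((w - real 1 * a) / s)))"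
    using s expmom_0_pos[of t] by (simp add: tilted_def exp_minus)
  then show ?case using s expmom_0_pos[of t] by (simp add: ennreal_mult'[symmetric] tilted_nonneg)
next
  case (step n)
  let ?f = "\<lambda>z. s * tilted t (a + s * z)" and ?F = "expmom 0 t"
  have F: "?F > 0" by (rule expmom_0_pos)
  let ?c = "?F ^ Suc n * exp (- t * w) / (s * s)"
  let ?u = "(w - real (Suc n) * a) / s"
  have "sum_density p (Suc n) w = (\<integral>\<^sup>+y. ennreal (p (w - y)) * sum_density p n y \<partial>lborel)"
    using step by (simp add: sum_density_Suc)
  also have "\<dots> = ennreal s * (\<integral>\<^sup>+v. ennreal (p (w - (real n * a + s * v))) * sum_density p n (real n * a + s * v) \<partial>lborel)"
    using s by (subst nn_integral_real_affine[where c=s and t="real n * a"]) auto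
  also have "(\<lambda>v. ennreal (p (w - (real n * a + s * v))) * sum_density p n (real n * a + s * v))
      = (\<lambda>v. ennreal ?c * (ennreal (?f (?u - v)) * sum_density ?f n v))"
  proof
    fix v
    have "a + s * (?u - v) = w - (real n * a + s * v)" using s by (simp add: field_simps)
    then have 1: "p (w - (real n * a + s * v)) = ?F * exp (- t * (w - (real n * a + s * v))) / s * ?f (?u - v)"
      using s F by (simp add: tilted_def exp_minus)
    have 2: "sum_density p n (real n * a + s * v) = ennreal (?F ^ n * exp (- t * (real n * a + s * v)) / s) * sum_density ?f n v"
      using step.IH[of "real n * a + s * v"] s by simp
    have e: "exp (- t * (w - (real n * a + s * v))) * exp (- t * (real n * a + s * v)) = exp (- t * w)"
      unfolding exp_add[symmetric] by (simp add: algebra_simps)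
    have 3: "?F * exp (- t * (w - (real n * a + s * v))) / s * (?F ^ n * exp (- t * (real n * a + s * v)) / s) = ?c"
      unfolding e[symmetric] by simp
    have "ennreal (p (w - (real n * a + s * v))) * sum_density p n (real n * a + s * v) =
      (ennreal (?F * exp (- t * (w - (real n * a + s * v))) / s) * ennreal (?F ^ n * exp (- t * (real n * a + s * v)) / s))
        * (ennreal (?f (?u - v)) * sum_density ?f n v)"
      unfolding 1 2 using s F by (subst ennreal_mult) (auto simp: tilted_nonneg mult_ac)
    also have "ennreal (?F * exp (- t * (w - (real n * a + s * v))) / s) * ennreal (?F ^ n * exp (- t * (real n * a + s * v)) / s) = ennreal ?c"
      unfolding 3[symmetric] using s F by (subst ennreal_mult) auto
    finally show "ennreal (p (w - (real n * a + s * v))) * sum_density p n (real n * a + s * v) =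
      ennreal ?c * (ennreal (?f (?u - v)) * sum_density ?f n v)" .
  qed
  also have "(\<integral>\<^sup>+v. ennreal ?c * (ennreal (?f (?u - v)) * sum_density ?f n v) \<partial>lborel)
      = ennreal ?c * sum_density ?f (Suc n) ?u"
    using step by (subst nn_integral_cmult) (auto simp: sum_density_Suc)
  also have "ennreal s * (ennreal ?c * sum_density ?f (Suc n) ?u) = ennreal (?F ^ Suc n * exp (- t * w) / s) * sum_density ?f (Suc n) ?u"
    using s F by (simp add: mult.assoc[symmetric] ennreal_mult[symmetric])
  finally show ?case .
qed

text \<open>
  In the quotient of the two convolution powers all exponential factors but \<open>exp (t * y) / \<Phi>(t)\<close> cancel, and
  that factor turns \<open>p y\<close> into the tilted density.
\<close>
lemma (in light_tailed_density) cond_density_tilt: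
  fixes s a t :: real
  assumes s: "s > 0" and n: "n \<ge> 2"
  defines "f \<equiv> \<lambda>z. s * tilted t (a + s * z)"
  shows "cond_density p n (real n * a) y =
    tilted t y * (enn2real (sum_density f (n - 1) ((a - y) / s)) / enn2real (sum_density f n 0))"
proof -
  let ?F = "expmom 0 t"
  have F: "?F > 0" by (rule expmom_0_pos)
  have arg: "real n * a - y - real (n - 1) * a = a - y" using n by (simp add: algebra_simps of_nat_diff)
  have 1: "enn2real (sum_density p (n - 1) (real n * a - y)) =
      ?F ^ (n - 1) * exp (- t * (real n * a - y)) / s * enn2real (sum_density f (n - 1) ((a - y) / s))"
    using sum_density_tilt[OF s, of "n - 1" "real n * a - y" t a] n s F unfolding arg f_def
    by (simp add: enn2real_mult)
  have 2: "enn2real (sum_density p n (real n * a)) = ?F ^ n * exp (- t * (real n * a)) / s * enn2real (sum_density f n 0)"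
    using sum_density_tilt[OF s, of n "real n * a" t a] n s F unfolding f_def by (simp add: enn2real_mult)
  have Fn: "?F ^ n = ?F * ?F ^ (n - 1)" using n by (cases n) auto
  have e: "exp (- t * (real n * a - y)) = exp (- t * (real n * a)) * exp (t * y)"
    unfolding exp_add[symmetric] by (simp add: algebra_simps)
  show ?thesis unfolding cond_density_def 1 2 Fn e tilted_def using s F by simp
qed

text \<open>
  With \<open>q\<^sub>k = sqrt (2 * pi * k)\<close>, the local limit theorem makes \<open>q\<^sub>k * S\<^sub>k x\<close> equal to \<open>exp (- x\<^sup>2 / (2 * k))\<close> up to
  \<open>o(1 / sqrt n)\<close> for \<open>k = n\<close> and \<open>k = n - 1\<close>. The quotient then differs from \<open>1\<close> by these errors, by
  \<open>q\<^sub>n / q\<^sub>n\<^sub>-\<^sub>1 - 1 = O(1 / n)\<close>, and by \<open>x\<^sup>2 / n\<close> from the Gaussian factor. All constants depend on the common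
  parameters only, so they may be read off any single member of the sequence.
\<close>
lemma local_limit_ratio:
  fixes f :: "nat \<Rightarrow> real \<Rightarrow> real"
  assumes std: "\<forall>\<^sub>F n in sequentially. standardized_density (f n) A c \<kappa>"
    and skewness: "(\<lambda>n. LBINT z. z ^ 3 * f n z) \<longlonglongrightarrow> 0"
  obtains D where "D \<longlonglongrightarrow> 0"
    and "\<forall>\<^sub>F n in sequentially. enn2real (sum_density (f n) n 0) > 0 \<and>
      (\<forall>x. \<bar>enn2real (sum_density (f n) (n - 1) x) / enn2real (sum_density (f n) n 0) - 1\<bar>
          \<le> (D n + (8 + 2 * x\<^sup>2) / sqrt (real n)) / sqrt (real n) \<and>
        enn2real (sum_density (f n) (n - 1) x) / enn2real (sum_density (f n) n 0) \<le> 2)"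
proof -
  obtain N where N: "standardized_density (f N) A c \<kappa>"
    using std unfolding eventually_sequentially by blast
  interpret N: standardized_density "f N" A c \<kappa> by (rule N)
  define C r where "C = N.clt_const" and "r = N.decay"
  have C: "0 \<le> C" and r: "0 < r" "r < 1"
    using N.clt_const_nonneg N.decay by (auto simp: C_def r_def)
  define m where "m n = \<bar>\<integral>z. z ^ 3 * f n z \<partial>lborel\<bar>" for n
  \<comment> \<open>The factor \<open>2\<close> covers \<open>k = n - 1\<close>, where \<open>n \<le> 2 * k\<close>.\<close>
  define T where "T n k = 2 * C * sqrt (2 * pi) * (m n + 1 / sqrt (real k) + real k * r ^ k)" for n k :: nat
  have m0: "0 \<le> m n" for n by (simp add: m_def)
  have T0: "0 \<le> T n k" for n k using C r m0[of n] by (simp add: T_def)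
  have m_lim: "m \<longlonglongrightarrow> 0" unfolding m_def[abs_def] by (rule tendsto_rabs_zero[OF skewness])
  have kr: "(\<lambda>k. real k * r ^ k) \<longlonglongrightarrow> 0" using r powser_times_n_limit_0[of r] by simp
  have ks: "(\<lambda>k. 1 / sqrt (real k)) \<longlonglongrightarrow> 0"
    by (intro tendsto_divide_0[OF tendsto_const] filterlim_at_top_imp_at_infinity filterlim_compose[OF sqrt_at_top] filterlim_real_sequentially)
  have pred: "filterlim (\<lambda>n::nat. n - 1) sequentially sequentially" by (rule filterlim_minus_const_nat_at_top)
  have T1: "(\<lambda>n. T n n) \<longlonglongrightarrow> 0"
  proof -
    have "(\<lambda>n. T n n) \<longlonglongrightarrow> 2 * C * sqrt (2 * pi) * (0 + 0 + 0)"
      unfolding T_def by (intro tendsto_mult tendsto_const tendsto_add m_lim ks kr)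
    then show ?thesis by simp
  qed
  have T2: "(\<lambda>n. T n (n - 1)) \<longlonglongrightarrow> 0"
  proof -
    have "(\<lambda>n. T n (n - 1)) \<longlonglongrightarrow> 2 * C * sqrt (2 * pi) * (0 + 0 + 0)"
      unfolding T_def by (intro tendsto_mult tendsto_const tendsto_add m_lim filterlim_compose[OF ks pred] filterlim_compose[OF kr pred])
    then show ?thesis by simp
  qed
  define D where "D n = 2 * T n n + 2 * T n (n - 1)" for n
  have D_lim: "D \<longlonglongrightarrow> 0"
  proof -
    have "(\<lambda>n. 2 * T n n + 2 * T n (n - 1)) \<longlonglongrightarrow> 2 * 0 + 2 * 0" by (intro tendsto_add tendsto_mult tendsto_const T1 T2)
    then show ?thesis unfolding D_def[abs_def] by simp
  qed
  have est: "\<bar>sqrt (2 * pi * real k) * enn2real (sum_density (f n) k x) - exp (- (x\<^sup>2 / (2 * real k)))\<bar> \<le> T n k / sqrt (real n)"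
    if n: "standardized_density (f n) A c \<kappa>" "m n \<le> 1" and k: "3 \<le> k" "k \<le> n" "n \<le> 2 * k" for n k x
  proof -
    interpret F: standardized_density "f n" A c \<kappa> by (rule n(1))
    have mF: "\<bar>F.skew\<bar> = m n" by (simp add: F.skew_def m_def)
    let ?S = "enn2real (sum_density (f n) k x)" and ?q = "sqrt (2 * pi * real k)"
    have q: "?q > 0" using k by simp
    have "\<bar>?S - exp (- (x\<^sup>2 / (2 * real k))) / ?q\<bar> \<le> C * (m n / real k + 1 / (real k * sqrt (real k)) + r ^ k)"
      using F.local_limit_estimate[of k x] n k unfolding mF C_def r_def by simp
    also have "\<dots> = C * ((m n + 1 / sqrt (real k) + real k * r ^ k) / real k)" using k by (simp add: add_divide_distrib)
    finally have "?q * \<bar>?S - exp (- (x\<^sup>2 / (2 * real k))) / ?q\<bar> \<le> ?q * (C * ((m n + 1 / sqrt (real k) + real k * r ^ k) / real k))"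
      using q by (intro mult_left_mono) auto
    moreover have "?q * \<bar>?S - exp (- (x\<^sup>2 / (2 * real k))) / ?q\<bar> = \<bar>?q * ?S - exp (- (x\<^sup>2 / (2 * real k)))\<bar>"
    proof -
      have "?q * \<bar>?S - exp (- (x\<^sup>2 / (2 * real k))) / ?q\<bar> = \<bar>?q * (?S - exp (- (x\<^sup>2 / (2 * real k))) / ?q)\<bar>"
        using q by (simp add: abs_mult)
      then show ?thesis using q k by (simp add: right_diff_distrib)
    qed
    moreover have "?q * (C * ((m n + 1 / sqrt (real k) + real k * r ^ k) / real k)) \<le> T n k / sqrt (real n)"
    proof -
      have "sqrt (real k) * sqrt (real n) \<le> 2 * real k"
      proof -
        have "sqrt (real k) * sqrt (real n) = sqrt (real k * real n)" by (simp add: real_sqrt_mult)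
        also have "\<dots> \<le> sqrt ((2 * real k)\<^sup>2)"
        proof (rule real_sqrt_le_mono)
          have "real k * real n \<le> real k * (2 * real k)" using k by (intro mult_left_mono) auto
          also have "\<dots> \<le> (2 * real k)\<^sup>2" by (simp add: power2_eq_square)
          finally show "real k * real n \<le> (2 * real k)\<^sup>2" .
        qed
        also have "\<dots> = 2 * real k" by (subst real_sqrt_abs) simp
        finally show ?thesis .
      qed
      then have "sqrt (real k) / real k \<le> 2 / sqrt (real n)" using k by (simp add: field_simps)
      moreover define Q where "Q = m n + 1 / sqrt (real k) + real k * r ^ k"
      moreover have "0 \<le> Q" using r m0[of n] by (simp add: Q_def)
      ultimately have "sqrt (real k) / real k * (sqrt (2 * pi) * (C * Q)) \<le> 2 / sqrt (real n) * (sqrt (2 * pi) * (C * Q))"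
        using C by (intro mult_right_mono) auto
      then show ?thesis unfolding T_def Q_def[symmetric] by (simp add: real_sqrt_mult mult_ac)
    qed
    ultimately show ?thesis by linarith
  qed
  have ev1: "\<forall>\<^sub>F n in sequentially. m n \<le> 1" using order_tendstoD(2)[OF m_lim, of 1] by (auto elim: eventually_mono)
  have ev2: "\<forall>\<^sub>F n in sequentially. T n n < 1/8" by (rule order_tendstoD[OF T1]) simp
  have ev3: "\<forall>\<^sub>F n in sequentially. T n (n - 1) < 1/8" by (rule order_tendstoD[OF T2]) simp
  show thesis
  proof (rule that[of "\<lambda>n. 2 * D n"])
    show "(\<lambda>n. 2 * D n) \<longlonglongrightarrow> 0" using tendsto_mult_right_zero[OF D_lim, of 2] .
    show "\<forall>\<^sub>F n in sequentially. enn2real (sum_density (f n) n 0) > 0 \<and>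
      (\<forall>x. \<bar>enn2real (sum_density (f n) (n - 1) x) / enn2real (sum_density (f n) n 0) - 1\<bar>
          \<le> (2 * D n + (8 + 2 * x\<^sup>2) / sqrt (real n)) / sqrt (real n) \<and>
        enn2real (sum_density (f n) (n - 1) x) / enn2real (sum_density (f n) n 0) \<le> 2)"
      using std ev1 ev2 ev3 eventually_ge_at_top[of 5]
    proof eventually_elim
      case (elim n)
      let ?Z = "enn2real (sum_density (f n) n 0)" and ?S = "\<lambda>x. enn2real (sum_density (f n) (n - 1) x)"
      define q0 q1 where "q0 = sqrt (2 * pi * real n)" and "q1 = sqrt (2 * pi * real (n - 1))"
      define u where "u = q0 / q1"
      define t0 where "t0 = q0 * ?Z - 1"
      have n5: "n \<ge> 5" by (rule elim)
      have rn: "sqrt (real n) \<ge> 1" "sqrt (real n) > 0" using n5 by auto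
      have q: "q0 > 0" "q1 > 0" using n5 by (auto simp: q0_def q1_def)
      have t0: "\<bar>t0\<bar> \<le> T n n / sqrt (real n)"
        using est[of n n 0] elim by (simp add: t0_def q0_def)
      have small: "T n k / sqrt (real n) \<le> T n k" for k
        using T0[of n k] rn by (simp add: pos_divide_le_eq mult_le_cancel_left1)
      have t0': "\<bar>t0\<bar> \<le> 1/8" using t0 small[of n] elim by linarith
      have S0: "q0 * ?Z = 1 + t0" by (simp add: t0_def)
      have "0 < q0 * ?Z" unfolding S0 using t0' by linarith
      then have S0pos: "?Z > 0" using q by (simp add: zero_less_mult_iff)
      have u: "1 \<le> u" "u \<le> 1 + 2 / real n" "u \<le> 5/4"
      proof -
        have n1: "real (n - 1) = real n - 1" using n5 by simp
        have uu: "u = sqrt (real n / (real n - 1))"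
          using n5 unfolding u_def q0_def q1_def n1 by (simp add: real_sqrt_divide[symmetric])
        have quot: "real n / (real n - 1) = 1 + 1 / (real n - 1)" using n5 by (simp add: field_simps)
        define v where "v = 1 / (real n - 1)"
        have v: "v \<le> 2 / real n" "v \<le> 1/4" "0 \<le> v" using n5 by (auto simp: v_def field_simps)
        have "sqrt (1 + v) \<le> 1 + v"
          using v(3) by (intro real_le_lsqrt) (auto simp: power2_eq_square algebra_simps)
        moreover have "1 \<le> sqrt (1 + v)" using v(3) by simp
        ultimately show "1 \<le> u" "u \<le> 1 + 2 / real n" "u \<le> 5/4"
          unfolding uu quot v_def[symmetric] using v by linarith+
      qed
      have main: "\<bar>?S x / ?Z - 1\<bar> \<le> (2 * D n + (8 + 2 * x\<^sup>2) / sqrt (real n)) / sqrt (real n) \<and> ?S x / ?Z \<le> 2" for x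
      proof -
        define e where "e = exp (- (x\<^sup>2 / (2 * real (n - 1))))"
        define t1 where "t1 = q1 * ?S x - e"
        have e: "0 < e" "e \<le> 1" by (auto simp: e_def)
        have t1: "\<bar>t1\<bar> \<le> T n (n - 1) / sqrt (real n)"
          using est[of n "n - 1" x] elim by (simp add: t1_def q1_def e_def)
        have t1': "\<bar>t1\<bar> \<le> 1/8" using t1 small[of "n - 1"] elim by linarith
        have ratio: "?S x / ?Z = u * (e + t1) / (1 + t0)"
          unfolding S0[symmetric] t1_def u_def using q S0pos by simp
        have d: "1 + t0 \<ge> 7/8" using t0' by linarith
        have e1: "\<bar>e - 1\<bar> \<le> x\<^sup>2 / real n"
        proof -
          have "x\<^sup>2 / (2 * real (n - 1)) \<le> x\<^sup>2 / real n" using n5 by (intro divide_left_mono) auto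
          then have "1 - x\<^sup>2 / real n \<le> 1 - x\<^sup>2 / (2 * real (n - 1))" by (rule diff_left_mono)
          also have "\<dots> \<le> e" unfolding e_def using exp_ge_add_one_self[of "- (x\<^sup>2 / (2 * real (n - 1)))"] by simp
          finally show ?thesis using e by (simp add: abs_if)
        qed
        have "?S x / ?Z - 1 = ((u - 1) * (e + t1) + (e - 1) + t1 - t0) / (1 + t0)"
          unfolding ratio using d by (simp add: field_simps)
        then have "\<bar>?S x / ?Z - 1\<bar> = \<bar>(u - 1) * (e + t1) + (e - 1) + t1 - t0\<bar> / (1 + t0)"
          using d by (simp add: abs_divide)
        also have "\<dots> \<le> \<bar>(u - 1) * (e + t1) + (e - 1) + t1 - t0\<bar> / (1/2)"
          using d by (intro divide_left_mono) auto
        also have "\<dots> \<le> 2 * (2 / real n * 2 + x\<^sup>2 / real n + T n (n - 1) / sqrt (real n) + T n n / sqrt (real n))"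
        proof -
          have X: "\<bar>(u - 1) * (e + t1)\<bar> \<le> 2 / real n * 2"
            unfolding abs_mult using u e t1' by (intro mult_mono) auto
          have "\<bar>X + Y + Z - V\<bar> / (1/2) \<le> 2 * (bX + bY + bZ + bV)"
            if "\<bar>X\<bar> \<le> bX" "\<bar>Y\<bar> \<le> bY" "\<bar>Z\<bar> \<le> bZ" "\<bar>V\<bar> \<le> bV" for X Y Z V bX bY bZ bV :: real
          proof -
            have "\<bar>X + Y + Z - V\<bar> \<le> bX + bY + bZ + bV" using that by linarith
            then show ?thesis by simp
          qed
          from this[OF X e1 t1 t0] show ?thesis .
        qed
        also have "\<dots> = (2 * T n n + 2 * T n (n - 1) + (8 + 2 * x\<^sup>2) / sqrt (real n)) / sqrt (real n)"
        proof -
          have "real n = sqrt (real n) * sqrt (real n)" by simp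
          then have "(8 + 2 * x\<^sup>2) / sqrt (real n) / sqrt (real n) = (8 + 2 * x\<^sup>2) / real n" by (metis divide_divide_eq_left)
          then show ?thesis by (simp add: add_divide_distrib)
        qed
        also have "\<dots> \<le> (2 * D n + (8 + 2 * x\<^sup>2) / sqrt (real n)) / sqrt (real n)"
          using T0[of n n] T0[of n "n - 1"] rn by (intro divide_right_mono add_right_mono) (auto simp: D_def)
        finally have 1: "\<bar>?S x / ?Z - 1\<bar> \<le> (2 * D n + (8 + 2 * x\<^sup>2) / sqrt (real n)) / sqrt (real n)" .
        have "e + t1 \<le> 9/8" using e t1' by linarith
        then have "u * (e + t1) \<le> u * (9/8)" using u by (intro mult_left_mono) auto
        also have "\<dots> \<le> 5/4 * (9/8)" using u by simp
        finally have "u * (e + t1) \<le> 5/4 * (9/8)" .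
        then have "?S x / ?Z \<le> 2" unfolding ratio using d by (simp add: pos_divide_le_eq)
        with 1 show ?thesis by blast
      qed
      then show ?case using S0pos by blast
    qed
  qed
qed

text \<open>
  Chebyshev's inequality for the tilted law, whose density dominates that of the conditional law up to the
  factor \<open>2\<close>.
\<close>
lemma (in light_tailed_density) cond_law_tail:
  assumes s: "s = sqrt (tvar t)" and K: "K > 0" and a: "a = tmean t"
    and le: "\<And>y. cond_density p n w y \<le> 2 * tilted t y" and A: "A \<subseteq> {y. \<bar>y - a\<bar> > K * s}"
  shows "measure (cond_law p n w) A \<le> 2 / K\<^sup>2"
proof -
  have s0: "s > 0" and s2: "s\<^sup>2 = tvar t" using tvar_pos[of t] by (auto simp: s)
  let ?T = "{y. \<bar>y - a\<bar> > K * s}"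
  have [measurable]: "cond_density p n w \<in> borel_measurable borel" unfolding cond_density_def[abs_def] by measurable
  have "emeasure (cond_law p n w) A \<le> emeasure (cond_law p n w) ?T" by (intro emeasure_mono A) (simp add: cond_law_def)
  also have "\<dots> = (\<integral>\<^sup>+y. ennreal (cond_density p n w y) * indicator ?T y \<partial>lborel)"
    unfolding cond_law_def by (subst emeasure_density) auto
  also have "\<dots> \<le> (\<integral>\<^sup>+y. ennreal (2 / (K * s)\<^sup>2 * ((y - a)\<^sup>2 * tilted t y)) \<partial>lborel)"
  proof (rule nn_integral_mono)
    fix y
    show "ennreal (cond_density p n w y) * indicator ?T y \<le> ennreal (2 / (K * s)\<^sup>2 * ((y - a)\<^sup>2 * tilted t y))"
    proof (cases "y \<in> ?T")
      case True
      have "(K * s)\<^sup>2 \<le> \<bar>y - a\<bar>\<^sup>2" using True K s0 by (intro power_mono) auto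
      then have "1 \<le> (y - a)\<^sup>2 / (K * s)\<^sup>2" using K s0 by (simp add: pos_le_divide_eq)
      then have "2 * tilted t y * 1 \<le> 2 * tilted t y * ((y - a)\<^sup>2 / (K * s)\<^sup>2)" using tilted_nonneg by (intro mult_left_mono) auto
      then have "cond_density p n w y \<le> 2 / (K * s)\<^sup>2 * ((y - a)\<^sup>2 * tilted t y)" using le[of y] by (simp add: mult_ac)
      then show ?thesis using True by (simp add: ennreal_leI)
    qed simp
  qed
  also have "\<dots> = ennreal (LBINT y. 2 / (K * s)\<^sup>2 * ((y - a)\<^sup>2 * tilted t y))"
    by (intro nn_integral_eq_integral integrable_mult_right tilted_central_moments(1)) (auto simp: tilted_nonneg)
  also have "(LBINT y. 2 / (K * s)\<^sup>2 * ((y - a)\<^sup>2 * tilted t y)) = 2 / K\<^sup>2"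
    unfolding integral_mult_right_zero tilted_central_moments(3) using s0 K by (simp add: a s2[symmetric] power_mult_distrib)
  finally have "emeasure (cond_law p n w) A \<le> ennreal (2 / K\<^sup>2)" .
  then show ?thesis unfolding measure_def by (rule enn2real_leI[rotated]) simp
qed

section \<open>Approximation of the conditional density in probability\<close>

lemma tendsto_zero_from_square_bounds:
  fixes m :: "nat \<Rightarrow> real"
  assumes "\<And>n. 0 \<le> m n" and "\<And>K. K > 0 \<Longrightarrow> \<forall>\<^sub>F n in sequentially. m n \<le> 2 / K\<^sup>2"
  shows "m \<longlonglongrightarrow> 0"
proof (rule tendstoI)
  fix e :: real assume e: "e > 0"
  \<comment> \<open>Chosen so that \<open>2 / K\<^sup>2 = e / 2\<close>.\<close>
  define K where "K = sqrt (4 / e)"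
  have K: "K > 0" "2 / K\<^sup>2 = e / 2" using e by (auto simp: K_def)
  show "\<forall>\<^sub>F n in sequentially. dist (m n) 0 < e"
    using assms(2)[OF K(1)] by eventually_elim (use K e assms(1) in \<open>simp add: dist_real_def\<close>)
qed

context light_tailed_density
begin

lemma tmean_at_top_imp:
  fixes t :: "nat \<Rightarrow> real"
  assumes a: "filterlim a at_top sequentially" and t: "\<forall>\<^sub>F n in sequentially. tmean (t n) = a n"
  shows "filterlim t at_top sequentially"
  unfolding filterlim_at_top_dense
proof
  fix Z :: real
  show "\<forall>\<^sub>F n in sequentially. t n > Z"
    using t a[unfolded filterlim_at_top_dense, THEN spec, of "tmean Z"]
  proof eventually_elim
    case (elim n)
    then show ?case using tmean_strict_mono[of "t n" Z] by (cases "t n" Z rule: linorder_cases) auto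
  qed
qed

text \<open>
  Completing the square: with mean \<open>(t + \<gamma>) * \<beta> + a\<close> and variance \<open>\<beta>\<close> the linear part of the Gaussian exponent
  around \<open>a\<close> is \<open>(t + \<gamma>) * (y - a)\<close>, so the Gaussian factor tilts \<open>p\<close> by \<open>t\<close> and leaves \<open>v\<close>. The remaining
  constants cancel in the normalization.
\<close>
lemma normal_tilt_eq:
  fixes t a \<beta> \<gamma> :: real
  assumes b: "\<beta> > 0"
  defines "v \<equiv> \<lambda>y. exp (\<gamma> * (y - a) - (y - a)\<^sup>2 / (2 * \<beta>))"
  shows "normal_tilt p ((t + \<gamma>) * \<beta> + a) (sqrt \<beta>) y
    = tilted t y * v y / (LBINT y. tilted t y * v y)"
proof -
  define C where "C = expmom 0 t * exp (- (t * a) - (t + \<gamma>)\<^sup>2 * \<beta> / 2) / sqrt (2 * pi * \<beta>)"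
  have C: "C \<noteq> 0" using expmom_0_pos[of t] b by (simp add: C_def)
  have eq: "p y * normal_density ((t + \<gamma>) * \<beta> + a) (sqrt \<beta>) y = C * (tilted t y * v y)" for y
  proof -
    have ex: "- (y - ((t + \<gamma>) * \<beta> + a))\<^sup>2 / (2 * \<beta>) = (- (t * a) - (t + \<gamma>)\<^sup>2 * \<beta> / 2) + t * y + (\<gamma> * (y - a) - (y - a)\<^sup>2 / (2 * \<beta>))"
      using b by (simp add: field_simps power2_eq_square)
    have "normal_density ((t + \<gamma>) * \<beta> + a) (sqrt \<beta>) y
        = exp (- (t * a) - (t + \<gamma>)\<^sup>2 * \<beta> / 2) * exp (t * y) * v y / sqrt (2 * pi * \<beta>)"
      unfolding normal_density_def v_def exp_add[symmetric] ex[symmetric] using b by simp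
    then show ?thesis using expmom_0_pos[of t] by (simp add: C_def tilted_def)
  qed
  show ?thesis unfolding normal_tilt_def eq using C by simp
qed

end

locale tilted_asymptotics = light_tailed_density +
  fixes t a :: "nat \<Rightarrow> real" and A c \<kappa> :: real
  assumes mean_eq: "\<forall>\<^sub>F n in sequentially. tmean (t n) = a n"
    and std: "\<forall>\<^sub>F n in sequentially. standardized_density
        (\<lambda>z. sqrt (tvar (t n)) * tilted (t n) (tmean (t n) + sqrt (tvar (t n)) * z)) A c \<kappa>"
    and skewness: "(\<lambda>n. tthird (t n) / sqrt (tvar (t n)) ^ 3) \<longlonglongrightarrow> 0"
begin

definition "s n = sqrt (tvar (t n))"
definition "f n z = s n * tilted (t n) (tmean (t n) + s n * z)"
definition "ratio n z = enn2real (sum_density (f n) (n - 1) (- z)) / enn2real (sum_density (f n) n 0)"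

lemma s_pos: "s n > 0" using tvar_pos[of "t n"] by (simp add: s_def)

lemma cond_density_ratio:
  "\<forall>\<^sub>F n in sequentially. \<forall>y. cond_density p n (real n * a n) y = tilted (t n) y * ratio n ((y - a n) / s n)"
  using mean_eq eventually_ge_at_top[of 2]
proof eventually_elim
  case (elim n)
  have "(a n - y) / s n = - ((y - a n) / s n)" for y by (simp add: minus_divide_left)
  then show ?case
    using cond_density_tilt[OF s_pos[of n] elim(2), of "a n" _ "t n"] elim(1)
    by (simp add: ratio_def f_def[abs_def])
qed

lemma ratio_limit:
  obtains D where "D \<longlonglongrightarrow> 0"
    and "\<forall>\<^sub>F n in sequentially. \<forall>z. \<bar>ratio n z - 1\<bar> \<le> (D n + (8 + 2 * z\<^sup>2) / sqrt (real n)) / sqrt (real n) \<and> ratio n z \<le> 2"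
proof -
  have f: "f n = (\<lambda>z. sqrt (tvar (t n)) * tilted (t n) (tmean (t n) + sqrt (tvar (t n)) * z))" for n
    by (simp add: f_def[abs_def] s_def)
  have st: "\<forall>\<^sub>F n in sequentially. standardized_density (f n) A c \<kappa>" unfolding f by (rule std)
  have m3: "(LBINT z. z ^ 3 * f n z) = tthird (t n) / sqrt (tvar (t n)) ^ 3" for n
    unfolding f_def using rescaled_moment(2)[OF s_pos[of n], of 3 "t n" "tmean (t n)"]
      tilted_central_moments(4)[of "tmean (t n)" "t n"] by (simp add: s_def)
  have sk: "(\<lambda>n. LBINT z. z ^ 3 * f n z) \<longlonglongrightarrow> 0" unfolding m3 by (rule skewness)
  obtain D where D: "D \<longlonglongrightarrow> 0"
    and ev: "\<forall>\<^sub>F n in sequentially. enn2real (sum_density (f n) n 0) > 0 \<and>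
      (\<forall>x. \<bar>enn2real (sum_density (f n) (n - 1) x) / enn2real (sum_density (f n) n 0) - 1\<bar>
          \<le> (D n + (8 + 2 * x\<^sup>2) / sqrt (real n)) / sqrt (real n) \<and>
        enn2real (sum_density (f n) (n - 1) x) / enn2real (sum_density (f n) n 0) \<le> 2)"
    by (rule local_limit_ratio[OF st sk])
  show thesis
  proof (rule that[OF D])
    show "\<forall>\<^sub>F n in sequentially. \<forall>z. \<bar>ratio n z - 1\<bar> \<le> (D n + (8 + 2 * z\<^sup>2) / sqrt (real n)) / sqrt (real n) \<and> ratio n z \<le> 2"
      using ev
    proof eventually_elim
      case (elim n)
      show ?case
      proof
        fix z show "\<bar>ratio n z - 1\<bar> \<le> (D n + (8 + 2 * z\<^sup>2) / sqrt (real n)) / sqrt (real n) \<and> ratio n z \<le> 2"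
          using conjunct2[OF elim, THEN spec, of "- z"] by (simp add: ratio_def)
      qed
    qed
  qed
qed

lemma ratio_window:
  assumes K: "K > 0"
  obtains r where "r \<longlonglongrightarrow> 0"
    and "\<forall>\<^sub>F n in sequentially. \<forall>z. \<bar>z\<bar> \<le> K \<longrightarrow> \<bar>ratio n z - 1\<bar> \<le> r n / sqrt (real n)"
proof -
  obtain D where D: "D \<longlonglongrightarrow> 0"
    and ev: "\<forall>\<^sub>F n in sequentially. \<forall>z. \<bar>ratio n z - 1\<bar> \<le> (D n + (8 + 2 * z\<^sup>2) / sqrt (real n)) / sqrt (real n) \<and> ratio n z \<le> 2"
    by (rule ratio_limit)
  have "(\<lambda>n. (8 + 2 * K\<^sup>2) / sqrt (real n)) \<longlonglongrightarrow> 0"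
    by (intro tendsto_divide_0[OF tendsto_const] filterlim_at_top_imp_at_infinity filterlim_compose[OF sqrt_at_top] filterlim_real_sequentially)
  from tendsto_add[OF D this] have lim: "(\<lambda>n. D n + (8 + 2 * K\<^sup>2) / sqrt (real n)) \<longlonglongrightarrow> 0" by simp
  show thesis
  proof (rule that[OF lim])
    show "\<forall>\<^sub>F n in sequentially. \<forall>z. \<bar>z\<bar> \<le> K \<longrightarrow> \<bar>ratio n z - 1\<bar> \<le> (D n + (8 + 2 * K\<^sup>2) / sqrt (real n)) / sqrt (real n)"
      using ev
    proof eventually_elim
      case (elim n)
      show ?case
      proof (intro allI impI)
        fix z :: real assume z: "\<bar>z\<bar> \<le> K"
        have "z\<^sup>2 \<le> K\<^sup>2" using z power_mono[of "\<bar>z\<bar>" K 2] by simp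
        then have "(D n + (8 + 2 * z\<^sup>2) / sqrt (real n)) / sqrt (real n) \<le> (D n + (8 + 2 * K\<^sup>2) / sqrt (real n)) / sqrt (real n)"
          by (intro divide_right_mono add_left_mono) auto
        then show "\<bar>ratio n z - 1\<bar> \<le> (D n + (8 + 2 * K\<^sup>2) / sqrt (real n)) / sqrt (real n)"
          using elim order_trans by blast
      qed
    qed
  qed
qed

text \<open>
  A set that eventually avoids every window \<open>\<bar>y - a\<bar> \<le> K * s\<close> has conditional probability at most \<open>2 / K\<^sup>2\<close>,
  for each \<open>K\<close>.
\<close>
lemma exceptional_set_negligible:
  fixes E :: "nat \<Rightarrow> real set"
  assumes "\<And>K. K > 0 \<Longrightarrow> \<forall>\<^sub>F n in sequentially. \<forall>y. \<bar>(y - a n) / s n\<bar> \<le> K \<longrightarrow> y \<notin> E n"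
  shows "(\<lambda>n. measure (cond_law p n (real n * a n)) (E n)) \<longlonglongrightarrow> 0"
proof (rule tendsto_zero_from_square_bounds)
  obtain D where ev: "\<forall>\<^sub>F n in sequentially. \<forall>z. \<bar>ratio n z - 1\<bar> \<le> (D n + (8 + 2 * z\<^sup>2) / sqrt (real n)) / sqrt (real n) \<and> ratio n z \<le> 2"
    by (rule ratio_limit)
  fix K :: real assume K: "K > 0"
  show "\<forall>\<^sub>F n in sequentially. measure (cond_law p n (real n * a n)) (E n) \<le> 2 / K\<^sup>2"
    using assms[OF K] ev cond_density_ratio mean_eq
  proof eventually_elim
    case (elim n)
    show ?case
    proof (rule cond_law_tail[OF s_def[of n] K])
      show "a n = tmean (t n)" using elim by simp
      show "cond_density p n (real n * a n) y \<le> 2 * tilted (t n) y" for y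
      proof -
        have "tilted (t n) y * ratio n ((y - a n) / s n) \<le> tilted (t n) y * 2"
          using elim by (intro mult_left_mono tilted_nonneg) auto
        then show ?thesis using elim by (simp add: mult.commute)
      qed
      show "E n \<subseteq> {y. K * s n < \<bar>y - a n\<bar>}"
      proof
        fix y assume "y \<in> E n"
        then have "\<not> \<bar>(y - a n) / s n\<bar> \<le> K" using elim by blast
        then show "y \<in> {y. K * s n < \<bar>y - a n\<bar>}" using s_pos[of n] by (simp add: abs_divide pos_divide_le_eq)
      qed
    qed
  qed
qed simp

text \<open>
  The relative error is forced wherever \<open>p\<close> is positive, and it is set to \<open>0\<close> elsewhere. To bound it in
  probability it suffices to bound it on each window around \<open>a\<close>.
\<close>
lemma relative_error_exists:
  fixes d :: "nat \<Rightarrow> real \<Rightarrow> real" and \<epsilon> :: "real \<Rightarrow> nat \<Rightarrow> real"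
  assumes meas [measurable]: "\<And>n. d n \<in> borel_measurable borel"
    and zero: "\<forall>\<^sub>F n in sequentially. \<forall>y. d n y = 0 \<longleftrightarrow> p y = 0"
    and eps: "\<And>e n. e > 0 \<Longrightarrow> 0 \<le> \<epsilon> e n"
    and window: "\<And>K e. K > 0 \<Longrightarrow> e > 0 \<Longrightarrow> \<forall>\<^sub>F n in sequentially. \<forall>y. \<bar>(y - a n) / s n\<bar> \<le> K \<longrightarrow> p y \<noteq> 0 \<longrightarrow>
        \<bar>cond_density p n (real n * a n) y / d n y - 1\<bar> \<le> \<epsilon> e n"
  shows "\<exists>R :: nat \<Rightarrow> real \<Rightarrow> real. (\<forall>n. R n \<in> borel_measurable borel) \<and>
     (\<forall>\<^sub>F n in sequentially. \<forall>y. cond_density p n (real n * a n) y = d n y * (1 + R n y)) \<and>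
     (\<forall>e>0. (\<lambda>n. measure (cond_law p n (real n * a n)) {y. \<bar>R n y\<bar> > \<epsilon> e n}) \<longlonglongrightarrow> 0)"
proof -
  define R where "R n y = (if p y = 0 then 0 else cond_density p n (real n * a n) y / d n y - 1)" for n y
  have [measurable]: "cond_density p n w \<in> borel_measurable borel" for n w
    unfolding cond_density_def[abs_def] by measurable
  show ?thesis
  proof (intro exI[of _ R] conjI allI impI)
    show "R n \<in> borel_measurable borel" for n unfolding R_def[abs_def] by measurable
    show "\<forall>\<^sub>F n in sequentially. \<forall>y. cond_density p n (real n * a n) y = d n y * (1 + R n y)"
      using zero
    proof eventually_elim
      case (elim n)
      show ?case
      proof
        fix y show "cond_density p n (real n * a n) y = d n y * (1 + R n y)"
          using elim[THEN spec, of y] by (cases "p y = 0") (simp_all add: R_def cond_density_def)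
      qed
    qed
    fix e :: real assume e: "e > 0"
    show "(\<lambda>n. measure (cond_law p n (real n * a n)) {y. \<bar>R n y\<bar> > \<epsilon> e n}) \<longlonglongrightarrow> 0"
    proof (rule exceptional_set_negligible)
      fix K :: real assume K: "K > 0"
      show "\<forall>\<^sub>F n in sequentially. \<forall>y. \<bar>(y - a n) / s n\<bar> \<le> K \<longrightarrow> y \<notin> {y. \<bar>R n y\<bar> > \<epsilon> e n}"
        using window[OF K e]
      proof eventually_elim
        case (elim n)
        show ?case
        proof (intro allI impI)
          fix y assume "\<bar>(y - a n) / s n\<bar> \<le> K"
          then have "\<bar>R n y\<bar> \<le> \<epsilon> e n" using elim eps[OF e, of n] by (simp add: R_def)
          then show "y \<notin> {y. \<bar>R n y\<bar> > \<epsilon> e n}" by simp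
        qed
      qed
    qed
  qed
qed

lemma tilted_eq_0_iff: "tilted u y = 0 \<longleftrightarrow> p y = 0"
  using expmom_0_pos[of u] by (simp add: tilted_def)

theorem tilted_approximation:
  "\<exists>R :: nat \<Rightarrow> real \<Rightarrow> real. (\<forall>n. R n \<in> borel_measurable borel) \<and>
     (\<forall>\<^sub>F n in sequentially. \<forall>y. cond_density p n (real n * a n) y = tilted (t n) y * (1 + R n y)) \<and>
     (\<forall>e>0. (\<lambda>n. measure (cond_law p n (real n * a n)) {y. \<bar>R n y\<bar> > e / sqrt (real n)}) \<longlonglongrightarrow> 0)"
proof (rule relative_error_exists)
  fix K e :: real assume K: "K > 0" and e: "e > 0"
  obtain r where r: "r \<longlonglongrightarrow> 0"
    and ev: "\<forall>\<^sub>F n in sequentially. \<forall>z. \<bar>z\<bar> \<le> K \<longrightarrow> \<bar>ratio n z - 1\<bar> \<le> r n / sqrt (real n)"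
    by (rule ratio_window[OF K])
  have re: "\<forall>\<^sub>F n in sequentially. r n < e" by (rule order_tendstoD(2)[OF r e])
  show "\<forall>\<^sub>F n in sequentially. \<forall>y. \<bar>(y - a n) / s n\<bar> \<le> K \<longrightarrow> p y \<noteq> 0 \<longrightarrow>
        \<bar>cond_density p n (real n * a n) y / tilted (t n) y - 1\<bar> \<le> e / sqrt (real n)"
    using ev re cond_density_ratio
  proof eventually_elim
    case (elim n)
    show ?case
    proof (intro allI impI)
      fix y assume y: "\<bar>(y - a n) / s n\<bar> \<le> K" "p y \<noteq> 0"
      have "cond_density p n (real n * a n) y / tilted (t n) y = ratio n ((y - a n) / s n)"
        using elim y tilted_eq_0_iff[of "t n" y] by simp
      moreover have "\<bar>ratio n ((y - a n) / s n) - 1\<bar> \<le> r n / sqrt (real n)" using elim y by blast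
      moreover have "r n / sqrt (real n) \<le> e / sqrt (real n)" using elim by (intro divide_right_mono) auto
      ultimately show "\<bar>cond_density p n (real n * a n) y / tilted (t n) y - 1\<bar> \<le> e / sqrt (real n)" by simp
    qed
  qed
qed (simp_all add: tilted_eq_0_iff)

text \<open>
  By \<open>normal_tilt_eq\<close>, the quotient of the Gaussian approximant and the tilted density at \<open>y = a n + s n * z\<close>
  is \<open>weight n z\<close> up to normalization.
\<close>
definition "slope n = tthird (t n) / (2 * (real n - 1) * (s n)\<^sup>2)"
definition "weight n z = exp (slope n * s n * z - z\<^sup>2 / (2 * (real n - 1)))"

lemma standardized_upper: "\<forall>\<^sub>F n in sequentially. \<forall>z. 0 \<le> f n z \<and> f n z \<le> A * exp (- c * \<bar>z\<bar>)"
  using std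
proof eventually_elim
  case (elim n)
  interpret standardized_density "\<lambda>z. sqrt (tvar (t n)) * tilted (t n) (tmean (t n) + sqrt (tvar (t n)) * z)" A c \<kappa>
    by (rule elim)
  show ?case using upper f_nonneg by (simp add: f_def s_def)
qed

context
  assumes spread: "(\<lambda>n. (s n)\<^sup>2 / real n) \<longlonglongrightarrow> 0"
begin

text \<open>
  The coefficient of \<open>z\<close> is half the skewness times \<open>(s n)\<^sup>2 / (n - 1)\<close>, and both of these tend to \<open>0\<close>.
\<close>
lemma slope_lim: "(\<lambda>n. slope n * s n) \<longlonglongrightarrow> 0"
proof -
  have nn: "(\<lambda>n. real n / (real n - 1)) \<longlonglongrightarrow> 1" by real_asymp
  have lim: "(\<lambda>n. tthird (t n) / sqrt (tvar (t n)) ^ 3 * ((s n)\<^sup>2 / real n) * (real n / (real n - 1)) / 2) \<longlonglongrightarrow> 0"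
    by (rule tendsto_eq_rhs[where x="0 * 0 * 1 / 2"]) (intro tendsto_divide tendsto_mult skewness spread nn tendsto_const, simp_all)
  show ?thesis
  proof (rule Lim_transform_eventually[OF lim])
    show "\<forall>\<^sub>F n in sequentially. tthird (t n) / sqrt (tvar (t n)) ^ 3 * ((s n)\<^sup>2 / real n) * (real n / (real n - 1)) / 2
        = slope n * s n"
      using eventually_ge_at_top[of 2]
    proof eventually_elim
      case (elim n)
      have "s n > 0" "real n > 0" "real n - 1 > 0" using s_pos elim by auto
      then show ?case by (simp add: slope_def s_def[symmetric] power2_eq_square power3_eq_cube)
    qed
  qed
qed

lemma weight_lim: "(\<lambda>n. weight n z) \<longlonglongrightarrow> 1"
proof -
  have q: "(\<lambda>n. z\<^sup>2 / (2 * (real n - 1))) \<longlonglongrightarrow> 0" by real_asymp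
  have "(\<lambda>n. weight n z) \<longlonglongrightarrow> exp (0 * z - 0)"
    unfolding weight_def by (intro tendsto_exp tendsto_diff tendsto_mult slope_lim tendsto_const q)
  then show ?thesis by simp
qed

text \<open>
  Dominated convergence: once the coefficient of \<open>z\<close> is below \<open>c / 2\<close>, half of the exponential envelope of
  \<open>f n\<close> absorbs \<open>weight n\<close>, which leaves \<open>exp (- (c / 2) * \<bar>z\<bar>)\<close>.
\<close>
lemma weight_integral_lim: "(\<lambda>n. LBINT z. f n z * weight n z) \<longlonglongrightarrow> 1"
proof -
  have c: "c > 0"
  proof -
    obtain N where N: "standardized_density (\<lambda>z. sqrt (tvar (t N)) * tilted (t N) (tmean (t N) + sqrt (tvar (t N)) * z)) A c \<kappa>"
      using std unfolding eventually_sequentially by blast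
    then show ?thesis by (rule standardized_density.c_pos)
  qed
  have [measurable]: "f n \<in> borel_measurable borel" "weight n \<in> borel_measurable borel" for n
    unfolding f_def[abs_def] weight_def[abs_def] by measurable
  let ?u = "\<lambda>z. 2 * A * exp (- (c / 2) * \<bar>z\<bar>)"
  have u: "integrable lborel ?u"
    using integrable_power_exp_abs[of "c / 2" 0] c by (intro integrable_mult_right) simp
  have up: "\<forall>\<^sub>F n in sequentially. \<forall>z. \<bar>f n z * (weight n z - 1)\<bar> \<le> ?u z"
  proof -
    have "\<forall>\<^sub>F n in sequentially. \<bar>slope n * s n\<bar> < c / 2"
      using tendstoD[OF slope_lim, of "c / 2"] c by (simp add: dist_real_def)
    then show ?thesis using standardized_upper eventually_ge_at_top[of 2]
    proof eventually_elim
      case (elim n)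
      show ?case
      proof
        fix z
        define b where "b = slope n * s n"
        have fz: "0 \<le> f n z" "f n z \<le> A * exp (- c * \<bar>z\<bar>)" using elim by blast+
        then have Az: "0 \<le> A * exp (- c * \<bar>z\<bar>)" by linarith
        have "b * z \<le> \<bar>b\<bar> * \<bar>z\<bar>" by (metis abs_ge_self abs_mult)
        also have "\<dots> \<le> c / 2 * \<bar>z\<bar>" using elim by (intro mult_right_mono) (auto simp: b_def)
        finally have "b * z - z\<^sup>2 / (2 * (real n - 1)) \<le> c / 2 * \<bar>z\<bar>"
          using elim by (smt (verit) divide_nonneg_nonneg of_nat_1 of_nat_mono one_le_numeral order_trans zero_le_power2)
        then have "weight n z \<le> exp (c / 2 * \<bar>z\<bar>)" by (simp add: weight_def b_def)
        moreover have "1 \<le> exp (c / 2 * \<bar>z\<bar>)" using c by simp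
        moreover have "0 \<le> weight n z" by (simp add: weight_def)
        ultimately have "\<bar>weight n z - 1\<bar> \<le> 2 * exp (c / 2 * \<bar>z\<bar>)" by linarith
        then have "f n z * \<bar>weight n z - 1\<bar> \<le> A * exp (- c * \<bar>z\<bar>) * (2 * exp (c / 2 * \<bar>z\<bar>))"
          using fz Az by (intro mult_mono) auto
        also have "\<dots> = 2 * A * (exp (- c * \<bar>z\<bar>) * exp (c / 2 * \<bar>z\<bar>))" by simp
        also have "exp (- c * \<bar>z\<bar>) * exp (c / 2 * \<bar>z\<bar>) = exp (- (c / 2) * \<bar>z\<bar>)"
          unfolding exp_add[symmetric] by (simp add: field_simps)
        finally show "\<bar>f n z * (weight n z - 1)\<bar> \<le> ?u z" using fz(1) by (simp add: abs_mult)
      qed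
    qed
  qed
  have "(\<lambda>n. LBINT z. f n z * (weight n z - 1)) \<longlonglongrightarrow> (\<integral>z. (0::real) \<partial>(lborel :: real measure))"
  proof (rule dominated_convergence_eventually[OF _ _ u up])
    fix z
    show "(\<lambda>n. f n z * (weight n z - 1)) \<longlonglongrightarrow> 0"
    proof (rule Lim_null_comparison)
      show "\<forall>\<^sub>F n in sequentially. norm (f n z * (weight n z - 1)) \<le> A * exp (- c * \<bar>z\<bar>) * \<bar>weight n z - 1\<bar>"
        using standardized_upper
      proof eventually_elim
        case (elim n)
        then have "0 \<le> f n z" "f n z \<le> A * exp (- c * \<bar>z\<bar>)" by blast+
        then show ?case by (simp add: abs_mult mult_right_mono)
      qed
      have "(\<lambda>n. weight n z - 1) \<longlonglongrightarrow> 0" using tendsto_diff[OF weight_lim tendsto_const[of 1]] by simp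
      then show "(\<lambda>n. A * exp (- c * \<bar>z\<bar>) * \<bar>weight n z - 1\<bar>) \<longlonglongrightarrow> 0"
        by (rule tendsto_mult_right_zero[OF tendsto_rabs_zero])
    qed
  qed simp_all
  then have "(\<lambda>n. (LBINT z. f n z * (weight n z - 1)) + 1) \<longlonglongrightarrow> 0 + 1" by (intro tendsto_add tendsto_const) simp
  then have "(\<lambda>n. (LBINT z. f n z * (weight n z - 1)) + 1) \<longlonglongrightarrow> 1" by simp
  then show ?thesis
  proof (rule Lim_transform_eventually)
    show "\<forall>\<^sub>F n in sequentially. (LBINT z. f n z * (weight n z - 1)) + 1 = (LBINT z. f n z * weight n z)"
      using up
    proof eventually_elim
      case (elim n)
      have i1: "integrable lborel (\<lambda>z. f n z * (weight n z - 1))"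
      proof (rule Bochner_Integration.integrable_bound[OF u])
        show "AE z in lborel. norm (f n z * (weight n z - 1)) \<le> norm (?u z)"
        proof (rule AE_I2)
          fix z
          have "\<bar>f n z * (weight n z - 1)\<bar> \<le> ?u z" using elim by blast
          then show "norm (f n z * (weight n z - 1)) \<le> norm (?u z)" unfolding real_norm_def by linarith
        qed
      qed simp
      have f: "integrable lborel (f n)" "(LBINT z. f n z) = 1"
        using rescaled_moment[OF s_pos[of n], of 0 "t n" "tmean (t n)"] tilted_integral[of "t n"]
        by (simp_all add: f_def[abs_def])
      have "(LBINT z. f n z * (weight n z - 1)) + (LBINT z. f n z) = (LBINT z. f n z * (weight n z - 1) + f n z)"
        by (rule Bochner_Integration.integral_add[OF i1 f(1), symmetric])
      also have "\<dots> = (LBINT z. f n z * weight n z)"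
        by (intro Bochner_Integration.integral_cong) (auto simp: algebra_simps)
      finally show ?case by (simp add: f(2))
    qed
  qed
qed

lemma approximant_eq:
  assumes n: "n \<ge> 2" and an: "tmean (t n) = a n"
  shows "normal_tilt p ((t n + slope n) * ((real n - 1) * (s n)\<^sup>2) + a n) (sqrt ((real n - 1) * (s n)\<^sup>2)) y
    = tilted (t n) y * weight n ((y - a n) / s n) / (LBINT z. f n z * weight n z)"
proof -
  define \<gamma> \<beta> where "\<gamma> = slope n" and "\<beta> = (real n - 1) * (s n)\<^sup>2"
  have n1: "real n - 1 > 0" using n by simp
  have s0: "s n > 0" by (rule s_pos)
  have b: "\<beta> > 0" using n1 s0 by (simp add: \<beta>_def)
  have v: "exp (\<gamma> * (y - a n) - (y - a n)\<^sup>2 / (2 * \<beta>)) = weight n ((y - a n) / s n)" for y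
    using s0 n1 by (simp add: weight_def \<gamma>_def \<beta>_def power_divide)
  have "(LBINT y. tilted (t n) y * weight n ((y - a n) / s n))
      = s n * (LBINT z. tilted (t n) (a n + s n * z) * weight n (((a n + s n * z) - a n) / s n))"
    using s0 lborel_integral_real_affine[of "s n" "\<lambda>y. tilted (t n) y * weight n ((y - a n) / s n)" "a n"] by simp
  also have "\<dots> = (LBINT z. s n * (tilted (t n) (a n + s n * z) * weight n (((a n + s n * z) - a n) / s n)))"
    by (rule integral_mult_right_zero[symmetric])
  also have "\<dots> = (LBINT z. f n z * weight n z)"
    using s0 by (simp add: f_def an mult.assoc)
  finally have V: "(LBINT y. tilted (t n) y * weight n ((y - a n) / s n)) = (LBINT z. f n z * weight n z)" .
  show ?thesis
    using normal_tilt_eq[OF b, of "t n" \<gamma> "a n" y] unfolding v V by (simp only: \<gamma>_def \<beta>_def)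
qed

text \<open>
  On a window \<open>\<bar>z\<bar> \<le> K\<close> the relative error is \<open>ratio n z * V n / weight n z - 1\<close>, where \<open>V n\<close> is the integral of
  \<open>f n * weight n\<close>. The three factors tend to \<open>1\<close> uniformly on the window.
\<close>
theorem normal_tilt_approximation:
  defines "d \<equiv> \<lambda>n. normal_tilt p ((t n + slope n) * ((real n - 1) * (s n)\<^sup>2) + a n)
       (sqrt ((real n - 1) * (s n)\<^sup>2))"
  shows "\<exists>R :: nat \<Rightarrow> real \<Rightarrow> real. (\<forall>n. R n \<in> borel_measurable borel) \<and>
     (\<forall>\<^sub>F n in sequentially. \<forall>y. cond_density p n (real n * a n) y = d n y * (1 + R n y)) \<and>
     (\<forall>e>0. (\<lambda>n. measure (cond_law p n (real n * a n)) {y. \<bar>R n y\<bar> > e}) \<longlonglongrightarrow> 0)"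
proof (rule relative_error_exists[where \<epsilon>="\<lambda>e n. e"])
  let ?V = "\<lambda>n. \<integral>z. f n z * weight n z \<partial>lborel"
  have V_pos: "\<forall>\<^sub>F n in sequentially. 0 < ?V n" by (rule order_tendstoD(1)[OF weight_integral_lim]) simp
  show "d n \<in> borel_measurable borel" for n unfolding d_def normal_tilt_def[abs_def] by measurable
  have d_eq: "\<forall>\<^sub>F n in sequentially. \<forall>y. d n y = tilted (t n) y * weight n ((y - a n) / s n) / ?V n"
    using mean_eq eventually_ge_at_top[of 2] unfolding d_def by eventually_elim (simp only: approximant_eq simp_thms)
  show "\<forall>\<^sub>F n in sequentially. \<forall>y. d n y = 0 \<longleftrightarrow> p y = 0"
    using d_eq V_pos by eventually_elim (simp add: tilted_eq_0_iff weight_def)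
  fix K e :: real assume K: "K > 0" and e: "e > 0"
  obtain r where r: "r \<longlonglongrightarrow> 0"
    and ev: "\<forall>\<^sub>F n in sequentially. \<forall>z. \<bar>z\<bar> \<le> K \<longrightarrow> \<bar>ratio n z - 1\<bar> \<le> r n / sqrt (real n)"
    by (rule ratio_window[OF K])
  define b where "b n = slope n * s n" for n
  define l where "l n = \<bar>b n\<bar> * K + K\<^sup>2 / (2 * (real n - 1))" for n
  have q: "(\<lambda>n. K\<^sup>2 / (2 * (real n - 1))) \<longlonglongrightarrow> 0" by real_asymp
  have "(\<lambda>n. \<bar>b n\<bar> * K + K\<^sup>2 / (2 * (real n - 1))) \<longlonglongrightarrow> \<bar>0\<bar> * K + 0"
    unfolding b_def by (intro tendsto_add tendsto_mult tendsto_rabs slope_lim tendsto_const q)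
  then have l: "l \<longlonglongrightarrow> 0" unfolding l_def[abs_def] by simp
  define E where "E n = (r n / sqrt (real n) * ?V n + \<bar>?V n - 1\<bar>) * exp (l n) + (exp (l n) - 1)" for n
  have rs: "(\<lambda>n. r n / sqrt (real n)) \<longlonglongrightarrow> 0"
    by (rule tendsto_divide_0[OF r]) (intro filterlim_at_top_imp_at_infinity filterlim_compose[OF sqrt_at_top] filterlim_real_sequentially)
  have "(\<lambda>n. (r n / sqrt (real n) * ?V n + \<bar>?V n - 1\<bar>) * exp (l n) + (exp (l n) - 1)) \<longlonglongrightarrow> (0 * 1 + \<bar>1 - 1\<bar>) * exp 0 + (exp 0 - 1)"
    by (intro tendsto_add tendsto_mult tendsto_rabs tendsto_diff tendsto_exp rs weight_integral_lim l tendsto_const)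
  then have "E \<longlonglongrightarrow> 0" unfolding E_def[abs_def] by simp
  then have Ee: "\<forall>\<^sub>F n in sequentially. E n < e" using e by (rule order_tendstoD(2))
  show "\<forall>\<^sub>F n in sequentially. \<forall>y. \<bar>(y - a n) / s n\<bar> \<le> K \<longrightarrow> p y \<noteq> 0 \<longrightarrow>
        \<bar>cond_density p n (real n * a n) y / d n y - 1\<bar> \<le> e"
    using ev Ee cond_density_ratio d_eq V_pos eventually_ge_at_top[of 2]
  proof eventually_elim
    case (elim n)
    show ?case
    proof (intro allI impI)
      fix y assume y: "\<bar>(y - a n) / s n\<bar> \<le> K" "p y \<noteq> 0"
      define z where "z = (y - a n) / s n"
      define V \<rho> x where "V = ?V n" and "\<rho> = ratio n z" and "x = 1 / weight n z"
      have V: "V > 0" using elim by (simp add: V_def)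
      have n1: "real n - 1 > 0" using elim by simp
      have "cond_density p n (real n * a n) y / d n y = \<rho> * V * x"
        using elim y tilted_eq_0_iff[of "t n" y] by (simp add: V_def \<rho>_def x_def z_def)
      also have "\<rho> * V * x - 1 = ((\<rho> - 1) * V + (V - 1)) * x + (x - 1)" by (simp add: algebra_simps)
      finally have eq: "cond_density p n (real n * a n) y / d n y - 1 = ((\<rho> - 1) * V + (V - 1)) * x + (x - 1)" by simp
      have w: "weight n z = exp (b n * z - z\<^sup>2 / (2 * (real n - 1)))" by (simp add: weight_def b_def)
      have x_eq: "x = exp (- (b n * z - z\<^sup>2 / (2 * (real n - 1))))" unfolding x_def w exp_minus by (simp add: inverse_eq_divide)
      have bz: "\<bar>b n * z - z\<^sup>2 / (2 * (real n - 1))\<bar> \<le> l n"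
      proof -
        have "\<bar>b n * z\<bar> \<le> \<bar>b n\<bar> * K" using y unfolding abs_mult z_def by (intro mult_left_mono) auto
        moreover have "z\<^sup>2 \<le> K\<^sup>2" using power_mono[of "\<bar>z\<bar>" K 2] y(1)[folded z_def] by simp
        then have "z\<^sup>2 / (2 * (real n - 1)) \<le> K\<^sup>2 / (2 * (real n - 1))" using n1 by (intro divide_right_mono) auto
        moreover have "0 \<le> z\<^sup>2 / (2 * (real n - 1))" using n1 by simp
        ultimately show ?thesis unfolding l_def by linarith
      qed
      have x0: "0 < x" by (simp add: x_eq)
      have x1: "x \<le> exp (l n)" using bz unfolding x_eq by (subst exp_le_cancel_iff) linarith
      have x2: "\<bar>x - 1\<bar> \<le> exp (l n) - 1"
      proof -
        have "1 - l n \<le> x" unfolding x_eq using bz exp_ge_add_one_self[of "- (b n * z - z\<^sup>2 / (2 * (real n - 1)))"] by linarith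
        moreover have "1 + l n \<le> exp (l n)" by (rule exp_ge_add_one_self)
        ultimately show ?thesis using x1 by linarith
      qed
      have \<rho>: "\<bar>\<rho> - 1\<bar> \<le> r n / sqrt (real n)" using elim y by (simp add: \<rho>_def z_def)
      have "\<bar>(\<rho> - 1) * V + (V - 1)\<bar> \<le> r n / sqrt (real n) * V + \<bar>V - 1\<bar>"
      proof -
        have "\<bar>(\<rho> - 1) * V\<bar> \<le> r n / sqrt (real n) * V" unfolding abs_mult using \<rho> V by (intro mult_mono) auto
        then show ?thesis by linarith
      qed
      then have "\<bar>((\<rho> - 1) * V + (V - 1)) * x\<bar> \<le> (r n / sqrt (real n) * V + \<bar>V - 1\<bar>) * exp (l n)"
        unfolding abs_mult using x0 x1 by (intro mult_mono) auto
      then have "\<bar>((\<rho> - 1) * V + (V - 1)) * x + (x - 1)\<bar> \<le> E n" using x2 unfolding E_def V_def by linarith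
      then show "\<bar>cond_density p n (real n * a n) y / d n y - 1\<bar> \<le> e" unfolding eq using elim by linarith
    qed
  qed
qed simp_all

end

end

section \<open>The conditional limit theorem\<close>

text \<open>
  The conditions on \<open>\<theta>\<close> and \<open>\<eta>\<close> force \<open>\<eta> < 0\<close>.
\<close>
lemma regular_case_q_tendsto_zero:
  assumes reg: "regular_case h h2 q" and bd: "\<And>x. x \<ge> 0 \<Longrightarrow> \<bar>q x\<bar> \<le> B"
  shows "(q \<longlongrightarrow> 0) at_top"
proof -
  from reg obtain \<beta>0 \<theta> \<eta> :: real where "\<beta>0 > 0" "\<theta> \<le> \<beta>0 - 2" "\<eta> < \<theta> - 3 * \<beta>0 / 2 - 3 / 2"
    and rv: "regularly_varying \<eta> (\<lambda>x. \<bar>q x\<bar>)"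
    unfolding regular_case_def by blast
  then have "\<eta> < 0" by simp
  moreover have "\<forall>\<^sub>F x in at_top. \<bar>q x\<bar> \<le> B" using eventually_ge_at_top[of 0] by eventually_elim (rule bd)
  ultimately have "((\<lambda>x. \<bar>q x\<bar>) \<longlongrightarrow> 0) at_top" by (rule regularly_varying_bounded_tendsto_zero[OF rv])
  then show ?thesis by (rule tendsto_rabs_zero_cancel)
qed

text \<open>
  The limit is obtained for \<open>q \<circ> \<psi>\<close> and transported back along \<open>u = h x\<close>.
\<close>
lemma rapid_case_q_tendsto_zero:
  assumes rap: "rapid_case h q" and bd: "\<And>x. x \<ge> 0 \<Longrightarrow> \<bar>q x\<bar> \<le> B" and h: "filterlim h at_top at_top"
  shows "(q \<longlongrightarrow> 0) at_top"
proof -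
  from rap obtain \<psi> and \<eta> :: real where inv: "inverse_at_top h \<psi>" and eta: "\<eta> < - 1 / 2"
    and rv: "regularly_varying \<eta> (\<lambda>u. \<bar>q (\<psi> u)\<bar>)"
    unfolding rapid_case_def by blast
  have "\<forall>\<^sub>F u in at_top. \<psi> u \<ge> 0 \<and> h (\<psi> u) = u" using inv by (simp add: inverse_at_top_def)
  then have "\<forall>\<^sub>F u in at_top. \<bar>q (\<psi> u)\<bar> \<le> B" by eventually_elim (simp add: bd)
  then have "((\<lambda>u. \<bar>q (\<psi> u)\<bar>) \<longlongrightarrow> 0) at_top"
    using eta by (intro regularly_varying_bounded_tendsto_zero[OF rv]) auto
  then have "((\<lambda>u. q (\<psi> u)) \<longlongrightarrow> 0) at_top" by (rule tendsto_rabs_zero_cancel)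
  then have "((\<lambda>x. q (\<psi> (h x))) \<longlongrightarrow> 0) at_top" by (rule filterlim_compose[OF _ h])
  then show ?thesis
  proof (rule Lim_transform_eventually)
    have "\<forall>\<^sub>F x in at_top. \<psi> (h x) = x" using inv by (simp add: inverse_at_top_def)
    then show "\<forall>\<^sub>F x in at_top. q (\<psi> (h x)) = q x" by eventually_elim simp
  qed
qed

text \<open>
  As \<open>m\<close> is strictly increasing, \<open>a n \<rightarrow> \<infinity>\<close> forces \<open>t n \<rightarrow> \<infinity>\<close>, and then \<open>t n\<close> has a saddle point that also tends
  to infinity.
\<close>
theorem (in convex_tail) tilted_asymptotics_at_top:
  fixes t a :: "nat \<Rightarrow> real"
  assumes a: "filterlim a at_top sequentially" and mean: "\<forall>\<^sub>F n in sequentially. tmean (t n) = a n"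
  shows "tilted_asymptotics p t a (2 * exp (B + 1/4 + 1/8)) (1/8) (exp (- B - 3) / 6)"
    and "(\<lambda>n. tvar (t n) / a n) \<longlonglongrightarrow> 0"
proof -
  have t: "filterlim t at_top sequentially" by (rule tmean_at_top_imp[OF a mean])
  obtain x where x: "filterlim x at_top sequentially" and hx: "\<forall>\<^sub>F n in sequentially. h (x n) = t n"
    by (rule saddle_point[OF t])
  interpret laplace_sequence p g q h k B x
    by (intro laplace_sequence.intro laplace_sequence_axioms.intro convex_tail_axioms x)
  show "tilted_asymptotics p t a (2 * exp (B + 1/4 + 1/8)) (1/8) (exp (- B - 3) / 6)"
  proof
    show "\<forall>\<^sub>F n in sequentially. tmean (t n) = a n" by (rule mean)
    show "\<forall>\<^sub>F n in sequentially. standardized_density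
        (\<lambda>z. sqrt (tvar (t n)) * tilted (t n) (tmean (t n) + sqrt (tvar (t n)) * z)) (2 * exp (B + 1/4 + 1/8)) (1/8) (exp (- B - 3) / 6)"
      using standardized_tilted hx by eventually_elim (simp only:)
    show "(\<lambda>n. tthird (t n) / sqrt (tvar (t n)) ^ 3) \<longlonglongrightarrow> 0"
      by (rule Lim_transform_eventually[OF skewness_lim]) (use hx in \<open>auto elim!: eventually_mono\<close>)
  qed
  have "\<forall>\<^sub>F n in sequentially. tvar (h (x n)) / tmean (h (x n)) = tvar (t n) / a n"
    using hx mean by eventually_elim simp
  then show "(\<lambda>n. tvar (t n) / a n) \<longlonglongrightarrow> 0" by (rule Lim_transform_eventually[OF variance_mean_lim])
qed

text \<open>
  Since \<open>s\<^sup>2 / n\<close> is the product of the squares of \<open>a / (s * sqrt n)\<close>, which is bounded, and of \<open>s\<^sup>2 / a\<close>.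
\<close>
lemma spread_of_limsup:
  fixes a s :: "nat \<Rightarrow> real"
  assumes s: "\<And>n. s n > 0" and a: "filterlim a at_top sequentially" and lim: "(\<lambda>n. (s n)\<^sup>2 / a n) \<longlonglongrightarrow> 0"
    and sup: "limsup (\<lambda>n. ereal (a n / (s n * sqrt (real n)))) < \<infinity>"
  shows "(\<lambda>n. (s n)\<^sup>2 / real n) \<longlonglongrightarrow> 0"
proof -
  obtain C :: nat where "limsup (\<lambda>n. ereal (a n / (s n * sqrt (real n)))) < ereal (real C)"
    using sup less_PInf_Ex_of_nat by auto
  then have C: "\<forall>\<^sub>F n in sequentially. a n / (s n * sqrt (real n)) < real C"
    using Limsup_lessD by fastforce
  show ?thesis
  proof (rule Lim_null_comparison)
    have "(\<lambda>n. (real C)\<^sup>2 * ((s n)\<^sup>2 / a n)\<^sup>2) \<longlonglongrightarrow> (real C)\<^sup>2 * 0\<^sup>2" by (intro tendsto_mult tendsto_const tendsto_power lim)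
    then show "(\<lambda>n. (real C)\<^sup>2 * ((s n)\<^sup>2 / a n)\<^sup>2) \<longlonglongrightarrow> 0" by simp
    show "\<forall>\<^sub>F n in sequentially. norm ((s n)\<^sup>2 / real n) \<le> (real C)\<^sup>2 * ((s n)\<^sup>2 / a n)\<^sup>2"
      using C a[unfolded filterlim_at_top_dense, THEN spec, of 0] eventually_gt_at_top[of 0]
    proof eventually_elim
      case (elim n)
      define r where "r = a n / (s n * sqrt (real n))"
      have r: "0 \<le> r" "r \<le> real C" using elim s[of n] by (auto simp: r_def)
      have "(s n)\<^sup>2 / real n = r\<^sup>2 * ((s n)\<^sup>2 / a n)\<^sup>2"
        using elim s[of n] by (simp add: r_def power_divide power_mult_distrib field_simps power2_eq_square)
      also have "\<dots> \<le> (real C)\<^sup>2 * ((s n)\<^sup>2 / a n)\<^sup>2" using r by (intro mult_right_mono power_mono) auto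
      finally show ?case by simp
    qed
  qed
qed

theorem theorem16:
  fixes M :: "'a measure" and X :: "nat \<Rightarrow> 'a \<Rightarrow> real"
    and p g q :: "real \<Rightarrow> real" and D :: "nat \<Rightarrow> real \<Rightarrow> real"
    and a t :: "nat \<Rightarrow> real"
  assumes "prob_space M"
    and "prob_space.indep_vars M (\<lambda>_. borel) X {1..}"
    and "\<forall>i\<ge>1. distributed M lborel (X i) (\<lambda>x. ennreal (p x))"
    and "\<forall>x. p x = (if x \<ge> 0 then exp (- (g x - q x)) else 0)"
    and "\<forall>x\<ge>0. g x > 0"
    and "convex_on {0..} g"
    and "derivs_on 4 {0..} g D"
    and "filterlim (\<lambda>x. g x / x) at_top at_top"
    and "bounded (q ` {0..})"
    and "regular_case (D 1) (D 3) q \<or> rapid_case (D 1) q"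
    and "filterlim a at_top sequentially"
    and "\<forall>\<^sub>F n in sequentially. tilt_mean M (X 1) (t n) = a n"
  shows
    "((\<lambda>n. a n / (tilt_sd M (X 1) (t n) * sqrt (real n))) \<longlonglongrightarrow> 0 \<longrightarrow>
       (\<exists>R :: nat \<Rightarrow> real \<Rightarrow> real.
          (\<forall>n. R n \<in> borel_measurable borel) \<and>
          (\<forall>\<^sub>F n in sequentially. \<forall>y.
             cond_density p n (real n * a n) y
               = tilted_density M (X 1) p (t n) y * (1 + R n y)) \<and>
          (\<forall>\<delta>>0. (\<lambda>n. measure (cond_law p n (real n * a n))
                          {y. \<bar>R n y\<bar> > \<delta> / sqrt (real n)}) \<longlonglongrightarrow> 0)))
     \<and>
     (0 < liminf (\<lambda>n. ereal (a n / (tilt_sd M (X 1) (t n) * sqrt (real n)))) \<and>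
      limsup (\<lambda>n. ereal (a n / (tilt_sd M (X 1) (t n) * sqrt (real n)))) < \<infinity> \<longrightarrow>
       (\<exists>R :: nat \<Rightarrow> real \<Rightarrow> real.
          (\<forall>n. R n \<in> borel_measurable borel) \<and>
          (\<forall>\<^sub>F n in sequentially. \<forall>y.
             cond_density p n (real n * a n) y
               = approx_density M (X 1) p n (a n) (t n) y * (1 + R n y)) \<and>
          (\<forall>\<delta>>0. (\<lambda>n. measure (cond_law p n (real n * a n))
                          {y. \<bar>R n y\<bar> > \<delta>}) \<longlonglongrightarrow> 0)))"
proof -
  interpret prob_space M by fact
  have X1: "distributed M lborel (X 1) (\<lambda>x. ennreal (p x))" using assms(3) by simp
  have p_eq: "p x = (if x \<ge> 0 then exp (- (g x - q x)) else 0)" for x using assms(4) by blast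
  have p_nn: "0 \<le> p x" for x by (simp add: p_eq)
  have p_meas: "p \<in> borel_measurable borel"
    using distributed_real_measurable[OF _ X1] p_nn by simp
  have p_mass: "(LBINT x. p x) = 1"
    using distributed_integral[OF X1, of "\<lambda>_. 1"] p_nn by (simp add: prob_space)
  obtain B where B: "\<And>x. x \<ge> 0 \<Longrightarrow> \<bar>q x\<bar> \<le> B"
    using assms(9) unfolding bounded_iff by auto
  note der = derivs_onD[OF assms(7)]
  have at: "at x within {0..} = at x" if "x > 0" for x :: real using that by (intro at_within_interior) auto
  have gd: "(g has_real_derivative D 1 x) (at x)" if "x > 0" for x
    using der(2)[of 0 x] at[OF that] that by (simp add: der(1))
  have hd: "(D 1 has_real_derivative D 2 x) (at x)" if "x > 0" for x
    using der(2)[of 1 x] at[OF that] that by (simp add: numeral_2_eq_2)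
  have h_top: "filterlim (D 1) at_top at_top" by (rule convex_derivative_at_top[OF assms(6) gd assms(8)])
  have h_mono: "D 1 x \<le> D 1 y" if "0 < x" "x \<le> y" for x y
    by (rule convex_derivative_mono[OF assms(6) gd that])
  have curv: "slowly_changing_curvature (D 2)"
    using assms(10) regular_case_curvature[OF hd h_top] rapid_case_curvature[OF hd h_mono h_top] by blast
  have q0: "(q \<longlongrightarrow> 0) at_top"
    using assms(10)
  proof
    assume "regular_case (D 1) (D 3) q"
    then show ?thesis by (rule regular_case_q_tendsto_zero) (rule B)
  next
    assume "rapid_case (D 1) q"
    then show ?thesis by (rule rapid_case_q_tendsto_zero[OF _ _ h_top]) (rule B)
  qed
  interpret convex_tail p g q "D 1" "D 2" B
    by (rule convex_tail.intro) (use p_eq p_meas p_mass assms(5,6,8) gd hd B q0 curv in auto)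
  have mean: "\<forall>\<^sub>F n in sequentially. tmean (t n) = a n" using assms(12) unfolding tilt_mean_eq[OF X1] .
  interpret T: tilted_asymptotics p t a "2 * exp (B + 1/4 + 1/8)" "1/8" "exp (- B - 3) / 6"
    by (rule tilted_asymptotics_at_top(1)[OF assms(11) mean])
  have s_eq: "tilt_sd M (X 1) (t n) = T.s n" for n by (simp only: tilt_sd_eq[OF X1] T.s_def)
  have sv: "(T.s n)\<^sup>2 = tvar (t n)" for n using tvar_pos[of "t n"] by (simp add: T.s_def)
  have approx: "approx_density M (X 1) p n (a n) (t n) =
      normal_tilt p ((t n + T.slope n) * ((real n - 1) * (T.s n)\<^sup>2) + a n)
       (sqrt ((real n - 1) * (T.s n)\<^sup>2))" for n
    by (simp only: approx_density_def Let_def s_eq tilt_mu3_eq[OF X1] T.slope_def)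
  have spread: "(\<lambda>n. (T.s n)\<^sup>2 / real n) \<longlonglongrightarrow> 0" if "limsup (\<lambda>n. ereal (a n / (T.s n * sqrt (real n)))) < \<infinity>"
    using tilted_asymptotics_at_top(2)[OF assms(11) mean] that unfolding sv[symmetric]
    by (intro spread_of_limsup[OF T.s_pos assms(11)]) auto
  show ?thesis
    unfolding s_eq tilted_density_eq[OF X1] approx
    using T.tilted_approximation T.normal_tilt_approximation[OF spread] by blast
qed

end
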